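(* Every finite subgroup $H<\mathcal G$ leaves some simplex of $X(\mathcal G)$ invariant (and fixes its barycenter). In particular, there are only finitely many conjugacy classes of finite subgroups in $\mathcal G$.
   Context: Let $\mathcal A$ be an Artin group of finite type with generating set $S$ and associated finite Coxeter group $\mathcal W$; $\mathcal A^+$ is the submonoid generated by $S$, and $x<y$ means $y=xz$ with $z\in\mathcal A^+$. An atom is an element of $\mathcal A^+$ whose $S$-word length equals the length of its image in $\mathcal W$; $\Delta$ is the atom mapping to the longest element of $\mathcal W$ ($\Delta^2$ central). For $g\in\mathcal A^+$, $\alpha(g)$ is the largest (for $<$) atom with $\alpha(g)<g$; the normal form of $g$ is $g=A_1\cdot\ldots\cdot A_k$ with nontrivial atoms and $A_i=\alpha(A_i\cdots A_k)$. Let $\mathcal G=\mathcal A/\langle\Delta^2\rangle$ act on $V=\mathcal A/\langle\Delta\rangle$ by left multiplication, $*=\langle\Delta\rangle$. Each $v\in V$ has a unique special representative in $\mathcal A^+$ whose normal form contains no $\Delta$; $|v|$ is its number of atoms and $d_{at}(v,w)=|g^{-1}w|$ for $g( * )=v$. $X(\mathcal G)$ is the simplicial complex on $V$ whose simplices are finite vertex sets pairwise at $d_{at}=1$; $\mathcal G$ acts on it simplicially. *)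

theory Defs
  imports "HOL-Algebra.Coset" "HOL-Algebra.Generated_Groups"
begin

section \<open>Coxeter matrices (0 encodes infinity)\<close>

definition coxeter_matrix :: "'a set \<Rightarrow> ('a \<Rightarrow> 'a \<Rightarrow> nat) \<Rightarrow> bool" where
  "coxeter_matrix S m \<longleftrightarrow>
     (\<forall>s\<in>S. m s s = 1) \<and>
     (\<forall>s\<in>S. \<forall>t\<in>S. m s t = m t s) \<and>
     (\<forall>s\<in>S. \<forall>t\<in>S. s \<noteq> t \<longrightarrow> (m s t = 0 \<or> m s t \<ge> 2))"

fun alt :: "'a \<Rightarrow> 'a \<Rightarrow> nat \<Rightarrow> 'a list" where
  "alt s t 0 = []"
| "alt s t (Suc n) = s # alt t s n"

text \<open>A letter (s, True) is the generator s, (s, False) its inverse.\<close>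

definition pos :: "'a list \<Rightarrow> ('a \<times> bool) list" where
  "pos w = map (\<lambda>x. (x, True)) w"

inductive art_eq :: "'a set \<Rightarrow> ('a \<Rightarrow> 'a \<Rightarrow> nat) \<Rightarrow> ('a \<times> bool) list \<Rightarrow> ('a \<times> bool) list \<Rightarrow> bool"
  for S m where
  refl: "set w \<subseteq> S \<times> UNIV \<Longrightarrow> art_eq S m w w"
| sym: "art_eq S m x y \<Longrightarrow> art_eq S m y x"
| trans: "art_eq S m x y \<Longrightarrow> art_eq S m y z \<Longrightarrow> art_eq S m x z"
| free: "s \<in> S \<Longrightarrow> set u \<subseteq> S \<times> UNIV \<Longrightarrow> set v \<subseteq> S \<times> UNIV \<Longrightarrow>
          art_eq S m (u @ [(s, b), (s, \<not> b)] @ v) (u @ v)"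
| braid: "s \<in> S \<Longrightarrow> t \<in> S \<Longrightarrow> m s t \<noteq> 0 \<Longrightarrow> set u \<subseteq> S \<times> UNIV \<Longrightarrow> set v \<subseteq> S \<times> UNIV \<Longrightarrow>
          art_eq S m (u @ pos (alt s t (m s t)) @ v) (u @ pos (alt t s (m s t)) @ v)"

definition art_rel :: "'a set \<Rightarrow> ('a \<Rightarrow> 'a \<Rightarrow> nat) \<Rightarrow> (('a \<times> bool) list \<times> ('a \<times> bool) list) set" where
  "art_rel S m = {(x, y). art_eq S m x y}"

type_synonym 'a artin_elt = "('a \<times> bool) list set"

definition artin :: "'a set \<Rightarrow> ('a \<Rightarrow> 'a \<Rightarrow> nat) \<Rightarrow> 'a artin_elt monoid" where
  "artin S m = \<lparr> carrier = {w. set w \<subseteq> S \<times> UNIV} // art_rel S m,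
                 mult = (\<lambda>X Y. art_rel S m `` {x @ y | x y. x \<in> X \<and> y \<in> Y}),
                 one = art_rel S m `` {[]} \<rparr>"

inductive cox_eq :: "'a set \<Rightarrow> ('a \<Rightarrow> 'a \<Rightarrow> nat) \<Rightarrow> 'a list \<Rightarrow> 'a list \<Rightarrow> bool"
  for S m where
  refl: "set w \<subseteq> S \<Longrightarrow> cox_eq S m w w"
| sym: "cox_eq S m x y \<Longrightarrow> cox_eq S m y x"
| trans: "cox_eq S m x y \<Longrightarrow> cox_eq S m y z \<Longrightarrow> cox_eq S m x z"
| square: "s \<in> S \<Longrightarrow> set u \<subseteq> S \<Longrightarrow> set v \<subseteq> S \<Longrightarrow> cox_eq S m (u @ [s, s] @ v) (u @ v)"
| braid: "s \<in> S \<Longrightarrow> t \<in> S \<Longrightarrow> m s t \<noteq> 0 \<Longrightarrow> set u \<subseteq> S \<Longrightarrow> set v \<subseteq> S \<Longrightarrow>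
          cox_eq S m (u @ alt s t (m s t) @ v) (u @ alt t s (m s t) @ v)"

definition cox_rel :: "'a set \<Rightarrow> ('a \<Rightarrow> 'a \<Rightarrow> nat) \<Rightarrow> ('a list \<times> 'a list) set" where
  "cox_rel S m = {(x, y). cox_eq S m x y}"

definition coxeter_elems :: "'a set \<Rightarrow> ('a \<Rightarrow> 'a \<Rightarrow> nat) \<Rightarrow> 'a list set set" where
  "coxeter_elems S m = {w. set w \<subseteq> S} // cox_rel S m"

definition cox_len :: "'a list set \<Rightarrow> nat" where
  "cox_len x = (LEAST n. \<exists>w\<in>x. length w = n)"

definition finite_type :: "'a set \<Rightarrow> ('a \<Rightarrow> 'a \<Rightarrow> nat) \<Rightarrow> bool" where
  "finite_type S m \<longleftrightarrow> finite S \<and> coxeter_matrix S m \<and> finite (coxeter_elems S m)"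

definition longest :: "'a set \<Rightarrow> ('a \<Rightarrow> 'a \<Rightarrow> nat) \<Rightarrow> 'a list set" where
  "longest S m = (THE x. x \<in> coxeter_elems S m \<and> (\<forall>y\<in>coxeter_elems S m. cox_len y \<le> cox_len x))"

definition to_cox :: "'a set \<Rightarrow> ('a \<Rightarrow> 'a \<Rightarrow> nat) \<Rightarrow> 'a artin_elt \<Rightarrow> 'a list set" where
  "to_cox S m X = cox_rel S m `` (map fst ` X)"

definition posword :: "('a \<times> bool) list \<Rightarrow> bool" where
  "posword w \<longleftrightarrow> (\<forall>l\<in>set w. snd l)"

definition artin_pos :: "'a set \<Rightarrow> ('a \<Rightarrow> 'a \<Rightarrow> nat) \<Rightarrow> 'a artin_elt set" where
  "artin_pos S m = {X \<in> carrier (artin S m). \<exists>w\<in>X. posword w}"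

definition pos_len :: "'a artin_elt \<Rightarrow> nat" where
  "pos_len X = (LEAST n. \<exists>w\<in>X. posword w \<and> length w = n)"

definition pleq :: "'a set \<Rightarrow> ('a \<Rightarrow> 'a \<Rightarrow> nat) \<Rightarrow> 'a artin_elt \<Rightarrow> 'a artin_elt \<Rightarrow> bool" where
  "pleq S m x y \<longleftrightarrow> (\<exists>z\<in>artin_pos S m. y = x \<otimes>\<^bsub>artin S m\<^esub> z)"

definition atom :: "'a set \<Rightarrow> ('a \<Rightarrow> 'a \<Rightarrow> nat) \<Rightarrow> 'a artin_elt \<Rightarrow> bool" where
  "atom S m X \<longleftrightarrow> X \<in> artin_pos S m \<and> pos_len X = cox_len (to_cox S m X)"

definition Delta :: "'a set \<Rightarrow> ('a \<Rightarrow> 'a \<Rightarrow> nat) \<Rightarrow> 'a artin_elt" where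
  "Delta S m = (THE X. atom S m X \<and> to_cox S m X = longest S m)"

definition alpha :: "'a set \<Rightarrow> ('a \<Rightarrow> 'a \<Rightarrow> nat) \<Rightarrow> 'a artin_elt \<Rightarrow> 'a artin_elt" where
  "alpha S m g = (THE a. atom S m a \<and> pleq S m a g \<and> (\<forall>b. atom S m b \<and> pleq S m b g \<longrightarrow> pleq S m b a))"

definition aprod :: "'a set \<Rightarrow> ('a \<Rightarrow> 'a \<Rightarrow> nat) \<Rightarrow> 'a artin_elt list \<Rightarrow> 'a artin_elt" where
  "aprod S m L = foldr (\<lambda>x y. x \<otimes>\<^bsub>artin S m\<^esub> y) L \<one>\<^bsub>artin S m\<^esub>"

definition normal_form :: "'a set \<Rightarrow> ('a \<Rightarrow> 'a \<Rightarrow> nat) \<Rightarrow> 'a artin_elt \<Rightarrow> 'a artin_elt list" where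
  "normal_form S m g = (THE L. (\<forall>a\<in>set L. atom S m a \<and> a \<noteq> \<one>\<^bsub>artin S m\<^esub>) \<and>
      aprod S m L = g \<and> (\<forall>i<length L. L ! i = alpha S m (aprod S m (drop i L))))"

definition DeltaGrp :: "'a set \<Rightarrow> ('a \<Rightarrow> 'a \<Rightarrow> nat) \<Rightarrow> 'a artin_elt set" where
  "DeltaGrp S m = generate (artin S m) {Delta S m}"

definition Delta2Grp :: "'a set \<Rightarrow> ('a \<Rightarrow> 'a \<Rightarrow> nat) \<Rightarrow> 'a artin_elt set" where
  "Delta2Grp S m = generate (artin S m) {Delta S m \<otimes>\<^bsub>artin S m\<^esub> Delta S m}"

definition Gq :: "'a set \<Rightarrow> ('a \<Rightarrow> 'a \<Rightarrow> nat) \<Rightarrow> 'a artin_elt set monoid" where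
  "Gq S m = artin S m Mod Delta2Grp S m"

definition verts :: "'a set \<Rightarrow> ('a \<Rightarrow> 'a \<Rightarrow> nat) \<Rightarrow> 'a artin_elt set set" where
  "verts S m = {g <#\<^bsub>artin S m\<^esub> DeltaGrp S m | g. g \<in> carrier (artin S m)}"

definition gact :: "'a set \<Rightarrow> ('a \<Rightarrow> 'a \<Rightarrow> nat) \<Rightarrow> 'a artin_elt set \<Rightarrow> 'a artin_elt set \<Rightarrow> 'a artin_elt set" where
  "gact S m C v = (\<Union>g\<in>C. g <#\<^bsub>artin S m\<^esub> v)"

definition special_rep :: "'a set \<Rightarrow> ('a \<Rightarrow> 'a \<Rightarrow> nat) \<Rightarrow> 'a artin_elt set \<Rightarrow> 'a artin_elt" where
  "special_rep S m v = (THE p. p \<in> artin_pos S m \<and> p \<in> v \<and> Delta S m \<notin> set (normal_form S m p))"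

definition vlen :: "'a set \<Rightarrow> ('a \<Rightarrow> 'a \<Rightarrow> nat) \<Rightarrow> 'a artin_elt set \<Rightarrow> nat" where
  "vlen S m v = length (normal_form S m (special_rep S m v))"

definition d_at :: "'a set \<Rightarrow> ('a \<Rightarrow> 'a \<Rightarrow> nat) \<Rightarrow> 'a artin_elt set \<Rightarrow> 'a artin_elt set \<Rightarrow> nat" where
  "d_at S m v w = (let g = (SOME g. g \<in> carrier (artin S m) \<and> g <#\<^bsub>artin S m\<^esub> DeltaGrp S m = v)
                   in vlen S m (inv\<^bsub>artin S m\<^esub> g <#\<^bsub>artin S m\<^esub> w))"

definition simplex :: "'a set \<Rightarrow> ('a \<Rightarrow> 'a \<Rightarrow> nat) \<Rightarrow> 'a artin_elt set set \<Rightarrow> bool" where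
  "simplex S m \<sigma> \<longleftrightarrow> \<sigma> \<subseteq> verts S m \<and> finite \<sigma> \<and> \<sigma> \<noteq> {} \<and>
     (\<forall>v\<in>\<sigma>. \<forall>w\<in>\<sigma>. v \<noteq> w \<longrightarrow> d_at S m v w = 1)"

definition subgroup_conj_class :: "('b, 'c) monoid_scheme \<Rightarrow> 'b set \<Rightarrow> 'b set set" where
  "subgroup_conj_class G H = {(\<lambda>h. g \<otimes>\<^bsub>G\<^esub> h \<otimes>\<^bsub>G\<^esub> inv\<^bsub>G\<^esub> g) ` H | g. g \<in> carrier G}"

end

theory Submission
  imports Defs Complex_Main
begin

text \<open>Order the Artin group by \<open>x \<le> y\<close> iff \<open>x\<inverse> y\<close> lies in the positive monoid. This order is invariant under
  left multiplication and under right multiplication by \<open>\<Delta>\<close>, finite sets have greatest lower bounds, and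
  there is a degree homomorphism to the integers that is positive on nontrivial positive elements. Let
  \<open>K\<close> be the preimage of a finite subgroup. The elements \<open>h \<Delta>\<^sup>j\<close> with \<open>h \<in> K\<close> and nonnegative degree
  have a greatest lower bound \<open>x\<close>, since up to powers of \<open>\<Delta>\<close> there are only finitely many of them. Then
  \<open>x \<le> h x \<Delta>\<^sup>j\<close> whenever \<open>h \<Delta>\<^sup>j\<close> has nonnegative degree, so the elements \<open>h x \<Delta>\<^sup>j\<close> form a chain. Hence
  the orbit of the vertex of \<open>x\<close> is an invariant simplex, and \<open>x\<inverse> K x\<close> consists of elements \<open>a \<Delta>\<^sup>j\<close> with
  \<open>a\<close> an atom, of which there are finitely many modulo \<open>\<Delta>\<^sup>2\<close>.

  The lattice property rests on the combinatorics of the finite Coxeter group (exchange condition,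
  Matsumoto's theorem, meets in the weak order), from which left cancellation in the positive monoid
  is obtained by tracking the largest reduced left divisor of a word.\<close>


text \<open>The pairs \<open>(h, j)\<close> of nonnegative degree form a submonoid that contains
  each pair or its inverse. This totality makes the orbit of \<open>x\<close> a chain, and comparing
  the exponents \<open>j\<close> and \<open>j - 1\<close> around the sign change of the degree traps
  the element between \<open>x\<close> and \<open>x \<Delta>\<close>. The order lives in the group,
  while divisibility can only be computed with positive words, so the positive monoid has to embed
  into the group. An inverse letter is a positive word divided by the central element \<Delta>^2;
  clearing these denominators is consistent only if powers of \<Delta>^2 can be cancelled, and this
  is where left cancellation in the monoid enters. Meets in the weak order, Matsumoto's theorem and
  gcds of positive words share one ingredient: whatever lies above two generators \<open>s\<close>
  and \<open>t\<close> lies above their alternating word of length \<open>m s t\<close>. For this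
  the word must be reduced, that is, the order of \<open>s t\<close> must not drop below
  \<open>m s t\<close>. The defining relations alone do not show this; a linear representation
  does.\<close>

lemma length_alt [simp]: "length (alt s t k) = k"
  by (induction s t k rule: alt.induct) auto

lemma set_alt: "s \<in> S \<Longrightarrow> t \<in> S \<Longrightarrow> set (alt s t k) \<subseteq> S"
  by (induction s t k rule: alt.induct) auto

lemma alt_add: "alt s t (j + k) = alt s t j @ (if even j then alt s t k else alt t s k)"
  by (induction s t j rule: alt.induct) auto

lemma rev_alt: "rev (alt s t k) = (if even k then alt t s k else alt s t k)"
proof (induction s t k rule: alt.induct)
  case (2 s t n)
  have "rev (alt s t (Suc n)) = (if even n then alt s t n else alt t s n) @ [s]"
    using 2 by simp
  also have "\<dots> = (if even n then alt s t (n + 1) else alt t s (n + 1))"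
    unfolding alt_add by simp
  finally show ?case by simp
qed auto

lemma cox_eq_set: "cox_eq S m u v \<Longrightarrow> set u \<subseteq> S \<and> set v \<subseteq> S"
  by (induction rule: cox_eq.induct) (auto dest: set_alt[THEN subsetD, rotated 2])

lemma cox_eq_ctxt:
  "cox_eq S m u v \<Longrightarrow> set x \<subseteq> S \<Longrightarrow> set y \<subseteq> S \<Longrightarrow> cox_eq S m (x @ u @ y) (x @ v @ y)"
proof (induction rule: cox_eq.induct)
  case (refl w)
  then show ?case by (simp add: cox_eq.refl)
next
  case (square s u v)
  then show ?case using cox_eq.square[of s S "x @ u" "v @ y" m] by simp
next
  case (braid s t u v)
  then show ?case using cox_eq.braid[of s S t m "x @ u" "v @ y"] by simp
qed (auto intro: cox_eq.intros)

lemma cox_eq_append: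
  assumes "cox_eq S m u u'" "cox_eq S m v v'"
  shows "cox_eq S m (u @ v) (u' @ v')"
  using cox_eq_ctxt[OF assms(1), of "[]" v] cox_eq_ctxt[OF assms(2), of u' "[]"]
    cox_eq_set[OF assms(1)] cox_eq_set[OF assms(2)] by (auto intro: cox_eq.trans)

section \<open>The contragredient geometric representation\<close>

text \<open>A functional \<open>f\<close> is stored by its values on the simple roots. This is
  \<open>f\<close> composed with the reflection \<alpha>_r -> \<alpha>_r - 2 B(s,r)
  \<alpha>_s.\<close>

definition grefl :: "('a \<Rightarrow> 'a \<Rightarrow> real) \<Rightarrow> 'a \<Rightarrow> ('a \<Rightarrow> real) \<Rightarrow> 'a \<Rightarrow> real" where
  "grefl B s f = (\<lambda>r. f r - 2 * B s r * f s)"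

definition grep :: "('a \<Rightarrow> 'a \<Rightarrow> real) \<Rightarrow> 'a list \<Rightarrow> ('a \<Rightarrow> real) \<Rightarrow> 'a \<Rightarrow> real" where
  "grep B u = foldr (grefl B) u"

text \<open>Polar coordinates for the pair \<open>(f s, f t)\<close>, skewed so that for unit roots
  with \<open>B s t = - cos \<theta>\<close> the two reflections act on the angle as
  \<open>\<phi> -> - \<phi>\<close> and \<open>\<phi> -> 2 * \<theta> - \<phi>\<close>.\<close>

definition has_angle :: "'a \<Rightarrow> 'a \<Rightarrow> real \<Rightarrow> real \<Rightarrow> ('a \<Rightarrow> real) \<Rightarrow> real \<Rightarrow> bool" where
  "has_angle s t \<theta> R f \<phi> \<longleftrightarrow> f s = R * sin \<phi> \<and> f t = R * sin (\<theta> - \<phi>)"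

lemma grep_simps [simp]:
  "grep B [] f = f" "grep B (s # u) f = grefl B s (grep B u f)"
  "grep B (u @ v) f = grep B u (grep B v f)"
  by (auto simp: grep_def)

lemma ex_has_angle:
  assumes "sin \<theta> \<noteq> 0" shows "\<exists>R \<phi>. has_angle s t \<theta> R f \<phi>"
proof -
  obtain r a where ra: "(f t + cos \<theta> * f s) / sin \<theta> = r * cos a" "f s = r * sin a"
    using polar_Ex by blast
  have "f t = sin \<theta> * (r * cos a) - cos \<theta> * (r * sin a)"
    using assms by (simp flip: ra)
  then show ?thesis using ra(2) unfolding has_angle_def
    by (intro exI[of _ r] exI[of _ a]) (simp add: sin_diff algebra_simps)
qed

lemma sin_reflect: "sin (\<theta> + a) = sin (\<theta> - a) + 2 * cos \<theta> * sin (a::real)"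
  by (simp add: sin_add sin_diff)

lemma has_angle_grefl:
  assumes "B s s = 1" "B t t = 1" "B s t = - cos \<theta>" "B t s = - cos \<theta>" "has_angle s t \<theta> R f \<phi>"
  shows "has_angle s t \<theta> R (grefl B s f) (- \<phi>)"
    and "has_angle s t \<theta> R (grefl B t f) (2 * \<theta> - \<phi>)"
proof -
  have f: "f s = R * sin \<phi>" "f t = R * sin (\<theta> - \<phi>)" using assms(5) by (auto simp: has_angle_def)
  show "has_angle s t \<theta> R (grefl B s f) (- \<phi>)"
    using assms(1-4) f by (simp add: has_angle_def grefl_def sin_add sin_diff algebra_simps)
  have "sin (2 * \<theta> - \<phi>) = sin \<phi> + 2 * cos \<theta> * sin (\<theta> - \<phi>)"
    using sin_reflect[of \<theta> "\<theta> - \<phi>"] by (simp add: algebra_simps)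
  moreover have "sin (\<theta> - (2 * \<theta> - \<phi>)) = - sin (\<theta> - \<phi>)"
    using sin_minus[of "\<theta> - \<phi>"] by (simp add: algebra_simps)
  ultimately show "has_angle s t \<theta> R (grefl B t f) (2 * \<theta> - \<phi>)"
    using assms(1-4) f by (simp add: has_angle_def grefl_def algebra_simps)
qed

text \<open>Prepending a letter to each word exchanges the roles of the two words and reflects both
  angles, so their gap grows by \<open>2 * \<theta>\<close> per letter. Only the gap matters
  later.\<close>

lemma has_angle_alt:
  assumes "B s s = 1" "B t t = 1" "B s t = - cos \<theta>" "B t s = - cos \<theta>" "has_angle s t \<theta> R f \<phi>"
  shows "\<exists>a. has_angle s t \<theta> R (grep B (alt s t k) f) a
           \<and> has_angle s t \<theta> R (grep B (alt t s k) f) (a + 2 * real k * \<theta>)"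
proof (induction k)
  case 0
  then show ?case using assms(5) by auto
next
  case (Suc k)
  then obtain a where a: "has_angle s t \<theta> R (grep B (alt s t k) f) a"
    "has_angle s t \<theta> R (grep B (alt t s k) f) (a + 2 * real k * \<theta>)" by blast
  have e: "- (a + 2 * real k * \<theta>) + 2 * real (Suc k) * \<theta> = 2 * \<theta> - a" by (simp add: algebra_simps)
  then show ?case
    using has_angle_grefl(1)[of B s t, OF assms(1-4) a(2)] has_angle_grefl(2)[of B s t, OF assms(1-4) a(1)]
    by (intro exI[of _ "- (a + 2 * real k * \<theta>)"]) (simp only: e alt.simps grep_simps simp_thms)
qed

text \<open>\<open>A\<close> and \<open>C\<close> are the coordinates of the projection of
  \<alpha>_r onto the plane of \<alpha>_s and \<alpha>_t. The remainder is orthogonal to both roots,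
  hence fixed by both reflections.\<close>

lemma grep_alt_invariant:
  assumes "B s s = 1" "B t t = 1" "B s t = - cos \<theta>" "B t s = - cos \<theta>"
    and "A - cos \<theta> * C = B s r" "C - cos \<theta> * A = B t r"
  shows "grep B (alt s t k) f r - A * grep B (alt s t k) f s - C * grep B (alt s t k) f t
       = f r - A * f s - C * f t \<and>
       grep B (alt t s k) f r - A * grep B (alt t s k) f s - C * grep B (alt t s k) f t
       = f r - A * f s - C * f t"
proof (induction k)
  case (Suc k)
  have 1: "grefl B s g r - A * grefl B s g s - C * grefl B s g t = g r - A * g s - C * g t" for g
    using assms(1-4) by (simp add: grefl_def flip: assms(5)) (simp add: algebra_simps)
  have 2: "grefl B t g r - A * grefl B t g s - C * grefl B t g t = g r - A * g s - C * g t" for g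
    using assms(1-4) by (simp add: grefl_def flip: assms(6)) (simp add: algebra_simps)
  from Suc show ?case by (simp add: 1 2)
qed simp

text \<open>After \<open>k\<close> letters the two angles differ by
  \<open>2 * k * \<theta> = 2 * pi\<close>, so both sides agree at \<open>s\<close> and
  \<open>t\<close>; the invariant of \<open>grep_alt_invariant\<close> carries the agreement over to
  every other \<open>r\<close>.\<close>

lemma grep_braid:
  assumes B: "B s s = 1" "B t t = 1" "B s t = - cos \<theta>" "B t s = - cos \<theta>"
    and \<theta>: "\<theta> = pi / k" "k \<ge> (2::nat)"
  shows "grep B (alt s t k) f = grep B (alt t s k) f"
proof -
  have "pi / k < pi" using \<theta>(2) by (simp add: divide_less_eq)
  then have "sin \<theta> > 0" unfolding \<theta>(1) using \<theta>(2) by (intro sin_gt_zero) auto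
  then have sin: "sin \<theta> \<noteq> 0" by simp
  then have cos: "1 - cos \<theta> * cos \<theta> \<noteq> 0" using sin_squared_eq[of \<theta>] by (auto simp: power2_eq_square)
  obtain R \<phi> where "has_angle s t \<theta> R f \<phi>" using ex_has_angle[OF sin, of s t f] by blast
  then obtain a where a: "has_angle s t \<theta> R (grep B (alt s t k) f) a"
    "has_angle s t \<theta> R (grep B (alt t s k) f) (a + 2 * real k * \<theta>)"
    using has_angle_alt[OF B] by blast
  have per: "2 * real k * \<theta> = 2 * pi" using \<theta> by simp
  have "sin (\<theta> - (a + 2 * pi)) = sin (\<theta> - a)"
    using sin_periodic[of "\<theta> - (a + 2 * pi)"] by (simp add: algebra_simps)
  then have st: "grep B (alt s t k) f s = grep B (alt t s k) f s"
    "grep B (alt s t k) f t = grep B (alt t s k) f t"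
    using a unfolding has_angle_def per by auto
  show ?thesis
  proof
    fix r
    \<comment> \<open>The Gram system of the two roots solved by Cramer's rule; its determinant is
      the square of \<open>sin \<theta>\<close>.\<close>
    define A where "A = (B s r + cos \<theta> * B t r) / (1 - cos \<theta> * cos \<theta>)"
    define C where "C = (B t r + cos \<theta> * B s r) / (1 - cos \<theta> * cos \<theta>)"
    have "A - cos \<theta> * C = (B s r * (1 - cos \<theta> * cos \<theta>)) / (1 - cos \<theta> * cos \<theta>)"
      unfolding A_def C_def by (simp add: algebra_simps flip: diff_divide_distrib)
    then have 1: "A - cos \<theta> * C = B s r" using cos by simp
    have "C - cos \<theta> * A = (B t r * (1 - cos \<theta> * cos \<theta>)) / (1 - cos \<theta> * cos \<theta>)"
      unfolding A_def C_def by (simp add: algebra_simps flip: diff_divide_distrib)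
    then have 2: "C - cos \<theta> * A = B t r" using cos by simp
    show "grep B (alt s t k) f r = grep B (alt t s k) f r"
      using grep_alt_invariant[of B s t \<theta> A C r k f, OF B 1 2] st by simp
  qed
qed

text \<open>The order of \<open>s t\<close> is not smaller than prescribed. A missing relation (\<open>m s t = 0\<close>) is
  represented by a finite angle as well, which may be chosen arbitrarily small.\<close>

lemma alt_not_cox_eq:
  assumes cm: "coxeter_matrix S m" and st: "s \<in> S" "t \<in> S" "s \<noteq> t"
    and i: "0 < i" "m s t = 0 \<or> i < m s t"
  shows "\<not> cox_eq S m (alt s t i) (alt t s i)"
proof
  assume eq: "cox_eq S m (alt s t i) (alt t s i)"
  \<comment> \<open>The value \<open>i + 2\<close> is at least 2 and exceeds \<open>i\<close>, so
    the replaced entries satisfy the same bounds as the finite ones.\<close>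
  define m' where "m' a b = (if m a b = 0 then i + 2 else m a b)" for a b
  define B where "B a b = - cos (pi / m' a b)" for a b
  have ge2: "m' a b \<ge> 2" if "a \<in> S" "b \<in> S" "a \<noteq> b" for a b
    using that cm unfolding coxeter_matrix_def m'_def by (metis le_add2)
  have sym: "m' a b = m' b a" if "a \<in> S" "b \<in> S" for a b
    using that cm by (auto simp: coxeter_matrix_def m'_def)
  have B1: "B a a = 1" if "a \<in> S" for a
    using that cm by (auto simp: coxeter_matrix_def m'_def B_def)
  have square: "grefl B a (grefl B a f) = f" if "a \<in> S" for a f
    using B1[OF that] by (auto simp: grefl_def fun_eq_iff algebra_simps)
  have inv: "grep B u f = grep B v f" if "cox_eq S m u v" for u v f
    using that
  proof (induction arbitrary: f rule: cox_eq.induct)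
    case (square s u v)
    then show ?case using \<open>\<And>a f. a \<in> S \<Longrightarrow> grefl B a (grefl B a f) = f\<close> by simp
  next
    case (braid a b u v)
    show ?case
    proof (cases "a = b")
      case False
      have "m' a b = m a b" using braid by (simp add: m'_def)
      then have "grep B (alt a b (m a b)) g = grep B (alt b a (m a b)) g" for g
        using braid False B1 ge2[of a b] sym[of a b]
        by (intro grep_braid[where \<theta> = "pi / m a b"]) (auto simp: B_def)
      then show ?thesis by simp
    qed simp
  qed auto
  define \<theta> where "\<theta> = pi / m' s t"
  have k: "m' s t \<ge> 2" "i < m' s t" using ge2[OF st] i by (auto simp: m'_def)
  have "pi / m' s t < pi" using k by (simp add: divide_less_eq)
  then have "sin \<theta> > 0" unfolding \<theta>_def using k by (intro sin_gt_zero) auto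
  then have sin: "sin \<theta> \<noteq> 0" by simp
  \<comment> \<open>A test functional of radius 1 and angle 0.\<close>
  define f where "f r = (if r = s then 0 else sin \<theta>)" for r
  have "has_angle s t \<theta> 1 f 0" using st by (auto simp: has_angle_def f_def)
  then obtain a where a: "has_angle s t \<theta> 1 (grep B (alt s t i) f) a"
    "has_angle s t \<theta> 1 (grep B (alt t s i) f) (a + 2 * real i * \<theta>)"
    using has_angle_alt[of B s t \<theta> 1 f 0 i] B1 st sym[of s t] by (auto simp: B_def \<theta>_def)
  \<comment> \<open>Equal values at \<open>s\<close> and \<open>t\<close> make the gap
    \<open>b\<close> a multiple of a full turn, although it lies strictly between 0 and
    \<open>2 * pi\<close>.\<close>
  define b where "b = 2 * real i * \<theta>"
  have eqs: "sin a = sin (a + b)" "sin (\<theta> - a) = sin (\<theta> - (a + b))"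
    using a inv[OF eq, of f] by (auto simp: has_angle_def b_def)
  then have "sin \<theta> * cos a = sin \<theta> * cos (a + b)" by (simp add: sin_diff)
  then have "cos a = cos (a + b)" using sin by simp
  then have "cos b = cos a * cos a + sin a * sin a"
    using cos_diff[of "a + b" a] eqs by simp
  then have "cos b = 1" by (metis sin_cos_squared_add3)
  then obtain n :: int where n: "b = n * 2 * pi" using cos_one_2pi_int by auto
  have "0 < b" using i(1) k by (auto simp: b_def \<theta>_def)
  moreover have "b < 2 * pi" using k by (auto simp: b_def \<theta>_def divide_less_eq)
  ultimately have "0 < real_of_int n" "real_of_int n < 1" unfolding n by (auto simp: zero_less_mult_iff)
  then have "0 < n" "n < 1" by simp_all
  then show False by linarith
qed

section \<open>Bijections as a group\<close>

text \<open>A concrete type of class \<open>group_add\<close>, in which the Coxeter group will be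
  realized by permutations of its own elements.\<close>

typedef 'b bijection = "{f :: 'b \<Rightarrow> 'b. bij f}"
  by (rule exI[of _ id]) auto

instantiation bijection :: (type) group_add
begin

definition "0 = Abs_bijection id"
definition "f + g = Abs_bijection (Rep_bijection f \<circ> Rep_bijection g)"
definition "- f = Abs_bijection (inv_into UNIV (Rep_bijection f))"
definition "f - g = f + - (g :: 'a bijection)"

instance
proof
  have b: "bij (Rep_bijection f)" for f :: "'a bijection" using Rep_bijection by auto
  fix f g h :: "'a bijection"
  show "f + g + h = f + (g + h)"
    by (simp add: plus_bijection_def Abs_bijection_inverse bij_comp b o_assoc)
  show "0 + f = f" "f + 0 = f"
    by (simp_all add: plus_bijection_def zero_bijection_def Abs_bijection_inverse Rep_bijection_inverse)
  show "- f + f = 0"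
    using b[of f] by (simp add: plus_bijection_def uminus_bijection_def zero_bijection_def
        Abs_bijection_inverse bij_imp_bij_inv bij_is_inj)
  show "f + - g = f - g" by (simp add: minus_bijection_def)
qed

end

section \<open>Coxeter groups: exchange and weak order\<close>

text \<open>The group is written additively since \<open>group_add\<close> is the type class of (noncommutative) groups.\<close>

locale coxeter_group =
  fixes S :: "'a set" and m :: "'a \<Rightarrow> 'a \<Rightarrow> nat" and gen :: "'a \<Rightarrow> 'g::group_add"
  assumes cm: "coxeter_matrix S m"
    and gen_eq_iff: "\<lbrakk>set u \<subseteq> S; set v \<subseteq> S\<rbrakk> \<Longrightarrow>
      sum_list (map gen u) = sum_list (map gen v) \<longleftrightarrow> cox_eq S m u v"
begin

definition ev :: "'a list \<Rightarrow> 'g" where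
  "ev u = sum_list (map gen u)"

definition W :: "'g set" where
  "W = ev ` {u. set u \<subseteq> S}"

definition len :: "'g \<Rightarrow> nat" where
  "len w = (LEAST n. \<exists>u. set u \<subseteq> S \<and> ev u = w \<and> length u = n)"

definition wle :: "'g \<Rightarrow> 'g \<Rightarrow> bool" (infix \<open>\<preceq>\<close> 50) where
  "x \<preceq> y \<longleftrightarrow> x \<in> W \<and> y \<in> W \<and> len y = len x + len (- x + y)"

text \<open>For a word \<open>s1 ... sn\<close> these are the reflections
  \<open>s1 ... si ... s1\<close>. In a reduced word they are the inversions of the element; in
  general only the parity of each multiplicity is an invariant.\<close>

fun refls :: "'a list \<Rightarrow> 'g list" where
  "refls [] = []"
| "refls (s # u) = gen s # map (\<lambda>t. gen s + t - gen s) (refls u)"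

lemma ev_simps [simp]: "ev [] = 0" "ev (s # u) = gen s + ev u" "ev (u @ v) = ev u + ev v"
  by (auto simp: ev_def)

lemma ev_eq_iff: "\<lbrakk>set u \<subseteq> S; set v \<subseteq> S\<rbrakk> \<Longrightarrow> ev u = ev v \<longleftrightarrow> cox_eq S m u v"
  unfolding ev_def by (rule gen_eq_iff)

lemma evI: "cox_eq S m u v \<Longrightarrow> ev u = ev v"
  using ev_eq_iff cox_eq_set by blast

lemma gen_gen: "s \<in> S \<Longrightarrow> gen s + gen s = 0"
  using evI[of "[] @ [s, s] @ []" "[] @ []"] cox_eq.square[of s S "[]" "[]" m] by simp

lemma gen_gen_add: "s \<in> S \<Longrightarrow> gen s + (gen s + x) = x"
  by (simp add: gen_gen flip: add.assoc)

lemma uminus_gen: "s \<in> S \<Longrightarrow> - gen s = gen s"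
  using gen_gen by (intro minus_unique)

lemma ev_braid: "s \<in> S \<Longrightarrow> t \<in> S \<Longrightarrow> m s t \<noteq> 0 \<Longrightarrow> ev (alt s t (m s t)) = ev (alt t s (m s t))"
  using evI[of "[] @ alt s t (m s t) @ []" "[] @ alt t s (m s t) @ []"]
    cox_eq.braid[of s S t m "[]" "[]"] by simp

lemma ev_rev: "set u \<subseteq> S \<Longrightarrow> ev (rev u) = - ev u"
  by (induction u) (auto simp: uminus_gen minus_add)

lemma W_ev [simp]: "set u \<subseteq> S \<Longrightarrow> ev u \<in> W"
  by (auto simp: W_def)

lemma W_gen [simp]: "s \<in> S \<Longrightarrow> gen s \<in> W"
  using W_ev[of "[s]"] by simp

lemma W_zero [simp]: "0 \<in> W"
  using W_ev[of "[]"] by simp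

lemma W_add [simp]: "x \<in> W \<Longrightarrow> y \<in> W \<Longrightarrow> x + y \<in> W"
proof -
  assume "x \<in> W" "y \<in> W"
  then obtain u v where "set u \<subseteq> S" "x = ev u" "set v \<subseteq> S" "y = ev v" by (auto simp: W_def)
  then show ?thesis using W_ev[of "u @ v"] by simp
qed

lemma W_uminus [simp]: "x \<in> W \<Longrightarrow> - x \<in> W"
proof -
  assume "x \<in> W"
  then obtain u where "set u \<subseteq> S" "x = ev u" by (auto simp: W_def)
  then show ?thesis using W_ev[of "rev u"] ev_rev[of u] by simp
qed

lemma reduced_word:
  assumes "w \<in> W" obtains u where "set u \<subseteq> S" "ev u = w" "length u = len w"
proof -
  have "\<exists>n u. set u \<subseteq> S \<and> ev u = w \<and> length u = n" using assms by (auto simp: W_def)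
  from LeastI_ex[OF this] show ?thesis using that by (auto simp: len_def)
qed

lemma len_le: "set u \<subseteq> S \<Longrightarrow> len (ev u) \<le> length u"
  unfolding len_def by (rule Least_le) auto

lemma len_add: "x \<in> W \<Longrightarrow> y \<in> W \<Longrightarrow> len (x + y) \<le> len x + len y"
proof -
  assume "x \<in> W" "y \<in> W"
  then obtain u v where "set u \<subseteq> S" "x = ev u" "length u = len x" "set v \<subseteq> S" "y = ev v" "length v = len y"
    by (metis reduced_word)
  then show ?thesis using len_le[of "u @ v"] by simp
qed

lemma len_uminus: "x \<in> W \<Longrightarrow> len (- x) = len x"
proof -
  have "len (- x) \<le> len x" if "x \<in> W" for x
    by (metis that reduced_word len_le ev_rev length_rev set_rev)
  from this[of x] this[of "- x"] show "x \<in> W \<Longrightarrow> len (- x) = len x" by simp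
qed

lemma len_zero [simp]: "len 0 = 0"
  using len_le[of "[]"] by simp

lemma len_eq_0: "x \<in> W \<Longrightarrow> len x = 0 \<longleftrightarrow> x = 0"
  by (metis reduced_word length_0_conv ev_simps(1) len_zero)

lemma even_length: "cox_eq S m u v \<Longrightarrow> even (length u) = even (length v)"
  by (induction rule: cox_eq.induct) auto

lemma len_parity: "set u \<subseteq> S \<Longrightarrow> even (len (ev u)) = even (length u)"
  by (metis W_ev reduced_word ev_eq_iff even_length)

lemma len_gen_add:
  assumes "s \<in> S" "x \<in> W"
  shows "len (gen s + x) = len x + 1 \<or> len x = len (gen s + x) + 1"
proof -
  obtain u where u: "set u \<subseteq> S" "ev u = x" using assms by (auto simp: W_def)
  have "len (gen s) \<le> 1" using len_le[of "[s]"] assms by simp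
  then have "len (gen s + x) \<le> len x + 1" "len x \<le> len (gen s + x) + 1"
    using len_add[of "gen s" x] len_add[of "gen s" "gen s + x"] assms gen_gen_add by auto
  moreover have "len (gen s + x) \<noteq> len x"
    using len_parity[of u] len_parity[of "s # u"] u assms by auto
  ultimately show ?thesis by linarith
qed

lemma len_gen: "s \<in> S \<Longrightarrow> len (gen s) = 1"
  using len_gen_add[of s 0] by simp

section \<open>Reflection sequences and the exchange condition\<close>

lemma refls_append: "refls (u @ v) = refls u @ map (\<lambda>t. ev u + t - ev u) (refls v)"
  by (induction u) (simp_all add: diff_conv_add_uminus minus_add add.assoc o_def del: add_uminus_conv_diff)

lemma count_list_map_inj: "inj f \<Longrightarrow> count_list (map f xs) (f x) = count_list xs x"
  by (induction xs) (auto dest: injD)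

lemma count_refls_append:
  "count_list (refls (u @ v)) t = count_list (refls u) t + count_list (refls v) (- ev u + t + ev u)"
proof -
  let ?f = "\<lambda>t. ev u + t - ev u"
  have "inj ?f"
  proof (rule injI)
    fix x y assume "?f x = ?f y"
    then have "?f x + ev u = ?f y + ev u" by (rule arg_cong)
    then show "x = y" by (simp only: diff_add_cancel add_left_cancel)
  qed
  from count_list_map_inj[OF this, of "refls v" "- ev u + t + ev u"]
  have "count_list (map ?f (refls v)) t = count_list (refls v) (- ev u + t + ev u)"
    by (simp only: add.assoc diff_conv_add_uminus add_minus_cancel add.right_inverse add_0_right)
  then show ?thesis by (simp add: refls_append)
qed

lemma refls_alt: "s \<in> S \<Longrightarrow> t \<in> S \<Longrightarrow> refls (alt s t k) = map (\<lambda>i. ev (alt s t (2 * i + 1))) [0..<k]"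
proof (induction s t k rule: alt.induct)
  case (2 s t n)
  have alt: "alt s t (2 * Suc i + 1) = s # alt t s (2 * i + 1) @ [s]" for i
  proof -
    have "2 * Suc i + 1 = Suc (2 * i + 1) + 1" by simp
    then have "alt s t (2 * Suc i + 1) = alt s t (Suc (2 * i + 1)) @ [s]"
      using alt_add[of s t "Suc (2 * i + 1)" 1] by (simp del: alt.simps(2) add: alt.simps(2)[of s t 0])
    then show ?thesis by simp
  qed
  have conj: "gen s + ev (alt t s (2 * i + 1)) - gen s = ev (alt s t (2 * Suc i + 1))" for i
    unfolding alt ev_simps add_0_right diff_conv_add_uminus uminus_gen[OF 2(2)] add.assoc by (rule HOL.refl)
  have "refls (alt s t (Suc n)) = gen s # map (\<lambda>i. gen s + ev (alt t s (2 * i + 1)) - gen s) [0..<n]"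
    unfolding alt.simps(2)[of s t n] refls.simps 2(1)[OF 2(3,2)] map_map o_def by (rule HOL.refl)
  also have "\<dots> = ev (alt s t (2 * 0 + 1)) # map (\<lambda>i. ev (alt s t (2 * Suc i + 1))) [0..<n]"
    unfolding conj by simp
  also have "\<dots> = map (\<lambda>i. ev (alt s t (2 * i + 1))) [0..<Suc n]"
    unfolding map_upt_Suc by (rule HOL.refl)
  finally show ?case .
qed simp

lemma ev_alt_twice:
  assumes "s \<in> S" "t \<in> S" "ev (alt s t k) = ev (alt t s k)"
  shows "ev (alt s t (2 * k)) = 0"
proof -
  have "- ev (alt s t k) = ev (rev (alt s t k))"
    using ev_rev set_alt[of s S t k] assms by simp
  also have "\<dots> = ev (alt s t k)" using assms by (simp add: rev_alt)
  finally have "ev (alt s t k) + ev (alt s t k) = 0" by (metis add.right_inverse)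
  then show ?thesis using assms by (simp add: mult_2 alt_add)
qed

text \<open>The alternating word of length \<open>2 * m s t\<close> is trivial. Splitting it after
  \<open>2 * i + 1\<close> letters gives two odd palindromes that are inverse to each other, hence
  equal reflections; one belongs to either side, at mirrored positions.\<close>

lemma refls_braid:
  assumes "s \<in> S" "t \<in> S" "m s t \<noteq> 0"
  shows "refls (alt s t (m s t)) = rev (refls (alt t s (m s t)))"
proof -
  let ?m = "m s t"
  have *: "ev (alt s t (2 * i + 1)) = ev (alt t s (2 * (?m - Suc i) + 1))" if "i < ?m" for i
  proof -
    define j where "j = 2 * (?m - Suc i) + 1"
    have "odd j" by (simp add: j_def)
    have "2 * ?m = (2 * i + 1) + j" using that by (auto simp: j_def)
    then have "ev (alt s t (2 * i + 1)) + ev (alt t s j) = ev (alt s t (2 * ?m))"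
      using arg_cong[OF alt_add[of s t "2 * i + 1" j], of ev] by (simp del: alt.simps)
    also have "\<dots> = 0" using assms ev_braid by (intro ev_alt_twice) auto
    finally have "ev (alt s t (2 * i + 1)) = - ev (alt t s j)" by (simp add: eq_neg_iff_add_eq_0)
    also have "\<dots> = ev (rev (alt t s j))" using assms set_alt[of t S s j] by (simp add: ev_rev)
    also have "\<dots> = ev (alt t s j)" using \<open>odd j\<close> by (simp add: rev_alt)
    finally show ?thesis by (simp add: j_def)
  qed
  show ?thesis using assms
  proof (intro nth_equalityI)
    fix i assume "i < length (refls (alt s t ?m))"
    then have i: "i < ?m" using assms by (simp add: refls_alt del: alt.simps)
    then have "rev (refls (alt t s ?m)) ! i = ev (alt t s (2 * (?m - Suc i) + 1))"
      using assms by (simp add: refls_alt rev_nth del: alt.simps)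
    then show "refls (alt s t ?m) ! i = rev (refls (alt t s ?m)) ! i"
      using assms i *[OF i] by (simp add: refls_alt del: alt.simps)
  qed (use assms in \<open>simp add: refls_alt\<close>)
qed

text \<open>A square contributes one reflection twice and a braid relation merely reverses a block,
  so the parity depends on the group element only.\<close>

lemma even_count_refls:
  "cox_eq S m u v \<Longrightarrow> even (count_list (refls u) x) \<longleftrightarrow> even (count_list (refls v) x)"
proof (induction arbitrary: x rule: cox_eq.induct)
  case (square s u v)
  have r: "refls [s, s] = [gen s, gen s]" by (simp only: refls.simps list.map add_diff_cancel)
  have "even (count_list (refls [s, s]) t)" for t unfolding r by simp
  moreover have "ev [s, s] = 0" using square by (simp only: ev_simps add_0_right gen_gen)
  ultimately show ?case by (simp only: count_refls_append minus_zero add_0_right add_0_left even_add simp_thms)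
next
  case (braid s t u v)
  have "count_list (refls (alt s t (m s t))) x = count_list (refls (alt t s (m s t))) x" for x
    using refls_braid[of s t] braid by (simp del: alt.simps)
  moreover have "ev (alt s t (m s t)) = ev (alt t s (m s t))" by (rule ev_braid[OF braid(1-3)])
  ultimately show ?case by (simp only: count_refls_append)
qed auto

text \<open>Multiplying by the reflection at position \<open>i\<close> deletes the letter at
  position \<open>i\<close>.\<close>

lemma in_reflsD:
  "t \<in> set (refls u) \<Longrightarrow> \<exists>u1 r u2. u = u1 @ r # u2 \<and> t + ev u = ev (u1 @ u2)" if "set u \<subseteq> S"
  using that
proof (induction u arbitrary: t)
  case (Cons s u)
  then have s: "s \<in> S" "set u \<subseteq> S" by auto
  show ?case
  proof (cases "t = gen s")
    case True
    then show ?thesis using s by (intro exI[of _ "[]"]) (auto simp: gen_gen_add)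
  next
    case False
    then obtain t' where t': "t' \<in> set (refls u)" "t = gen s + t' - gen s" using Cons.prems by auto
    then obtain u1 r u2 where u: "u = u1 @ r # u2" "t' + ev u = ev (u1 @ u2)"
      using Cons.IH s by blast
    have "t + ev (s # u) = gen s + (t' + ev u)"
      using t' s by (simp only: add.assoc diff_conv_add_uminus uminus_gen gen_gen_add ev_simps)
    then show ?thesis using u by (intro exI[of _ "s # u1"] exI[of _ r] exI[of _ u2]) (simp add: add.assoc)
  qed
qed simp

text \<open>Otherwise \<open>gen s\<close> occurs exactly once in \<open>refls (s # u)\<close>. By
  parity it then occurs in the sequence of a reduced word \<open>v\<close> of
  \<open>gen s + ev u\<close>, so multiplying by it shortens \<open>v\<close>; but the product is
  \<open>ev u\<close>, which is longer.\<close>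

lemma refls_exchange:
  assumes s: "s \<in> S" and u: "set u \<subseteq> S" and l: "len (gen s + ev u) < len (ev u)"
  shows "gen s \<in> set (refls u)"
proof (rule ccontr)
  assume "gen s \<notin> set (refls u)"
  then have 1: "count_list (refls (s # u)) (gen s) = 1"
    using count_refls_append[of "[s]" u "gen s"] s by (simp add: gen_gen)
  obtain v where v: "set v \<subseteq> S" "ev v = gen s + ev u" "length v = len (gen s + ev u)"
    by (rule reduced_word[OF W_add[OF W_gen[OF s] W_ev[OF u]]])
  have "cox_eq S m (s # u) v" using v s u ev_eq_iff[of "s # u" v] by simp
  then have "odd (count_list (refls v) (gen s))" using even_count_refls 1 by (metis odd_one)
  then have "gen s \<in> set (refls v)" by (metis count_notin even_zero)
  then obtain v1 r v2 where "v = v1 @ r # v2" "gen s + ev v = ev (v1 @ v2)" using in_reflsD v by blast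
  then have "len (ev u) < length v"
    using len_le[of "v1 @ v2"] v s by (simp add: gen_gen_add)
  then show False using l v by simp
qed

lemma exchange:
  assumes "s \<in> S" "set u \<subseteq> S" "len (gen s + ev u) < len (ev u)"
  obtains u1 r u2 where "u = u1 @ r # u2" "gen s + ev u = ev (u1 @ u2)"
  using in_reflsD[OF assms(2) refls_exchange[OF assms]] by blast

section \<open>The weak order by reduced prefixes\<close>

lemma wleD: "x \<preceq> y \<Longrightarrow> x \<in> W" "x \<preceq> y \<Longrightarrow> y \<in> W" "x \<preceq> y \<Longrightarrow> len y = len x + len (- x + y)"
  by (auto simp: wle_def)

lemma wleI: "x \<in> W \<Longrightarrow> z \<in> W \<Longrightarrow> len (x + z) = len x + len z \<Longrightarrow> x \<preceq> x + z"
  by (auto simp: wle_def)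

lemma wleE:
  assumes "x \<preceq> y"
  obtains z where "x \<in> W" "z \<in> W" "y = x + z" "len (x + z) = len x + len z"
proof
  show "y = x + (- x + y)" by simp
qed (use assms in \<open>auto simp: wle_def\<close>)

lemma wle_refl [simp]: "x \<in> W \<Longrightarrow> x \<preceq> x"
  by (auto simp: wle_def)

lemma wle_zero [simp]: "x \<in> W \<Longrightarrow> 0 \<preceq> x"
  by (auto simp: wle_def)

lemma wle_trans:
  assumes "x \<preceq> y" "y \<preceq> z" shows "x \<preceq> z"
proof -
  have W: "x \<in> W" "y \<in> W" "z \<in> W" using assms by (auto simp: wle_def)
  have "- x + z = (- x + y) + (- y + z)" by (simp add: add.assoc)
  then have "len (- x + z) \<le> len (- x + y) + len (- y + z)" using len_add[of "- x + y" "- y + z"] W by simp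
  moreover have "len z \<le> len x + len (- x + z)" using len_add[of x "- x + z"] W by simp
  ultimately show ?thesis using assms W by (auto simp: wle_def)
qed

lemma wle_len: "x \<preceq> y \<Longrightarrow> len x \<le> len y"
  by (auto simp: wle_def)

lemma wle_antisym: assumes "x \<preceq> y" "y \<preceq> x" shows "x = y"
proof -
  have "len (- x + y) = 0" using assms by (auto simp: wle_def)
  then have "- x + y = 0" using assms len_eq_0 by (auto simp: wle_def)
  then show ?thesis by (simp add: add_eq_0_iff)
qed

lemma wle_add_left:
  assumes "w \<in> W" "len (w + x) = len w + len x" "len (w + y) = len w + len y" "x \<in> W" "y \<in> W"
  shows "w + x \<preceq> w + y \<longleftrightarrow> x \<preceq> y"
proof -
  have "- (w + x) + (w + y) = - x + y" by (simp only: minus_add add.assoc minus_add_cancel)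
  then show ?thesis using assms by (auto simp: wle_def)
qed

lemma len_add_down:
  assumes "x \<preceq> y" "w \<in> W" "len (w + y) = len w + len y"
  shows "len (w + x) = len w + len x"
proof -
  have W: "x \<in> W" "y \<in> W" using assms by (auto simp: wle_def)
  have "len (w + y) \<le> len (w + x) + len (- x + y)"
    using len_add[of "w + x" "- x + y"] W assms by (simp add: add.assoc)
  moreover have "len (w + x) \<le> len w + len x" using len_add W assms by blast
  ultimately show ?thesis using assms by (auto simp: wle_def)
qed

lemma wle_gen_iff:
  assumes "s \<in> S" "x \<in> W" shows "gen s \<preceq> x \<longleftrightarrow> len (gen s + x) < len x"
  using len_gen_add[OF assms] assms len_gen[of s] by (auto simp: wle_def uminus_gen)

text \<open>The lifting property. Exchange is applied to a reduced word of \<open>x\<close> that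
  starts with one of \<open>u\<close>. The deleted letter cannot lie in the part for
  \<open>u\<close>, because \<open>gen s + u\<close> is longer than \<open>u\<close>; so it is
  deleted from the rest, and \<open>gen s + u\<close> becomes a prefix of \<open>x\<close>.\<close>

lemma wle_gen_add:
  assumes s: "s \<in> S" and su: "len (gen s + u) = len u + 1" and ux: "u \<preceq> x" and sx: "gen s \<preceq> x"
  shows "gen s + u \<preceq> x"
proof -
  obtain y where y: "u \<in> W" "y \<in> W" "x = u + y" "len (u + y) = len u + len y" using wleE[OF ux] .
  obtain a where a: "set a \<subseteq> S" "ev a = u" "length a = len u" using reduced_word y by blast
  obtain b where b: "set b \<subseteq> S" "ev b = y" "length b = len y" using reduced_word y by blast
  have abS: "set (a @ b) \<subseteq> S" using a b by simp
  have l: "len (gen s + ev (a @ b)) < len (ev (a @ b))"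
    using sx wle_gen_iff[OF s, of x] y a b by simp
  obtain c1 r c2 where c: "a @ b = c1 @ r # c2" "gen s + ev (a @ b) = ev (c1 @ c2)"
    by (rule exchange[OF s abS l])
  have "set (c1 @ r # c2) \<subseteq> S" unfolding c(1)[symmetric] using a b by simp
  then have cS: "set (c1 @ c2) \<subseteq> S" by simp
  from c(1) consider d where "a = c1 @ r # d" "c2 = d @ b" | d where "c1 = a @ d" "b = d @ r # c2"
    by (auto simp: append_eq_append_conv2 Cons_eq_append_conv append_eq_Cons_conv)
  then show ?thesis
  proof cases
    case 1
    have "gen s + u + y = gen s + ev (a @ b)" using a(2) b(2) by (simp only: ev_simps add.assoc)
    also have "\<dots> = ev (c1 @ d) + y" unfolding c(2) 1(2) using b(2) by (simp only: ev_simps add.assoc)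
    finally have "gen s + u + y = ev (c1 @ d) + y" .
    then have "gen s + u = ev (c1 @ d)" by simp
    then have "len (gen s + u) < length a" using 1 cS len_le[of "c1 @ d"] by simp
    then show ?thesis using su a by simp
  next
    case 2
    let ?z = "ev (d @ c2)"
    have zS: "set (d @ c2) \<subseteq> S" using cS 2 by simp
    have "gen s + x = u + ?z" using c(2) 2 a(2) b(2) y(3) by (simp only: ev_simps append_assoc add.assoc)
    then have "gen s + (gen s + x) = gen s + (u + ?z)" by simp
    then have x: "x = gen s + u + ?z" unfolding gen_gen_add[OF s] by (simp add: add.assoc)
    have "len ?z + 1 \<le> len y" using len_le[OF zS] 2 b by simp
    then have "len (gen s + u) + len ?z \<le> len x" using su y(3,4) by simp
    moreover have "len x \<le> len (gen s + u) + len ?z"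
      unfolding x using y(1) s zS by (intro len_add W_add W_gen W_ev)
    ultimately show ?thesis unfolding x using y(1) s zS by (intro wleI W_add W_gen W_ev) auto
  qed
qed

lemma ev_alt_neq:
  "\<lbrakk>s \<in> S; t \<in> S; s \<noteq> t; 0 < i; m s t = 0 \<or> i < m s t\<rbrakk> \<Longrightarrow> ev (alt s t i) \<noteq> ev (alt t s i)"
  using alt_not_cox_eq[OF cm] ev_eq_iff set_alt by meson

lemma m_sym: "s \<in> S \<Longrightarrow> t \<in> S \<Longrightarrow> m s t = m t s"
  using cm by (auto simp: coxeter_matrix_def)

text \<open>If prepending \<open>s\<close> fails to lengthen the word, then \<open>gen s\<close> is
  one of its reflections, which are odd alternating words. This makes an alternating word of length
  \<open>2 * (i + 1)\<close> trivial with \<open>i + 1 < m s t\<close> (or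
  \<open>m s t = 0\<close>), so the order of \<open>s t\<close> would be too small.\<close>

lemma len_alt:
  "\<lbrakk>s \<in> S; t \<in> S; s \<noteq> t; m s t = 0 \<or> k \<le> m s t\<rbrakk> \<Longrightarrow> len (ev (alt s t k)) = k"
proof (induction s t k rule: alt.induct)
  case (2 s t k)
  then have IH: "len (ev (alt t s k)) = k" using m_sym[of s t] by auto
  show ?case
  proof (rule ccontr)
    assume "\<not> ?thesis"
    then have "len (gen s + ev (alt t s k)) < len (ev (alt t s k))"
      using len_gen_add[of s "ev (alt t s k)"] IH 2 set_alt[of t S s k] by auto
    then have "gen s \<in> set (refls (alt t s k))" using refls_exchange 2 set_alt[of t S s k] by auto
    then obtain i where i: "i < k" "gen s = ev (alt t s (2 * i + 1))" using refls_alt 2 by auto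
    have "gen s + ev (alt t s (2 * i + 1)) = 0" using i gen_gen 2 by metis
    moreover have "Suc i + Suc i = Suc (2 * i + 1)" by simp
    ultimately have "ev (alt s t (Suc i + Suc i)) = 0" by (simp only: alt.simps ev_simps)
    then have "ev (alt s t (Suc i)) = - ev (if even (Suc i) then alt s t (Suc i) else alt t s (Suc i))"
      unfolding alt_add by (simp only: ev_simps eq_neg_iff_add_eq_0)
    also have "\<dots> = ev (rev (if even (Suc i) then alt s t (Suc i) else alt t s (Suc i)))"
      using 2 set_alt[of t S s "Suc i"] set_alt[of s S t "Suc i"] by (simp only: ev_rev split: if_splits) simp
    also have "\<dots> = ev (alt t s (Suc i))" by (simp add: rev_alt del: alt.simps)
    finally show False using ev_alt_neq[of s t "Suc i"] 2 i by auto
  qed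
qed simp

text \<open>The lifting property applies alternately with \<open>s\<close> and \<open>t\<close> as
  long as alternating words stay reduced. If \<open>m s t = 0\<close> it never stops, which the
  length of \<open>x\<close> forbids.\<close>

lemma alt_wle:
  assumes st: "s \<in> S" "t \<in> S" "s \<noteq> t" and x: "gen s \<preceq> x" "gen t \<preceq> x"
  shows "m s t \<noteq> 0 \<and> ev (alt s t (m s t)) \<preceq> x"
proof -
  have *: "ev (alt s t k) \<preceq> x \<and> ev (alt t s k) \<preceq> x" if "m s t = 0 \<or> k \<le> m s t" for k
    using that
  proof (induction k)
    case 0
    then show ?case using x by (auto simp: wle_def)
  next
    case (Suc k)
    then have IH: "ev (alt s t k) \<preceq> x" "ev (alt t s k) \<preceq> x" by auto
    have "len (gen s + ev (alt t s k)) = len (ev (alt t s k)) + 1"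
      "len (gen t + ev (alt s t k)) = len (ev (alt s t k)) + 1"
      using len_alt[of s t k] len_alt[of t s k] len_alt[of s t "Suc k"] len_alt[of t s "Suc k"]
        st Suc.prems m_sym[of s t] by auto
    then show ?case using wle_gen_add IH x st by simp
  qed
  have "m s t \<noteq> 0"
  proof
    assume 0: "m s t = 0"
    then have "len (ev (alt s t (Suc (len x)))) \<le> len x" using * wle_len by blast
    then show False using len_alt[of s t "Suc (len x)"] 0 st by simp
  qed
  then show ?thesis using * by simp
qed


end

section \<open>Braid equivalence and Matsumoto's theorem\<close>

text \<open>The Coxeter relations without the squares: the presentation of the positive monoid, not
  yet known to embed into the Artin group.\<close>

inductive braid_eq :: "'a set \<Rightarrow> ('a \<Rightarrow> 'a \<Rightarrow> nat) \<Rightarrow> 'a list \<Rightarrow> 'a list \<Rightarrow> bool"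
  for S m where
  refl: "set w \<subseteq> S \<Longrightarrow> braid_eq S m w w"
| sym: "braid_eq S m x y \<Longrightarrow> braid_eq S m y x"
| trans: "braid_eq S m x y \<Longrightarrow> braid_eq S m y z \<Longrightarrow> braid_eq S m x z"
| braid: "s \<in> S \<Longrightarrow> t \<in> S \<Longrightarrow> m s t \<noteq> 0 \<Longrightarrow> set u \<subseteq> S \<Longrightarrow> set v \<subseteq> S \<Longrightarrow>
          braid_eq S m (u @ alt s t (m s t) @ v) (u @ alt t s (m s t) @ v)"

lemma braid_eq_set: "braid_eq S m u v \<Longrightarrow> set u \<subseteq> S \<and> set v \<subseteq> S"
  by (induction rule: braid_eq.induct) (auto dest: set_alt[THEN subsetD, rotated 2])

lemma braid_eq_length: "braid_eq S m u v \<Longrightarrow> length u = length v"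
  by (induction rule: braid_eq.induct) auto

lemma braid_eq_ctxt:
  "braid_eq S m u v \<Longrightarrow> set x \<subseteq> S \<Longrightarrow> set y \<subseteq> S \<Longrightarrow> braid_eq S m (x @ u @ y) (x @ v @ y)"
proof (induction rule: braid_eq.induct)
  case (refl w)
  then show ?case by (simp add: braid_eq.refl)
next
  case (braid s t u v)
  then show ?case using braid_eq.braid[of s S t m "x @ u" "v @ y"] by simp
qed (auto intro: braid_eq.intros)

lemma braid_eq_append:
  assumes "braid_eq S m u u'" "braid_eq S m v v'"
  shows "braid_eq S m (u @ v) (u' @ v')"
  using braid_eq_ctxt[OF assms(1), of "[]" v] braid_eq_ctxt[OF assms(2), of u' "[]"]
    braid_eq_set[OF assms(1)] braid_eq_set[OF assms(2)] by (auto intro: braid_eq.trans)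

lemma braid_eq_Cons: "s \<in> S \<Longrightarrow> braid_eq S m u v \<Longrightarrow> braid_eq S m (s # u) (s # v)"
  using braid_eq_append[of S m "[s]" "[s]" u v] braid_eq.refl[of "[s]" S m] by simp

lemma braid_eq_imp_cox_eq: "braid_eq S m u v \<Longrightarrow> cox_eq S m u v"
  by (induction rule: braid_eq.induct) (auto intro: cox_eq.intros)

context coxeter_group
begin

text \<open>Two reduced words with different first letters \<open>s\<close> and \<open>t\<close> are
  compared through \<open>p\<close> and \<open>q\<close>, words of the same element that start with
  the two alternating words. These differ by one braid relation, and each shares its first letter
  with one of the given words, so the induction hypothesis applies to the remainders.\<close>

lemma matsumoto:
  assumes "set u \<subseteq> S" "set v \<subseteq> S" "ev u = ev v" "length u = len (ev u)" "length v = len (ev v)"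
  shows "braid_eq S m u v"
  using assms
proof (induction "length u" arbitrary: u v rule: less_induct)
  case less
  have cancel: "length u' = len (ev u')" if "length (s # u') = len (ev (s # u'))" "set (s # u') \<subseteq> S" for s u'
  proof -
    have "set u' \<subseteq> S" "s \<in> S" using that(2) by simp_all
    then have "len (gen s + ev u') \<le> len (ev u') + 1" "len (ev u') \<le> length u'"
      using len_gen_add[of s "ev u'"] W_ev len_le by fastforce+
    then show ?thesis using that(1) by (simp only: ev_simps list.size)
  qed
  show ?case
  proof (cases u)
    case Nil
    then have "length v = 0" using less.prems(3,5) by (metis ev_simps(1) len_zero)
    then show ?thesis using Nil by (simp add: braid_eq.refl)
  next
    case (Cons s u')
    then have "length v \<noteq> 0" using less.prems(3-5) by (metis length_Cons nat.distinct(1))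
    then obtain t v' where v: "v = t # v'" by (cases v) auto
    have st: "s \<in> S" "t \<in> S" "set u' \<subseteq> S" "set v' \<subseteq> S"
      using less.prems(1,2) unfolding Cons v by auto
    have l: "length u' = len (ev u')" "length v' = len (ev v')"
      using cancel less.prems(1,2,4,5) unfolding Cons v by blast+
    have luv: "length v = length u" using less.prems(3-5) by simp
    have step: "braid_eq S m (r # p) q"
      if "r \<in> S" "set p \<subseteq> S" "length p = len (ev p)" "set q \<subseteq> S" "gen r + ev p = ev q" "length q = len (ev q)"
        "length q = length u" "q = r # q'" for r p q q'
    proof -
      have q': "length q' = len (ev q')" "set q' \<subseteq> S"
        using cancel[of r q'] that(4,6) unfolding that(8) by auto
      have pq: "ev p = ev q'" using that(5) unfolding that(8) by simp
      then have "length p = length q'" using that(3) q'(1) by simp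
      then have "length p < length u" using that(7) unfolding that(8) by simp
      then have "braid_eq S m p q'" using that(2) q'(2) pq that(3) q'(1)
        by (rule less.hyps)
      then show ?thesis unfolding that(8) by (rule braid_eq_Cons[OF that(1)])
    qed
    show ?thesis
    proof (cases "s = t")
      case True
      have "gen s + ev u' = ev v" using less.prems(3) unfolding Cons by simp
      from step[OF st(1,3) l(1) less.prems(2) this less.prems(5) luv v[folded True]] show ?thesis
        unfolding Cons .
    next
      case False
      let ?x = "ev u"
      have xW: "?x \<in> W" by (rule W_ev[OF less.prems(1)])
      have "gen s + ?x = ev u'" unfolding Cons using st by (simp add: gen_gen_add)
      moreover have "gen t + ?x = ev v'" unfolding less.prems(3) v using st by (simp add: gen_gen_add)
      moreover have "len (ev u') < len ?x" using l(1) less.prems(4) unfolding Cons by simp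
      moreover have "len (ev v') < len ?x" using l(2) less.prems(5) unfolding less.prems(3) v by simp
      ultimately have "gen s \<preceq> ?x" "gen t \<preceq> ?x"
        using wle_gen_iff[OF st(1) xW] wle_gen_iff[OF st(2) xW] by simp_all
      then have m0: "m s t \<noteq> 0" and d: "ev (alt s t (m s t)) \<preceq> ?x" using alt_wle[OF st(1,2) False] by auto
      obtain y where y: "y \<in> W" "?x = ev (alt s t (m s t)) + y"
        "len ?x = len (ev (alt s t (m s t))) + len y" by (rule wleE[OF d]) simp
      obtain z where z: "set z \<subseteq> S" "ev z = y" "length z = len y" using reduced_word y by blast
      define p where "p = alt s t (m s t) @ z"
      define q where "q = alt t s (m s t) @ z"
      have b: "braid_eq S m p q"
        unfolding p_def q_def using braid_eq.braid[of s S t m "[]" z] st m0 z by simp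
      have S: "set p \<subseteq> S" "set q \<subseteq> S" using braid_eq_set[OF b] by auto
      have ev: "ev p = ?x" "ev q = ?x"
        unfolding p_def q_def ev_simps z(2) ev_braid[OF st(1,2) m0, symmetric] y(2)[symmetric] by simp_all
      have len: "length p = len ?x" "length q = len ?x"
        using y(3) z(3) len_alt[OF st(1,2) False, of "m s t"] by (simp_all add: p_def q_def)
      obtain k where k: "m s t = Suc k" using m0 not0_implies_Suc by blast
      have "gen s + ev u' = ev p" "gen t + ev v' = ev q"
        using ev less.prems(3) unfolding Cons v by simp_all
      moreover have "length p = len (ev p)" "length q = len (ev q)" "length p = length u" "length q = length u"
        unfolding ev len less.prems(4) by simp_all
      moreover have "p = s # alt t s k @ z" "q = t # alt s t k @ z" by (simp_all add: p_def q_def k)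
      ultimately have "braid_eq S m (s # u') p" "braid_eq S m (t # v') q"
        using step[OF st(1,3) l(1) S(1)] step[OF st(2,4) l(2) S(2)] by blast+
      then have "braid_eq S m u p" "braid_eq S m v q" unfolding Cons v .
      then show ?thesis using b by (meson braid_eq.sym braid_eq.trans)
    qed
  qed
qed

end

section \<open>Greatest common divisors from joins of generators\<close>

text \<open>A common lower bound lying above the generator \<open>s\<close> is obtained by dividing by \<open>s\<close> and
  induction. The bounds obtained for different \<open>s\<close> coincide because any two generators below both
  elements have a join below both elements.\<close>

lemma gcd_from_joins:
  fixes le :: "'x \<Rightarrow> 'x \<Rightarrow> bool" and eps :: 'x and gt :: "'s \<Rightarrow> 'x" and size :: "'x \<Rightarrow> nat"
  assumes trans: "\<And>x y z. le x y \<Longrightarrow> le y z \<Longrightarrow> le x z"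
    and C: "\<And>x y. le x y \<Longrightarrow> x \<in> C \<and> y \<in> C"
    and eps: "\<And>x. x \<in> C \<Longrightarrow> le eps x"
    and atoms: "\<And>x. x \<in> C \<Longrightarrow> (\<exists>s\<in>S. le (gt s) x) \<or> (\<forall>y\<in>C. le x y)"
    and step: "\<And>s x y. s \<in> S \<Longrightarrow> le (gt s) x \<Longrightarrow> le (gt s) y \<Longrightarrow>
      \<exists>x'\<in>C. \<exists>y'\<in>C. \<exists>f. size x' < size x \<and>
        (\<forall>d. le d x' \<and> le d y' \<longrightarrow> le (gt s) (f d) \<and> le (f d) x \<and> le (f d) y) \<and>
        (\<forall>e. le (gt s) e \<and> le e x \<and> le e y \<longrightarrow> (\<exists>e'. le e' x' \<and> le e' y' \<and> (\<forall>d. le d x' \<and> le e' d \<longrightarrow> le e (f d))))"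
    and join: "\<And>s t x y. s \<in> S \<Longrightarrow> t \<in> S \<Longrightarrow> le (gt s) x \<Longrightarrow> le (gt t) x \<Longrightarrow> le (gt s) y \<Longrightarrow> le (gt t) y \<Longrightarrow>
      \<exists>j. le (gt s) j \<and> le (gt t) j \<and> le j x \<and> le j y"
  assumes "x \<in> C" "y \<in> C"
  shows "\<exists>d. le d x \<and> le d y \<and> (\<forall>e. le e x \<and> le e y \<longrightarrow> le e d)"
  using assms(7,8)
proof (induction "size x" arbitrary: x y rule: less_induct)
  case less
  have above: "\<exists>d. le (gt s) d \<and> le d x \<and> le d y \<and> (\<forall>e. le (gt s) e \<and> le e x \<and> le e y \<longrightarrow> le e d)"
    if s: "s \<in> S" "le (gt s) x" "le (gt s) y" for s
  proof -
    obtain x' y' f where *: "x' \<in> C" "y' \<in> C" "size x' < size x"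
      "\<And>d. le d x' \<and> le d y' \<Longrightarrow> le (gt s) (f d) \<and> le (f d) x \<and> le (f d) y"
      "\<And>e. le (gt s) e \<and> le e x \<and> le e y \<Longrightarrow> \<exists>e'. le e' x' \<and> le e' y' \<and> (\<forall>d. le d x' \<and> le e' d \<longrightarrow> le e (f d))"
      using step[OF s] by blast
    obtain d where d: "le d x'" "le d y'" "\<And>e. le e x' \<and> le e y' \<Longrightarrow> le e d"
      using less.hyps[OF *(3,1,2)] by blast
    have "le e (f d)" if "le (gt s) e \<and> le e x \<and> le e y" for e
      using *(5)[OF that] d by blast
    then show ?thesis using *(4)[of d] d by blast
  qed
  show ?case
  proof (cases "\<exists>s\<in>S. le (gt s) x \<and> le (gt s) y")
    case False
    have "le e eps" if "le e x" "le e y" for e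
    proof -
      have "\<not> (\<exists>s\<in>S. le (gt s) e)" using False trans that by blast
      moreover have "eps \<in> C" using eps less.prems C by blast
      ultimately show ?thesis using atoms[of e] C that by blast
    qed
    then show ?thesis using eps less.prems by blast
  next
    case True
    then obtain s where s: "s \<in> S" "le (gt s) x" "le (gt s) y" by blast
    obtain d where d: "le (gt s) d" "le d x" "le d y" "\<And>e. le (gt s) e \<Longrightarrow> le e x \<Longrightarrow> le e y \<Longrightarrow> le e d"
      using above[OF s] by blast
    have "le e d" if e: "le e x" "le e y" for e
    proof (cases "\<exists>t\<in>S. le (gt t) e")
      case False
      then show ?thesis using atoms[of e] C e d by blast
    next
      case True
      then obtain t where t: "t \<in> S" "le (gt t) e" by blast
      then have tx: "le (gt t) x" "le (gt t) y" using trans e by blast+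
      obtain d' where d': "le (gt t) d'" "le d' x" "le d' y" "\<And>e. le (gt t) e \<Longrightarrow> le e x \<Longrightarrow> le e y \<Longrightarrow> le e d'"
        using above[OF t(1) tx] by blast
      obtain j where j: "le (gt s) j" "le (gt t) j" "le j x" "le j y"
        using join[OF s(1) t(1) s(2) tx(1) s(3) tx(2)] by blast
      \<comment> \<open>\<open>d'\<close> is greatest only among bounds above \<open>t\<close>. The
        join \<open>j\<close> is such a bound and lies above \<open>s\<close>, which brings
        \<open>d'\<close> into the range where \<open>d\<close> is greatest.\<close>
      have "le (gt s) d'" using d'(4)[OF j(2-4)] j(1) trans by blast
      then have "le d' d" using d(4) d' by blast
      then show ?thesis using d'(4)[OF t(2) e] trans by blast
    qed
    then show ?thesis using d by blast
  qed
qed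

section \<open>Finite Coxeter groups: longest element and meets\<close>

locale finite_coxeter_group = coxeter_group +
  assumes finite_W: "finite W"
begin

definition w0 :: 'b where
  "w0 = (SOME x. x \<in> W \<and> (\<forall>y\<in>W. len y \<le> len x))"

lemma w0: "w0 \<in> W" "y \<in> W \<Longrightarrow> len y \<le> len w0"
proof -
  have "Max (len ` W) \<in> len ` W" using finite_W W_zero by (intro Max_in finite_imageI) blast+
  then obtain x where "x \<in> W" "len x = Max (len ` W)" by auto
  then have "\<exists>x. x \<in> W \<and> (\<forall>y\<in>W. len y \<le> len x)" using finite_W by (intro exI[of _ x]) auto
  from someI_ex[OF this] show "w0 \<in> W" "y \<in> W \<Longrightarrow> len y \<le> len w0" unfolding w0_def by blast+
qed

lemma reduced_Cons:
  assumes "set (s # u) \<subseteq> S" "length (s # u) = len (ev (s # u))"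
  shows "length u = len (ev u)" "len (gen s + ev u) = len (ev u) + 1"
proof -
  have S: "set u \<subseteq> S" "s \<in> S" using assms(1) by simp_all
  have "len (gen s + ev u) \<le> len (ev u) + 1" "len (ev u) \<le> length u"
    using len_gen_add[OF S(2) W_ev[OF S(1)]] len_le[OF S(1)] by auto
  then show "length u = len (ev u)" "len (gen s + ev u) = len (ev u) + 1"
    using assms(2) by (simp_all only: ev_simps list.size)
qed

text \<open>No generator lengthens \<open>w0\<close>, so all generators lie below it, and the
  lifting property builds up any reduced word below \<open>w0\<close> letter by letter.\<close>

lemma wle_w0: "y \<in> W \<Longrightarrow> y \<preceq> w0"
proof -
  have *: "set u \<subseteq> S \<Longrightarrow> length u = len (ev u) \<Longrightarrow> ev u \<preceq> w0" for u
  proof (induction u)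
    case Nil
    then show ?case using w0(1) by simp
  next
    case (Cons s u)
    have s: "s \<in> S" "set u \<subseteq> S" using Cons.prems(1) by simp_all
    have "len (gen s + w0) \<le> len w0" using s w0 by simp
    then have "gen s \<preceq> w0" using wle_gen_iff[OF s(1) w0(1)] len_gen_add[OF s(1) w0(1)] by simp
    moreover have "ev u \<preceq> w0" using Cons.IH s(2) reduced_Cons[OF Cons.prems] by simp
    ultimately show ?case using wle_gen_add[OF s(1)] reduced_Cons[OF Cons.prems] by simp
  qed
  assume "y \<in> W"
  then obtain u where "set u \<subseteq> S" "ev u = y" "length u = len y" by (rule reduced_word)
  then show ?thesis using * by blast
qed

lemma w0_unique: "x \<in> W \<Longrightarrow> len w0 \<le> len x \<Longrightarrow> x = w0"
proof -
  assume x: "x \<in> W" "len w0 \<le> len x"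
  then have "len (- x + w0) = 0" using wle_w0[OF x(1)] by (simp add: wle_def)
  then have "- x + w0 = 0" using len_eq_0[of "- x + w0"] x(1) w0(1) by simp
  then have "x + (- x + w0) = x" by simp
  then show ?thesis by simp
qed

lemma w0_w0: "w0 + w0 = 0"
proof -
  have "- w0 = w0" using w0_unique[of "- w0"] w0 len_uminus by simp
  then show ?thesis using add.right_inverse[of w0] by (simp only:)
qed

text \<open>Because everything lies below \<open>w0\<close>, the length of \<open>- x + w0\<close>
  is complementary to that of \<open>x\<close>. The elements that may follow \<open>x\<close>
  without loss of length are thus the lower set of one element, and the largest such divisor of a
  given element is a meet.\<close>

lemma len_add_iff:
  assumes "x \<in> W" "y \<in> W"
  shows "len (x + y) = len x + len y \<longleftrightarrow> y \<preceq> - x + w0"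
proof -
  have l: "len w0 = len z + len (- z + w0)" if "z \<in> W" for z
    using wle_w0[OF that] by (simp add: wle_def)
  have "- y + (- x + w0) = - (x + y) + w0" by (simp only: minus_add add.assoc)
  then have "y \<preceq> - x + w0 \<longleftrightarrow> len (- x + w0) = len y + len (- (x + y) + w0)"
    using assms w0 by (simp add: wle_def)
  then show ?thesis using l[OF assms(1)] l[OF W_add[OF assms]] by linarith
qed

lemma alt_ge_gen:
  assumes "s \<in> S" "t \<in> S" "s \<noteq> t" "m s t \<noteq> 0"
  shows "gen s \<preceq> ev (alt s t (m s t))"
proof -
  obtain k where k: "m s t = Suc k" using assms(4) not0_implies_Suc by blast
  have W: "ev (alt s t (m s t)) \<in> W" "ev (alt t s k) \<in> W"
    using W_ev set_alt assms(1,2) by metis+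
  have "gen s + ev (alt s t (m s t)) = ev (alt t s k)"
    using assms(1) by (simp add: k gen_gen_add)
  moreover have "len (ev (alt s t (m s t))) = Suc k" using len_alt[OF assms(1-3), of "m s t"] k by simp
  moreover have "len (ev (alt t s k)) = k"
    using len_alt[of t s k] assms(1-3) m_sym[OF assms(1,2)] k by (metis le_SucI le_refl)
  ultimately show ?thesis using wle_gen_iff[OF assms(1) W(1)] by (simp only: lessI)
qed

text \<open>The division step of \<open>gcd_from_joins\<close> is left translation by
  \<open>gen s\<close>; it respects the order since additivity of lengths passes to smaller elements
  (\<open>len_add_down\<close>). Two generators are joined by their alternating word of length
  \<open>m s t\<close>.\<close>

lemma ex_meet:
  assumes "x \<in> W" "y \<in> W"
  shows "\<exists>d. d \<preceq> x \<and> d \<preceq> y \<and> (\<forall>e. e \<preceq> x \<and> e \<preceq> y \<longrightarrow> e \<preceq> d)"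
proof (rule gcd_from_joins[where C = W and S = S and gt = gen and eps = 0 and size = len])
  fix x assume x: "x \<in> W"
  show "(\<exists>s\<in>S. gen s \<preceq> x) \<or> (\<forall>y\<in>W. x \<preceq> y)"
  proof (cases "x = 0")
    case False
    obtain u where u: "set u \<subseteq> S" "ev u = x" "length u = len x" using x by (rule reduced_word)
    then obtain s v where sv: "u = s # v" using False by (cases u) auto
    have s: "s \<in> S" "set (s # v) \<subseteq> S" "length (s # v) = len (ev (s # v))" using u by (simp_all add: sv)
    then have "gen s \<preceq> gen s + ev v"
      using reduced_Cons[OF s(2,3)] len_gen[OF s(1)] by (intro wleI) auto
    then show ?thesis using s u by (auto simp: sv)
  qed simp
next
  fix s x y
  assume s: "s \<in> S" and x: "gen s \<preceq> x" and y: "gen s \<preceq> y"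
  have gs: "gen s \<in> W" using s by simp
  have add: "len (gen s + (gen s + z)) = len (gen s) + len (gen s + z)" "gen s + z \<in> W"
    if "gen s \<preceq> z" for z
    using s wleD[OF that] unfolding uminus_gen[OF s] gen_gen_add[OF s] by simp_all
  have up: "gen s \<preceq> gen s + d" "gen s + d \<preceq> z" if "gen s \<preceq> z" "d \<preceq> gen s + z" for z d
  proof -
    have d: "d \<in> W" "gen s + z \<in> W" using wleD(1,2)[OF that(2)] by simp_all
    have l: "len (gen s + d) = len (gen s) + len d"
      using len_add_down[OF that(2) gs add(1)[OF that(1)]] .
    then show "gen s \<preceq> gen s + d" using d gs by (intro wleI)
    have "gen s + d \<preceq> gen s + (gen s + z)"
      using wle_add_left[OF gs l add(1)[OF that(1)] d] that(2) by simp
    then show "gen s + d \<preceq> z" by (simp only: gen_gen_add[OF s])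
  qed
  have down: "gen s + e \<preceq> gen s + z" if "gen s \<preceq> e" "gen s \<preceq> z" "e \<preceq> z" for e z
    using wle_add_left[OF gs add(1)[OF that(1)] add(1)[OF that(2)] add(2)[OF that(1)] add(2)[OF that(2)]]
      that(3) by (simp only: gen_gen_add[OF s])
  show "\<exists>x'\<in>W. \<exists>y'\<in>W. \<exists>f. len x' < len x \<and>
        (\<forall>d. d \<preceq> x' \<and> d \<preceq> y' \<longrightarrow> gen s \<preceq> f d \<and> f d \<preceq> x \<and> f d \<preceq> y) \<and>
        (\<forall>e. gen s \<preceq> e \<and> e \<preceq> x \<and> e \<preceq> y \<longrightarrow> (\<exists>e'. e' \<preceq> x' \<and> e' \<preceq> y' \<and> (\<forall>d. d \<preceq> x' \<and> e' \<preceq> d \<longrightarrow> e \<preceq> f d)))"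
  proof (intro bexI exI conjI allI impI)
    show "len (gen s + x) < len x" using wle_gen_iff[OF s wleD(2)[OF x]] x by simp
    show "gen s + x \<in> W" "gen s + y \<in> W" using add(2)[OF x] add(2)[OF y] by simp_all
    fix d assume "d \<preceq> gen s + x \<and> d \<preceq> gen s + y"
    then show "gen s \<preceq> gen s + d" "gen s + d \<preceq> x" "gen s + d \<preceq> y"
      using up[OF x] up[OF y] by simp_all
  next
    fix e assume e: "gen s \<preceq> e \<and> e \<preceq> x \<and> e \<preceq> y"
    then show "gen s + e \<preceq> gen s + x" "gen s + e \<preceq> gen s + y"
      using down x y by simp_all
    fix d assume d: "d \<preceq> gen s + x \<and> gen s + e \<preceq> d"
    have l: "len (gen s + d) = len (gen s) + len d"
      by (rule len_add_down[OF conjunct1[OF d] gs add(1)[OF x]])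
    have "gen s + (gen s + e) \<preceq> gen s + d"
      using wle_add_left[OF gs add(1)[OF conjunct1[OF e]] l add(2)[OF conjunct1[OF e]] wleD(1)[OF conjunct1[OF d]]]
        d by simp
    then show "e \<preceq> gen s + d" by (simp only: gen_gen_add[OF s])
  qed
next
  fix s t x y
  assume st: "s \<in> S" "t \<in> S" and *: "gen s \<preceq> x" "gen t \<preceq> x" "gen s \<preceq> y" "gen t \<preceq> y"
  show "\<exists>j. gen s \<preceq> j \<and> gen t \<preceq> j \<and> j \<preceq> x \<and> j \<preceq> y"
  proof (cases "s = t")
    case True
    then show ?thesis using * st by (intro exI[of _ "gen s"]) simp
  next
    case False
    then have m0: "m s t \<noteq> 0" "m t s = m s t" "m t s \<noteq> 0" using alt_wle[OF st] * m_sym[OF st] by auto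
    have "gen t \<preceq> ev (alt s t (m s t))"
      using alt_ge_gen[OF st(2,1) _ m0(3)] False ev_braid[OF st m0(1)] m0(2) by simp
    moreover have "gen s \<preceq> ev (alt s t (m s t))"
      using alt_ge_gen[OF st False m0(1)] .
    ultimately show ?thesis
      using alt_wle[OF st False *(1,2)] alt_wle[OF st False *(3,4)] by metis
  qed
next
  fix x y z assume "x \<preceq> y" "y \<preceq> z"
  then show "x \<preceq> z" by (rule wle_trans)
next
  fix x y assume "x \<preceq> y"
  then show "x \<in> W \<and> y \<in> W" using wleD(1,2) by simp
qed (simp_all add: assms)

definition meet :: "'b \<Rightarrow> 'b \<Rightarrow> 'b" where
  "meet x y = (SOME d. d \<preceq> x \<and> d \<preceq> y \<and> (\<forall>e. e \<preceq> x \<and> e \<preceq> y \<longrightarrow> e \<preceq> d))"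

lemma meet:
  assumes "x \<in> W" "y \<in> W"
  shows "meet x y \<preceq> x" "meet x y \<preceq> y" "e \<preceq> x \<Longrightarrow> e \<preceq> y \<Longrightarrow> e \<preceq> meet x y"
  using someI_ex[OF ex_meet[OF assms]] unfolding meet_def by blast+

text \<open>The largest left divisor of \<open>v\<close> that can be multiplied by \<open>w\<close> on the left with lengths adding
  up.\<close>

definition cap :: "'b \<Rightarrow> 'b \<Rightarrow> 'b" where
  "cap w v = meet v (- w + w0)"

lemma cap:
  assumes "w \<in> W" "v \<in> W"
  shows "cap w v \<preceq> v" "cap w v \<in> W" "len (w + cap w v) = len w + len (cap w v)"
    "\<And>x. x \<preceq> v \<Longrightarrow> len (w + x) = len w + len x \<Longrightarrow> x \<preceq> cap w v"
proof -
  have W: "- w + w0 \<in> W" using assms w0 by simp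
  show 1: "cap w v \<preceq> v" unfolding cap_def by (rule meet[OF assms(2) W])
  then show 2: "cap w v \<in> W" by (rule wleD)
  have "cap w v \<preceq> - w + w0" unfolding cap_def by (rule meet[OF assms(2) W])
  then show "len (w + cap w v) = len w + len (cap w v)" using len_add_iff[OF assms(1) 2] by simp
  fix x assume x: "x \<preceq> v" "len (w + x) = len w + len x"
  then have "x \<preceq> - w + w0" using len_add_iff[OF assms(1) wleD(1)[OF x(1)]] by simp
  then show "x \<preceq> cap w v" unfolding cap_def using meet(3)[OF assms(2) W x(1)] by simp
qed

text \<open>Absorbing from \<open>v\<close> by \<open>w + w'\<close> at once agrees with absorbing
  by \<open>w'\<close> and then by \<open>w\<close>. The second absorption retains all of
  \<open>w'\<close>, since \<open>w'\<close> is itself admissible after \<open>w\<close>; comparing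
  what is left uses both maximality properties. This compatibility makes a letterwise computation of
  the head consistent.\<close>

lemma cap_comp:
  assumes W: "w \<in> W" "w' \<in> W" "v \<in> W" and l: "len (w + w') = len w + len w'"
  shows "cap (w + w') v \<preceq> cap w' v" "cap w (w' + cap w' v) = w' + cap (w + w') v"
proof -
  define a where "a = cap w' v"
  define c where "c = cap (w + w') v"
  define b where "b = cap w (w' + a)"
  note av = cap(1)[OF W(2,3), folded a_def] and aW = cap(2)[OF W(2,3), folded a_def]
    and al = cap(3)[OF W(2,3), folded a_def] and amax = cap(4)[OF W(2,3), folded a_def]
  have ww: "w + w' \<in> W" "w' + a \<in> W" using W aW by simp_all
  note cv = cap(1)[OF ww(1) W(3), folded c_def] and cW = cap(2)[OF ww(1) W(3), folded c_def]
    and cl = cap(3)[OF ww(1) W(3), folded c_def] and cmax = cap(4)[OF ww(1) W(3), folded c_def]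
  note ba = cap(1)[OF W(1) ww(2), folded b_def] and bW = cap(2)[OF W(1) ww(2), folded b_def]
    and bl = cap(3)[OF W(1) ww(2), folded b_def] and bmax = cap(4)[OF W(1) ww(2), folded b_def]
  have cl': "len (w' + c) = len w' + len c" "len (w + (w' + c)) = len w + len (w' + c)"
  proof -
    have "len (w + (w' + c)) \<le> len w + len (w' + c)" "len (w' + c) \<le> len w' + len c"
      using len_add[OF W(1) W_add[OF W(2) cW]] len_add[OF W(2) cW] by simp_all
    then show "len (w' + c) = len w' + len c" "len (w + (w' + c)) = len w + len (w' + c)"
      using cl l unfolding add.assoc by linarith+
  qed
  show ca: "cap (w + w') v \<preceq> cap w' v" using amax[OF cv cl'(1)] unfolding a_def c_def .
  have "w' + c \<preceq> w' + a" using wle_add_left[OF W(2) cl'(1) al cW aW] ca unfolding a_def c_def by simp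
  then have 1: "w' + c \<preceq> b" by (rule bmax[OF _ cl'(2)])
  have "w' \<preceq> w' + a" by (rule wleI[OF W(2) aW al])
  then have "w' \<preceq> b" by (rule bmax[OF _ l])
  then obtain d where d: "d \<in> W" "b = w' + d" "len (w' + d) = len w' + len d" by (rule wleE)
  have "d \<preceq> a" using wle_add_left[OF W(2) d(3) al d(1) aW] ba unfolding d(2) by simp
  then have dv: "d \<preceq> v" using av by (rule wle_trans)
  have "len (w + w' + d) = len (w + w') + len d"
    using bl d(3) l unfolding d(2) add.assoc by linarith
  then have "d \<preceq> c" by (rule cmax[OF dv])
  then have "b \<preceq> w' + c" unfolding d(2) using wle_add_left[OF W(2) d(3) cl'(1) d(1) cW] by simp
  then have "b = w' + c" using 1 by (rule wle_antisym)
  then show "cap w (w' + cap w' v) = w' + cap (w + w') v" unfolding a_def b_def c_def .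
qed

end

section \<open>The positive monoid\<close>

context finite_coxeter_group
begin

abbreviation beq (infix \<open>\<approx>\<close> 50) where
  "u \<approx> v \<equiv> braid_eq S m u v"

declare braid_eq.trans [trans]

text \<open>The lift of a Coxeter group element to the positive monoid; by Matsumoto's theorem its
  class does not depend on the chosen word.\<close>

definition rw :: "'b \<Rightarrow> 'a list" where
  "rw w = (SOME u. set u \<subseteq> S \<and> ev u = w \<and> length u = len w)"

lemma rw:
  assumes "w \<in> W" shows "set (rw w) \<subseteq> S" "ev (rw w) = w" "length (rw w) = len w"
proof -
  have "\<exists>u. set u \<subseteq> S \<and> ev u = w \<and> length u = len w"
    using reduced_word[OF assms] by metis
  from someI_ex[OF this] show "set (rw w) \<subseteq> S" "ev (rw w) = w" "length (rw w) = len w"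
    unfolding rw_def by simp_all
qed

lemma rw_ev: "set u \<subseteq> S \<Longrightarrow> length u = len (ev u) \<Longrightarrow> rw (ev u) \<approx> u"
  using rw[of "ev u"] by (intro matsumoto) simp_all

lemma rw_add:
  assumes "x \<in> W" "y \<in> W" "len (x + y) = len x + len y"
  shows "rw (x + y) \<approx> rw x @ rw y"
proof -
  have "ev (rw x @ rw y) = x + y" using rw assms by simp
  moreover have "rw (ev (rw x @ rw y)) \<approx> rw x @ rw y"
    using rw[OF assms(1)] rw[OF assms(2)] assms(3) by (intro rw_ev) simp_all
  ultimately show ?thesis by simp
qed

lemma rw_zero: "rw 0 = []"
  using rw(3)[of 0] by simp

lemma rw_gen_add:
  assumes "s \<in> S" "x \<in> W" "len (gen s + x) = len (gen s) + len x"
  shows "rw (gen s + x) \<approx> s # rw x"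
proof -
  have "ev (s # rw x) = gen s + x" using rw assms by simp
  moreover have "rw (ev (s # rw x)) \<approx> s # rw x"
    using rw[OF assms(2)] assms len_gen[OF assms(1)] by (intro rw_ev) simp_all
  ultimately show ?thesis by simp
qed

text \<open>The head of a word is the largest element of \<open>W\<close> whose lift divides the word on the left, the
  tail is the quotient. Both are computed letter by letter; that they only depend on the class of the
  word replaces the usual reduction lemma.\<close>

fun head :: "'a list \<Rightarrow> 'b" where
  "head [] = 0"
| "head (s # u) = gen s + cap (gen s) (head u)"

fun tail :: "'a list \<Rightarrow> 'a list" where
  "tail [] = []"
| "tail (s # u) = rw (- cap (gen s) (head u) + head u) @ tail u"

lemma head_W: "set u \<subseteq> S \<Longrightarrow> head u \<in> W"
  by (induction u) (simp_all add: cap(2))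

lemma tail_S: "set u \<subseteq> S \<Longrightarrow> set (tail u) \<subseteq> S"
  by (induction u) (simp_all add: rw(1) cap(2) head_W)

lemma len_wle_chain:
  assumes "c \<preceq> a" "a \<preceq> h"
  shows "len (- c + h) = len (- c + a) + len (- a + h)"
  using wleD(3)[OF assms(1)] wleD(3)[OF assms(2)] wleD(3)[OF wle_trans[OF assms]] by linarith

text \<open>A reduced prefix acts on head and tail through its group element alone (the tail up to
  braid equivalence). Applied to the two sides of a braid relation, this yields invariance.\<close>

lemma head_append:
  assumes u: "set u \<subseteq> S"
  shows "set p \<subseteq> S \<Longrightarrow> length p = len (ev p) \<Longrightarrow>
    head (p @ u) = ev p + cap (ev p) (head u) \<and>
    tail (p @ u) \<approx> rw (- cap (ev p) (head u) + head u) @ tail u"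
proof (induction p)
  case Nil
  have h: "head u \<in> W" using head_W[OF u] .
  have "head u \<preceq> cap 0 (head u)" using h by (intro cap(4)) simp_all
  then have "cap 0 (head u) = head u" using cap(1)[of 0 "head u"] h wle_antisym by simp
  then show ?case by (simp add: rw_zero braid_eq.refl tail_S[OF u])
next
  case (Cons s p)
  note red = reduced_Cons[OF Cons.prems]
  have s: "s \<in> S" "set p \<subseteq> S" using Cons.prems(1) by simp_all
  define h where "h = head u"
  define w where "w = ev p"
  define a where "a = cap w h"
  define c where "c = cap (gen s + w) h"
  have W: "h \<in> W" "w \<in> W" "gen s \<in> W" "gen s + w \<in> W"
    using head_W[OF u] s by (simp_all add: h_def w_def)
  have IH: "head (p @ u) = w + a" "tail (p @ u) \<approx> rw (- a + h) @ tail u"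
    using Cons.IH[OF s(2) red(1)] by (simp_all add: h_def w_def a_def)
  have l: "len (gen s + w) = len (gen s) + len w" using red(2) len_gen[OF s(1)] by (simp add: w_def)
  have ca: "c \<preceq> a" and capeq: "cap (gen s) (w + a) = w + c"
    using cap_comp[OF W(3,2,1) l] by (simp_all add: a_def c_def)
  have ah: "a \<preceq> h" using cap(1)[OF W(2,1)] by (simp add: a_def)
  have aW: "a \<in> W" and cW: "c \<in> W" using ca wleD(1,2) by simp_all
  have "- (w + c) + (w + a) = - c + a" by (simp only: minus_add add.assoc minus_add_cancel)
  then have tail: "tail (s # p @ u) = rw (- c + a) @ tail (p @ u)" using IH(1) capeq by simp
  have "- c + h = (- c + a) + (- a + h)" by (simp add: add.assoc)
  then have "rw (- c + h) \<approx> rw (- c + a) @ rw (- a + h)"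
    using rw_add[of "- c + a" "- a + h"] len_wle_chain[OF ca ah] aW cW W(1) by simp
  then have 1: "rw (- c + h) @ tail u \<approx> (rw (- c + a) @ rw (- a + h)) @ tail u"
    by (rule braid_eq_append[OF _ braid_eq.refl[OF tail_S[OF u]]])
  have "rw (- c + a) \<approx> rw (- c + a)" using rw(1)[of "- c + a"] aW cW by (intro braid_eq.refl) simp
  then have "rw (- c + a) @ tail (p @ u) \<approx> rw (- c + a) @ (rw (- a + h) @ tail u)"
    using IH(2) by (rule braid_eq_append)
  then have "tail (s # p @ u) \<approx> rw (- c + h) @ tail u"
    unfolding tail using braid_eq.sym[OF 1] unfolding append_assoc by (rule braid_eq.trans)
  moreover have "head (s # p @ u) = gen s + w + c" using IH(1) capeq by (simp add: add.assoc)
  ultimately show ?case by (simp add: h_def w_def c_def)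
qed

lemma head_prefix_cong:
  assumes "head x = head y" "tail x \<approx> tail y" "set x \<subseteq> S"
  shows "set u \<subseteq> S \<Longrightarrow> head (u @ x) = head (u @ y) \<and> tail (u @ x) \<approx> tail (u @ y)"
proof (induction u)
  case (Cons s u)
  then have IH: "head (u @ x) = head (u @ y)" "tail (u @ x) \<approx> tail (u @ y)" and s: "s \<in> S" "set u \<subseteq> S"
    by simp_all
  have "head (u @ x) \<in> W" using s assms(3) by (intro head_W) simp
  then have "set (rw (- cap (gen s) (head (u @ x)) + head (u @ x))) \<subseteq> S"
    using s by (simp add: rw(1) cap(2))
  then have "rw (- cap (gen s) (head (u @ x)) + head (u @ x)) @ tail (u @ x) \<approx>
     rw (- cap (gen s) (head (u @ x)) + head (u @ x)) @ tail (u @ y)"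
    by (intro braid_eq_append[OF braid_eq.refl IH(2)])
  then show ?case using IH(1) by simp
qed (use assms in simp)

text \<open>For distinct letters both sides of a braid relation are reduced words of one element, so
  \<open>head_append\<close> gives the same result for both. For \<open>s = t\<close> they are the
  same word.\<close>

lemma head_tail_cong: "x \<approx> y \<Longrightarrow> head x = head y \<and> tail x \<approx> tail y"
proof (induction rule: braid_eq.induct)
  case (refl w)
  then show ?case by (simp add: braid_eq.refl tail_S)
next
  case (sym x y)
  then show ?case using braid_eq.sym[of S m "tail x" "tail y"] by simp
next
  case (trans x y z)
  then show ?case by (metis braid_eq.trans)
next
  case (braid s t u v)
  show ?case
  proof (cases "s = t")
    case True
    have "set (alt s s (m s s)) \<subseteq> S" using set_alt braid(1) by metis
    then show ?thesis unfolding True[symmetric] using braid by (simp add: braid_eq.refl tail_S)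
  next
    case False
    let ?x = "alt s t (m s t)" and ?y = "alt t s (m s t)"
    have S: "set ?x \<subseteq> S" "set ?y \<subseteq> S" using set_alt braid(1,2) by metis+
    have ev: "ev ?x = ev ?y" by (rule ev_braid[OF braid(1-3)])
    have len: "length ?x = len (ev ?x)" "length ?y = len (ev ?y)"
      using len_alt[OF braid(1,2) False, of "m s t"] ev by simp_all
    have "head (?x @ v) = head (?y @ v)"
      using head_append[OF braid(5) S(1) len(1)] head_append[OF braid(5) S(2) len(2)] ev by simp
    moreover have "tail (?x @ v) \<approx> tail (?y @ v)"
      using head_append[OF braid(5) S(1) len(1)] head_append[OF braid(5) S(2) len(2)]
      unfolding ev by (metis braid_eq.sym braid_eq.trans)
    ultimately show ?thesis using head_prefix_cong[OF _ _ _ braid(4)] S braid(5) by simp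
  qed
qed

lemma cap_split:
  assumes "s \<in> S" "set u \<subseteq> S"
  shows "rw (head u) \<approx> rw (cap (gen s) (head u)) @ rw (- cap (gen s) (head u) + head u)"
proof -
  define a where "a = cap (gen s) (head u)"
  have W: "gen s \<in> W" "head u \<in> W" using assms head_W by simp_all
  have a: "a \<preceq> head u" "a \<in> W" using cap(1,2)[OF W] by (simp_all add: a_def)
  have "rw (a + (- a + head u)) \<approx> rw a @ rw (- a + head u)"
    using wleD(3)[OF a(1)] a W by (intro rw_add) simp_all
  then show ?thesis by (simp add: a_def)
qed

lemma rw_head_tail: "set u \<subseteq> S \<Longrightarrow> u \<approx> rw (head u) @ tail u"
proof (induction u)
  case Nil
  then show ?case by (simp add: rw_zero braid_eq.refl)
next
  case (Cons s u)
  have s: "s \<in> S" "set u \<subseteq> S" using Cons.prems by simp_all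
  define h where "h = head u"
  define a where "a = cap (gen s) h"
  have W: "gen s \<in> W" "h \<in> W" using s head_W by (simp_all add: h_def)
  have a: "a \<in> W" "len (gen s + a) = len (gen s) + len a" using cap(2,3)[OF W] by (simp_all add: a_def)
  have t: "tail u \<approx> tail u" using tail_S[OF s(2)] by (rule braid_eq.refl)
  have "set (rw (- a + h)) \<subseteq> S" using a W by (simp add: rw(1))
  then have rt: "rw (- a + h) @ tail u \<approx> rw (- a + h) @ tail u" using tail_S[OF s(2)] by (intro braid_eq.refl) simp
  have "s # u \<approx> s # rw h @ tail u"
    unfolding h_def using braid_eq_Cons[OF s(1) Cons.IH[OF s(2)]] .
  also have "s # rw h @ tail u \<approx> s # (rw a @ rw (- a + h)) @ tail u"
    using braid_eq_Cons[OF s(1) braid_eq_append[OF cap_split[OF s] t]] unfolding a_def h_def .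
  also have "s # (rw a @ rw (- a + h)) @ tail u \<approx> rw (gen s + a) @ rw (- a + h) @ tail u"
    using braid_eq_append[OF braid_eq.sym[OF rw_gen_add[OF s(1) a]] rt] by simp
  finally show ?case by (simp add: a_def h_def)
qed

text \<open>Prepending \<open>s\<close> splits the head of \<open>u\<close> into the part absorbed
  by \<open>s\<close> and a part pushed into the tail. Both are visible in the head and tail of
  \<open>s # u\<close>, so \<open>u\<close> can be recovered from them.\<close>

lemma braid_eq_cancel_Cons:
  assumes "s # u \<approx> s # v" shows "u \<approx> v"
proof -
  have s: "s \<in> S" "set u \<subseteq> S" "set v \<subseteq> S" using braid_eq_set[OF assms] by simp_all
  have *: "w \<approx> rw (cap (gen s) (head w)) @ tail (s # w)" if w: "set w \<subseteq> S" for w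
  proof -
    have "w \<approx> rw (head w) @ tail w" by (rule rw_head_tail[OF w])
    also have "rw (head w) @ tail w \<approx>
      (rw (cap (gen s) (head w)) @ rw (- cap (gen s) (head w) + head w)) @ tail w"
      by (rule braid_eq_append[OF cap_split[OF s(1) w] braid_eq.refl[OF tail_S[OF w]]])
    finally show ?thesis by simp
  qed
  have eq: "cap (gen s) (head u) = cap (gen s) (head v)" "tail (s # u) \<approx> tail (s # v)"
    using head_tail_cong[OF assms] by (simp, blast)
  have "cap (gen s) (head v) \<in> W" using s head_W by (simp add: cap(2))
  then have "rw (cap (gen s) (head v)) \<approx> rw (cap (gen s) (head v))" using rw(1) by (intro braid_eq.refl)
  then have "rw (cap (gen s) (head v)) @ tail (s # u) \<approx> rw (cap (gen s) (head v)) @ tail (s # v)"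
    using eq(2) by (rule braid_eq_append)
  then have "u \<approx> rw (cap (gen s) (head v)) @ tail (s # v)"
    using *[OF s(2)] unfolding eq(1) by (metis braid_eq.trans)
  then show ?thesis using braid_eq.sym[OF *[OF s(3)]] by (rule braid_eq.trans)
qed

lemma braid_eq_cancel: "p @ u \<approx> p @ v \<Longrightarrow> u \<approx> v"
  by (induction p) (auto dest: braid_eq_cancel_Cons)

section \<open>Divisibility and greatest common divisors of positive words\<close>

definition pdvd :: "'a list \<Rightarrow> 'a list \<Rightarrow> bool" where
  "pdvd u v \<longleftrightarrow> set u \<subseteq> S \<and> (\<exists>w. set w \<subseteq> S \<and> v \<approx> u @ w)"

lemma pdvdI: "v \<approx> u @ w \<Longrightarrow> pdvd u v"
  using braid_eq_set[of S m v "u @ w"] unfolding pdvd_def by (metis le_sup_iff set_append)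

lemma pdvdE:
  assumes "pdvd u v" obtains w where "set u \<subseteq> S" "set w \<subseteq> S" "v \<approx> u @ w" "set v \<subseteq> S"
  using assms braid_eq_set unfolding pdvd_def by metis

lemma pdvd_refl: "set u \<subseteq> S \<Longrightarrow> pdvd u u"
  by (rule pdvdI[of _ _ "[]"]) (simp add: braid_eq.refl)

lemma pdvd_trans:
  assumes "pdvd u v" "pdvd v w" shows "pdvd u w"
proof -
  obtain x where x: "v \<approx> u @ x" using assms(1) by (rule pdvdE)
  obtain y where y: "set y \<subseteq> S" "w \<approx> v @ y" using assms(2) by (rule pdvdE)
  have "w \<approx> (u @ x) @ y"
    using y(2) braid_eq_append[OF x braid_eq.refl[OF y(1)]] by (rule braid_eq.trans)
  then show ?thesis by (intro pdvdI) simp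
qed

lemma pdvd_gen_wle_head:
  assumes "pdvd [s] x" shows "gen s \<preceq> head x"
proof -
  obtain u where u: "set [s] \<subseteq> S" "set u \<subseteq> S" "x \<approx> [s] @ u" using assms by (rule pdvdE)
  then have "head x = gen s + cap (gen s) (head u)" using head_tail_cong[of x "[s] @ u"] by simp
  then show ?thesis
    using cap(2,3)[of "gen s" "head u"] u head_W[of u] wleI[of "gen s" "cap (gen s) (head u)"] by simp
qed

text \<open>Divisibility by a generator is visible in the head, so the question moves to the weak
  order, where \<open>alt_wle\<close> answers it; the alternating word is reduced and lifts back to
  a divisor.\<close>

lemma pdvd_alt:
  assumes "s \<noteq> t" "pdvd [s] x" "pdvd [t] x"
  shows "m s t \<noteq> 0 \<and> pdvd (alt s t (m s t)) x"
proof -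
  have st: "s \<in> S" "t \<in> S" and x: "set x \<subseteq> S"
    using pdvdE[OF assms(2)] pdvdE[OF assms(3)] by auto
  let ?a = "alt s t (m s t)"
  have m0: "m s t \<noteq> 0" and d: "ev ?a \<preceq> head x"
    using alt_wle[OF st assms(1) pdvd_gen_wle_head[OF assms(2)] pdvd_gen_wle_head[OF assms(3)]] by simp_all
  obtain z where z: "ev ?a \<in> W" "z \<in> W" "head x = ev ?a + z" "len (ev ?a + z) = len (ev ?a) + len z"
    using d by (rule wleE)
  have S: "set ?a \<subseteq> S" using set_alt st by metis
  have "rw (head x) \<approx> rw (ev ?a) @ rw z" unfolding z(3) by (rule rw_add[OF z(1,2,4)])
  moreover have "rw (ev ?a) @ rw z \<approx> ?a @ rw z"
    using len_alt[OF st assms(1), of "m s t"] S rw(1)[OF z(2)]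
    by (intro braid_eq_append[OF rw_ev braid_eq.refl]) simp_all
  ultimately have "rw (head x) \<approx> ?a @ rw z" by (rule braid_eq.trans)
  then have "rw (head x) @ tail x \<approx> (?a @ rw z) @ tail x"
    by (rule braid_eq_append[OF _ braid_eq.refl[OF tail_S[OF x]]])
  with rw_head_tail[OF x] have "x \<approx> (?a @ rw z) @ tail x" by (rule braid_eq.trans)
  then show ?thesis using m0 pdvdI by simp
qed

lemma pdvd_Cons_iff:
  assumes s: "s \<in> S" shows "pdvd (s # u) (s # v) \<longleftrightarrow> pdvd u v"
proof
  assume "pdvd (s # u) (s # v)"
  then obtain w where "s # v \<approx> (s # u) @ w" by (rule pdvdE)
  then have "s # v \<approx> s # (u @ w)" by simp
  then have "v \<approx> u @ w" by (rule braid_eq_cancel_Cons)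
  then show "pdvd u v" by (rule pdvdI)
next
  assume "pdvd u v"
  then obtain w where "v \<approx> u @ w" by (rule pdvdE)
  then have "s # v \<approx> s # (u @ w)" by (rule braid_eq_Cons[OF s])
  then show "pdvd (s # u) (s # v)" by (intro pdvdI[of _ _ w]) simp
qed

lemma pdvd_braid_eq: "u \<approx> v \<Longrightarrow> pdvd u v"
proof -
  assume "u \<approx> v"
  then have "v \<approx> u" by (rule braid_eq.sym)
  then show ?thesis by (intro pdvdI[of _ _ "[]"]) simp
qed

lemma pdvd_cong:
  assumes "u \<approx> u'" "v \<approx> v'" shows "pdvd u v \<longleftrightarrow> pdvd u' v'"
proof
  assume "pdvd u v"
  with pdvd_braid_eq[OF braid_eq.sym[OF assms(1)]] have "pdvd u' v" by (rule pdvd_trans)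
  then show "pdvd u' v'" using pdvd_braid_eq[OF assms(2)] by (rule pdvd_trans)
next
  assume "pdvd u' v'"
  with pdvd_braid_eq[OF assms(1)] have "pdvd u v'" by (rule pdvd_trans)
  then show "pdvd u v" using pdvd_braid_eq[OF braid_eq.sym[OF assms(2)]] by (rule pdvd_trans)
qed

text \<open>The same scheme as for meets in the Coxeter group: left cancellation makes division by
  \<open>s\<close> compatible with divisibility, and \<open>pdvd_alt\<close> supplies the
  joins.\<close>

lemma ex_pgcd:
  assumes "set x \<subseteq> S" "set y \<subseteq> S"
  shows "\<exists>d. pdvd d x \<and> pdvd d y \<and> (\<forall>e. pdvd e x \<and> pdvd e y \<longrightarrow> pdvd e d)"
proof (rule gcd_from_joins[where C = "{u. set u \<subseteq> S}" and S = S and gt = "\<lambda>s. [s]" and eps = "[]"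
      and size = length])
  fix x y z assume "pdvd x y" "pdvd y z"
  then show "pdvd x z" by (rule pdvd_trans)
next
  fix x y assume "pdvd x y"
  then show "x \<in> {u. set u \<subseteq> S} \<and> y \<in> {u. set u \<subseteq> S}" by (auto simp: pdvd_def dest: braid_eq_set)
next
  fix x assume "x \<in> {u. set u \<subseteq> S}"
  then show "pdvd [] x" by (intro pdvdI[of _ _ x]) (simp add: braid_eq.refl)
next
  fix x assume x: "x \<in> {u. set u \<subseteq> S}"
  show "(\<exists>s\<in>S. pdvd [s] x) \<or> (\<forall>y\<in>{u. set u \<subseteq> S}. pdvd x y)"
  proof (cases x)
    case Nil
    have "pdvd [] y" if "set y \<subseteq> S" for y
      using that by (intro pdvdI[of _ _ y]) (simp add: braid_eq.refl)
    then show ?thesis using Nil by simp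
  next
    case (Cons s v)
    then have "pdvd [s] x" using x by (intro pdvdI[of _ _ v]) (simp add: braid_eq.refl)
    then show ?thesis using x Cons by auto
  qed
next
  fix s x y assume s: "s \<in> S" and "pdvd [s] x" "pdvd [s] y"
  then obtain x' y' where x': "set x' \<subseteq> S" "x \<approx> [s] @ x'" and y': "set y' \<subseteq> S" "y \<approx> [s] @ y'"
    by (metis pdvdE)
  have xiff: "pdvd u x \<longleftrightarrow> pdvd u (s # x')" and yiff: "pdvd u y \<longleftrightarrow> pdvd u (s # y')" if "set u \<subseteq> S" for u
    using pdvd_cong[OF braid_eq.refl[OF that]] x' y' by simp_all
  show "\<exists>x'\<in>{u. set u \<subseteq> S}. \<exists>y'\<in>{u. set u \<subseteq> S}. \<exists>f. length x' < length x \<and>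
        (\<forall>d. pdvd d x' \<and> pdvd d y' \<longrightarrow> pdvd [s] (f d) \<and> pdvd (f d) x \<and> pdvd (f d) y) \<and>
        (\<forall>e. pdvd [s] e \<and> pdvd e x \<and> pdvd e y \<longrightarrow>
          (\<exists>e'. pdvd e' x' \<and> pdvd e' y' \<and> (\<forall>d. pdvd d x' \<and> pdvd e' d \<longrightarrow> pdvd e (f d))))"
  proof (rule bexI[of _ x'], rule bexI[of _ y'], rule exI[of _ "Cons s"], intro conjI allI impI)
    show "length x' < length x" using braid_eq_length[OF x'(2)] by simp
    show "x' \<in> {u. set u \<subseteq> S}" "y' \<in> {u. set u \<subseteq> S}" using x' y' by simp_all
    fix d assume d: "pdvd d x' \<and> pdvd d y'"
    then have dS: "set d \<subseteq> S" by (simp add: pdvd_def)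
    then show "pdvd [s] (s # d)" using s by (intro pdvdI[of _ _ d]) (simp add: braid_eq.refl)
    show "pdvd (s # d) x" "pdvd (s # d) y"
      using xiff[of "s # d"] yiff[of "s # d"] d dS s by (simp_all add: pdvd_Cons_iff)
  next
    fix e assume e: "pdvd [s] e \<and> pdvd e x \<and> pdvd e y"
    then obtain e' where e': "set e' \<subseteq> S" "e \<approx> [s] @ e'" by (metis pdvdE)
    have eiff: "pdvd e v \<longleftrightarrow> pdvd (s # e') v" if "set v \<subseteq> S" for v
      using pdvd_cong[OF e'(2) braid_eq.refl[OF that]] by simp
    have "set e \<subseteq> S" using braid_eq_set[OF e'(2)] by simp
    then have "pdvd e (s # x')" "pdvd e (s # y')" using e xiff yiff by simp_all
    then have "pdvd e' x'" "pdvd e' y'" using eiff[of "s # x'"] eiff[of "s # y'"] s x' y'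
      by (simp_all add: pdvd_Cons_iff)
    moreover have "pdvd e (s # d)" if "pdvd d x' \<and> pdvd e' d" for d
      using eiff[of "s # d"] that s by (simp add: pdvd_Cons_iff pdvd_def[of d])
    ultimately show "\<exists>e'. pdvd e' x' \<and> pdvd e' y' \<and> (\<forall>d. pdvd d x' \<and> pdvd e' d \<longrightarrow> pdvd e (s # d))"
      by blast
  qed
next
  fix s t x y
  assume st: "s \<in> S" "t \<in> S" and *: "pdvd [s] x" "pdvd [t] x" "pdvd [s] y" "pdvd [t] y"
  show "\<exists>j. pdvd [s] j \<and> pdvd [t] j \<and> pdvd j x \<and> pdvd j y"
  proof (cases "s = t")
    case True
    then show ?thesis using * pdvd_refl[of "[s]"] st by (intro exI[of _ "[s]"]) simp
  next
    case False
    then obtain k where k: "m s t = Suc k" using pdvd_alt[OF False *(1,2)] not0_implies_Suc by metis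
    have S: "set (alt s t (m s t)) \<subseteq> S" "set (alt t s (m s t)) \<subseteq> S" using set_alt st by metis+
    have b: "alt s t (m s t) \<approx> alt t s (m s t)"
      using braid_eq.braid[of s S t m "[]" "[]"] st k by (simp del: alt.simps)
    have "pdvd [s] (alt s t (m s t))" using S(1) unfolding k
      by (intro pdvdI[of _ _ "alt t s k"]) (simp add: braid_eq.refl)
    moreover have "pdvd [t] (alt s t (m s t))" using b unfolding k
      by (intro pdvdI[of _ _ "alt s t k"]) simp
    ultimately show ?thesis using pdvd_alt[OF False *(1,2)] pdvd_alt[OF False *(3,4)] by metis
  qed
qed (use assms in simp_all)

subsection \<open>The Garside element\<close>

definition dw :: "'a list" where
  "dw = rw w0"

definition flip :: "'a \<Rightarrow> 'a" where
  "flip s = (SOME t. t \<in> S \<and> gen t = w0 + gen s + w0)"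

text \<open>The complement of \<open>s\<close> in \<Delta>^2, on either side; it will stand in for
  the inverse letter of \<open>s\<close>.\<close>

definition star :: "'a \<Rightarrow> 'a list" where
  "star s = rw (gen s + w0) @ dw"

lemma dw_S: "set dw \<subseteq> S"
  using rw(1)[OF w0(1)] by (simp add: dw_def)

lemma w0_gen:
  assumes s: "s \<in> S"
  shows "gen s + w0 \<in> W" "len w0 = Suc (len (gen s + w0))" "dw \<approx> s # rw (gen s + w0)"
proof -
  have "gen s \<in> W" using s by simp
  from wle_w0[OF this] show l: "len w0 = Suc (len (gen s + w0))"
    using len_gen[OF s] uminus_gen[OF s] by (simp add: wle_def)
  show W: "gen s + w0 \<in> W" using s w0 by simp
  have "rw (gen s + (gen s + w0)) \<approx> s # rw (gen s + w0)"
    using l len_gen[OF s] by (intro rw_gen_add[OF s W]) (simp add: gen_gen_add[OF s])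
  then show "dw \<approx> s # rw (gen s + w0)" by (simp add: gen_gen_add[OF s] dw_def)
qed

text \<open>The element completing \<open>gen s + w0\<close> to \<open>w0\<close> has length 1,
  hence is a generator, and it equals the conjugate of \<open>gen s\<close> by \<open>w0\<close>.
  Two factorizations of \<Delta> result, and comparing them moves a letter past \<Delta>.\<close>

lemma flip:
  assumes s: "s \<in> S"
  shows "flip s \<in> S" "gen (flip s) = w0 + gen s + w0" "dw \<approx> rw (gen s + w0) @ [flip s]" "s # dw \<approx> dw @ [flip s]"
proof -
  let ?y = "gen s + w0"
  note y = w0_gen[OF s]
  define z where "z = - ?y + w0"
  have z: "z = w0 + gen s + w0"
    using minus_unique[OF w0_w0] by (simp add: z_def minus_add uminus_gen[OF s])
  have zW: "z \<in> W" using y w0 by (simp add: z_def)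
  have yz: "w0 = ?y + z" by (simp add: z_def)
  have lz: "len z = 1" using wleD(3)[OF wle_w0[OF y(1)]] y(2) by (simp add: z_def)
  obtain u where u: "set u \<subseteq> S" "ev u = z" "length u = len z" using zW by (rule reduced_word)
  then obtain t where t: "t \<in> S" "gen t = z" using lz by (cases u) auto
  then have "\<exists>t. t \<in> S \<and> gen t = w0 + gen s + w0" using z by blast
  from someI_ex[OF this] show f: "flip s \<in> S" "gen (flip s) = w0 + gen s + w0"
    unfolding flip_def by simp_all
  have "ev (rw ?y @ [flip s]) = w0" using rw(2)[OF y(1)] f(2) yz z by simp
  moreover have "rw (ev (rw ?y @ [flip s])) \<approx> rw ?y @ [flip s]"
    using rw[OF y(1)] f y(2) calculation by (intro rw_ev) simp_all
  ultimately show 1: "dw \<approx> rw ?y @ [flip s]" by (simp add: dw_def)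
  have "s # dw \<approx> s # rw ?y @ [flip s]" by (rule braid_eq_Cons[OF s 1])
  moreover have "(s # rw ?y) @ [flip s] \<approx> dw @ [flip s]"
    using f by (intro braid_eq_append[OF braid_eq.sym[OF y(3)] braid_eq.refl]) simp
  ultimately show "s # dw \<approx> dw @ [flip s]" by (simp add: braid_eq.trans[of S m "s # dw" "s # rw ?y @ [flip s]"])
qed

text \<open>The computation takes place among the group elements \<open>gen\<close>; Matsumoto's
  theorem then lifts it to one-letter words.\<close>

lemma flip_flip:
  assumes "s \<in> S" shows "[flip (flip s)] \<approx> [s]"
proof -
  have f: "flip s \<in> S" "flip (flip s) \<in> S" using flip(1) assms by simp_all
  have "gen (flip (flip s)) = w0 + (w0 + (gen s + (w0 + w0)))"
    using flip(2) assms f by (simp add: add.assoc)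
  also have "\<dots> = gen s" using w0_w0 by (simp flip: add.assoc)
  finally have "gen (flip (flip s)) = gen s" .
  then show ?thesis using f assms len_gen by (intro matsumoto) simp_all
qed

lemma dw_flip:
  assumes s: "s \<in> S" shows "flip s # dw \<approx> dw @ [s]"
  using flip(4)[OF flip(1)[OF s]] braid_eq_append[OF braid_eq.refl[OF dw_S] flip_flip[OF s]]
  by (rule braid_eq.trans)

lemma dw_dw_central_gen:
  assumes s: "s \<in> S" shows "s # dw @ dw \<approx> dw @ dw @ [s]"
proof -
  have "(s # dw) @ dw \<approx> (dw @ [flip s]) @ dw"
    by (rule braid_eq_append[OF flip(4)[OF s] braid_eq.refl[OF dw_S]])
  moreover have "dw @ (flip s # dw) \<approx> dw @ (dw @ [s])"
    by (rule braid_eq_append[OF braid_eq.refl[OF dw_S] dw_flip[OF s]])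
  ultimately show ?thesis by (simp add: braid_eq.trans[of S m "s # dw @ dw" "dw @ flip s # dw"])
qed

lemma dw_dw_central: "set u \<subseteq> S \<Longrightarrow> u @ dw @ dw \<approx> dw @ dw @ u"
proof (induction u)
  case Nil
  then show ?case using dw_S by (simp add: braid_eq.refl)
next
  case (Cons s u)
  then have s: "s \<in> S" "set u \<subseteq> S" by simp_all
  have "s # (u @ dw @ dw) \<approx> s # (dw @ dw @ u)" by (rule braid_eq_Cons[OF s(1) Cons.IH[OF s(2)]])
  moreover have "(s # dw @ dw) @ u \<approx> (dw @ dw @ [s]) @ u"
    by (rule braid_eq_append[OF dw_dw_central_gen[OF s(1)] braid_eq.refl[OF s(2)]])
  ultimately show ?case by (simp add: braid_eq.trans[of S m "s # u @ dw @ dw" "s # dw @ dw @ u"])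
qed

lemma star:
  assumes s: "s \<in> S"
  shows "set (star s) \<subseteq> S" "s # star s \<approx> dw @ dw" "star s @ [s] \<approx> dw @ dw"
proof -
  let ?y = "gen s + w0"
  have yS: "set (rw ?y) \<subseteq> S" using rw(1) w0_gen(1)[OF s] .
  then show "set (star s) \<subseteq> S" using dw_S by (simp add: star_def)
  have "(s # rw ?y) @ dw \<approx> dw @ dw"
    by (rule braid_eq_append[OF braid_eq.sym[OF w0_gen(3)[OF s]] braid_eq.refl[OF dw_S]])
  then show "s # star s \<approx> dw @ dw" by (simp add: star_def)
  have "rw ?y @ (dw @ [s]) \<approx> rw ?y @ (flip s # dw)"
    by (rule braid_eq_append[OF braid_eq.refl[OF yS] braid_eq.sym[OF dw_flip[OF s]]])
  moreover have "(rw ?y @ [flip s]) @ dw \<approx> dw @ dw"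
    by (rule braid_eq_append[OF braid_eq.sym[OF flip(3)[OF s]] braid_eq.refl[OF dw_S]])
  ultimately show "star s @ [s] \<approx> dw @ dw"
    by (simp add: star_def braid_eq.trans[of S m "rw ?y @ dw @ [s]" "rw ?y @ flip s # dw"])
qed

end

section \<open>Subgroups of Garside groups that are finite modulo the Garside element\<close>

text \<open>The abstract setting of the chain argument. Meets are given for positive elements only;
  \<open>absorb\<close> will extend them to the group, and the two halves of \<open>conj_P\<close>
  make the order invariant under right multiplication by \<open>D\<close> and by its
  inverse.\<close>

locale garside_group = group G for G (structure) +
  fixes P :: "'a set" and D :: 'a and deg :: "'a \<Rightarrow> int"
  assumes P_carrier: "P \<subseteq> carrier G"
    and one_P: "\<one> \<in> P"
    and mult_P: "\<lbrakk>p \<in> P; q \<in> P\<rbrakk> \<Longrightarrow> p \<otimes> q \<in> P"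
    and D_P: "D \<in> P"
    and conj_P: "p \<in> P \<Longrightarrow> inv D \<otimes> p \<otimes> D \<in> P" "p \<in> P \<Longrightarrow> D \<otimes> p \<otimes> inv D \<in> P"
    and absorb: "g \<in> carrier G \<Longrightarrow> \<exists>k::nat. g \<otimes> D [^] k \<in> P"
    and deg_mult: "\<lbrakk>g \<in> carrier G; h \<in> carrier G\<rbrakk> \<Longrightarrow> deg (g \<otimes> h) = deg g + deg h"
    and deg_nonneg: "p \<in> P \<Longrightarrow> 0 \<le> deg p"
    and deg_zero: "\<lbrakk>p \<in> P; deg p = 0\<rbrakk> \<Longrightarrow> p = \<one>"
    and gcd_P: "\<lbrakk>x \<in> P; y \<in> P\<rbrakk> \<Longrightarrow>
      \<exists>d\<in>P. inv d \<otimes> x \<in> P \<and> inv d \<otimes> y \<in> P \<and>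
        (\<forall>e\<in>P. inv e \<otimes> x \<in> P \<and> inv e \<otimes> y \<in> P \<longrightarrow> inv e \<otimes> d \<in> P)"
begin

definition gle :: "'a \<Rightarrow> 'a \<Rightarrow> bool" (infix \<open>\<lesssim>\<close> 50) where
  "x \<lesssim> y \<longleftrightarrow> x \<in> carrier G \<and> y \<in> carrier G \<and> inv x \<otimes> y \<in> P"

lemma PG [simp]: "p \<in> P \<Longrightarrow> p \<in> carrier G"
  using P_carrier by auto

lemma D_carrier [simp]: "D \<in> carrier G"
  using D_P by simp

lemma inv_mult_cancel [simp]:
  "\<lbrakk>x \<in> carrier G; y \<in> carrier G\<rbrakk> \<Longrightarrow> inv x \<otimes> (x \<otimes> y) = y"
  "\<lbrakk>x \<in> carrier G; y \<in> carrier G\<rbrakk> \<Longrightarrow> x \<otimes> (inv x \<otimes> y) = y"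
  by (simp_all flip: m_assoc)

lemma gle_trans: assumes "x \<lesssim> y" "y \<lesssim> z" shows "x \<lesssim> z"
proof -
  have c: "x \<in> carrier G" "y \<in> carrier G" "z \<in> carrier G" using assms by (auto simp: gle_def)
  have "inv x \<otimes> z = (inv x \<otimes> y) \<otimes> (inv y \<otimes> z)" using c by (simp add: m_assoc)
  moreover have "inv x \<otimes> y \<in> P" "inv y \<otimes> z \<in> P" using assms by (auto simp: gle_def)
  ultimately show ?thesis using mult_P c by (simp add: gle_def)
qed

lemma gle_refl: "x \<in> carrier G \<Longrightarrow> x \<lesssim> x"
  by (simp add: gle_def one_P)

lemma gle_mult_P: "x \<in> carrier G \<Longrightarrow> p \<in> P \<Longrightarrow> x \<lesssim> x \<otimes> p"
  by (simp add: gle_def)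

lemma P_iff_gle: "p \<in> P \<longleftrightarrow> \<one> \<lesssim> p"
  by (auto simp: gle_def)

lemma gle_mult_left: "h \<in> carrier G \<Longrightarrow> x \<lesssim> y \<Longrightarrow> h \<otimes> x \<lesssim> h \<otimes> y"
  by (auto simp: gle_def inv_mult_group m_assoc)

lemma gle_mult_D:
  assumes "x \<lesssim> y"
  shows "x \<otimes> D \<lesssim> y \<otimes> D" "x \<otimes> inv D \<lesssim> y \<otimes> inv D"
proof -
  have c: "x \<in> carrier G" "y \<in> carrier G" "inv x \<otimes> y \<in> P" using assms by (auto simp: gle_def)
  have "inv (x \<otimes> D) \<otimes> (y \<otimes> D) = inv D \<otimes> (inv x \<otimes> y) \<otimes> D"
    "inv (x \<otimes> inv D) \<otimes> (y \<otimes> inv D) = D \<otimes> (inv x \<otimes> y) \<otimes> inv D"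
    using c(1,2) by (simp_all add: inv_mult_group m_assoc)
  then show "x \<otimes> D \<lesssim> y \<otimes> D" "x \<otimes> inv D \<lesssim> y \<otimes> inv D"
    using c conj_P by (simp_all add: gle_def)
qed

lemma D_pow_Suc:
  "D [^] (j + 1 :: int) = D [^] j \<otimes> D" "D [^] (j - 1 :: int) = D [^] j \<otimes> inv D"
  by (simp_all add: int_pow_mult int_pow_diff)

lemma gle_mult_D_pow: "x \<lesssim> y \<Longrightarrow> x \<otimes> D [^] (j::int) \<lesssim> y \<otimes> D [^] j"
proof (induction j rule: int_induct[where k = 0])
  case base
  then show ?case by (simp add: gle_def)
next
  case (step1 i)
  then have "x \<otimes> D [^] i \<otimes> D \<lesssim> y \<otimes> D [^] i \<otimes> D" by (intro gle_mult_D) simp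
  then show ?case using step1(3) unfolding D_pow_Suc by (simp add: gle_def m_assoc)
next
  case (step2 i)
  then have "x \<otimes> D [^] i \<otimes> inv D \<lesssim> y \<otimes> D [^] i \<otimes> inv D" by (intro gle_mult_D) simp
  then show ?case using step2(3) unfolding D_pow_Suc by (simp add: gle_def m_assoc)
qed

lemma D_pow_cancel:
  "x \<in> carrier G \<Longrightarrow> x \<otimes> D [^] (i::int) \<otimes> D [^] (j::int) = x \<otimes> D [^] (i + j)"
  by (simp add: m_assoc int_pow_mult)

lemma gle_mult_D_pow_iff:
  assumes "x \<in> carrier G" "y \<in> carrier G"
  shows "x \<otimes> D [^] (j::int) \<lesssim> y \<otimes> D [^] j \<longleftrightarrow> x \<lesssim> y"
proof
  assume "x \<otimes> D [^] j \<lesssim> y \<otimes> D [^] j"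
  from gle_mult_D_pow[OF this, of "- j"] show "x \<lesssim> y" using assms by (simp add: D_pow_cancel)
qed (rule gle_mult_D_pow)

lemma D_pow_nat_P: "D [^] (n::nat) \<in> P"
  by (induction n) (simp_all add: one_P D_P mult_P)

lemma gle_D_pow: "i \<le> j \<Longrightarrow> x \<in> carrier G \<Longrightarrow> x \<otimes> D [^] (i::int) \<lesssim> x \<otimes> D [^] j"
proof -
  assume ij: "i \<le> j" and x: "x \<in> carrier G"
  obtain n where "j - i = int n" using ij zero_le_imp_eq_int[of "j - i"] by auto
  then have "D [^] (j - i) \<in> P" using D_pow_nat_P[of n] by (simp add: int_pow_int)
  then have "x \<otimes> D [^] i \<lesssim> x \<otimes> D [^] i \<otimes> D [^] (j - i)" using x by (intro gle_mult_P) simp_all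
  then show ?thesis using x by (simp add: D_pow_cancel)
qed

text \<open>A high power of \<open>D\<close> makes both elements positive; the gcd is taken there
  and shifted back. The difficulty is that a lower bound \<open>z\<close> may need a higher power
  than \<open>x\<close> and \<open>y\<close>, so the gcds for two different shifts have to be
  compared.\<close>

lemma ex_glb2:
  assumes x: "x \<in> carrier G" and y: "y \<in> carrier G"
  shows "\<exists>d. d \<lesssim> x \<and> d \<lesssim> y \<and> (\<forall>z. z \<lesssim> x \<and> z \<lesssim> y \<longrightarrow> z \<lesssim> d)"
proof -
  have pos_mono: "u \<otimes> D [^] i \<in> P \<Longrightarrow> i \<le> j \<Longrightarrow> u \<in> carrier G \<Longrightarrow> u \<otimes> D [^] j \<in> P" for u and i j :: int
    unfolding P_iff_gle using gle_D_pow gle_trans by blast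
  have pos: "\<exists>k::int. k \<ge> 0 \<and> u \<otimes> D [^] k \<in> P" if "u \<in> carrier G" for u
    using absorb[OF that] by (metis int_pow_int of_nat_0_le_iff)
  obtain k1 k2 :: int where k12: "k1 \<ge> 0" "x \<otimes> D [^] k1 \<in> P" "k2 \<ge> 0" "y \<otimes> D [^] k2 \<in> P"
    using pos x y by metis
  define k where "k = k1 + k2"
  have k: "x \<otimes> D [^] k \<in> P" "y \<otimes> D [^] k \<in> P"
    using pos_mono[OF k12(2) _ x, of k] pos_mono[OF k12(4) _ y, of k] k12 by (simp_all add: k_def)
  have gcd: "\<exists>d. d \<in> P \<and> d \<lesssim> u \<and> d \<lesssim> v \<and> (\<forall>e. e \<in> P \<and> e \<lesssim> u \<and> e \<lesssim> v \<longrightarrow> e \<lesssim> d)" if "u \<in> P" "v \<in> P" for u v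
    using gcd_P[OF that] that by (auto simp: gle_def)
  obtain d where d: "d \<in> P" "d \<lesssim> x \<otimes> D [^] k" "d \<lesssim> y \<otimes> D [^] k"
    "\<And>e. e \<in> P \<Longrightarrow> e \<lesssim> x \<otimes> D [^] k \<Longrightarrow> e \<lesssim> y \<otimes> D [^] k \<Longrightarrow> e \<lesssim> d"
    using gcd[OF k] by blast
  have shift: "a \<otimes> D [^] (- i) \<lesssim> b \<longleftrightarrow> a \<lesssim> b \<otimes> D [^] i" if "a \<in> carrier G" "b \<in> carrier G" for a b and i :: int
    using gle_mult_D_pow_iff[of "a \<otimes> D [^] (- i)" b i] that by (simp add: D_pow_cancel)
  have shift': "a \<lesssim> b \<otimes> D [^] (- i) \<longleftrightarrow> a \<otimes> D [^] i \<lesssim> b" if "a \<in> carrier G" "b \<in> carrier G" for a b and i :: int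
    using gle_mult_D_pow_iff[of a "b \<otimes> D [^] (- i)" i] that by (simp add: D_pow_cancel)
  have "z \<lesssim> d \<otimes> D [^] (- k)" if z: "z \<lesssim> x" "z \<lesssim> y" for z
  proof -
    have zG: "z \<in> carrier G" using z by (simp add: gle_def)
    obtain l :: int where l: "l \<ge> 0" "z \<otimes> D [^] k \<otimes> D [^] l \<in> P" using pos[of "z \<otimes> D [^] k"] zG by auto
    have kl: "x \<otimes> D [^] k \<otimes> D [^] l \<in> P" "y \<otimes> D [^] k \<otimes> D [^] l \<in> P"
      using pos_mono[of x k "k + l"] pos_mono[of y k "k + l"] k l x y by (simp_all add: D_pow_cancel)
    obtain d' where d': "d' \<in> P" "d' \<lesssim> x \<otimes> D [^] k \<otimes> D [^] l" "d' \<lesssim> y \<otimes> D [^] k \<otimes> D [^] l"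
      "\<And>e. e \<in> P \<Longrightarrow> e \<lesssim> x \<otimes> D [^] k \<otimes> D [^] l \<Longrightarrow> e \<lesssim> y \<otimes> D [^] k \<otimes> D [^] l \<Longrightarrow> e \<lesssim> d'"
      using gcd[OF kl] by blast
    have z': "z \<otimes> D [^] k \<otimes> D [^] l \<lesssim> d'"
      using d'(4)[OF l(2)] z by (simp add: gle_mult_D_pow)
    have "d \<otimes> D [^] l \<in> P" using pos_mono[of d 0 l] d(1) l(1) by simp
    then have "d \<otimes> D [^] l \<lesssim> d'" using d'(4) d(2,3) by (simp add: gle_mult_D_pow)
    moreover have "\<one> \<otimes> D [^] l \<lesssim> d \<otimes> D [^] l" using d(1) by (intro gle_mult_D_pow) (simp flip: P_iff_gle)
    \<comment> \<open>The gcd \<open>d'\<close> at the higher shift lies above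
      \<open>D [^] l\<close>. It can therefore be shifted down by \<open>l\<close> without leaving
      the positive elements, where \<open>d\<close> dominates it.\<close>
    ultimately have "\<one> \<otimes> D [^] l \<lesssim> d'" using gle_trans by blast
    then have "d' \<otimes> D [^] (- l) \<in> P" unfolding P_iff_gle using d'(1) by (subst shift') simp_all
    moreover have "d' \<otimes> D [^] (- l) \<lesssim> x \<otimes> D [^] k" "d' \<otimes> D [^] (- l) \<lesssim> y \<otimes> D [^] k"
      using d' x y by (simp_all add: shift)
    ultimately have "d' \<otimes> D [^] (- l) \<lesssim> d" by (rule d(4))
    then have "d' \<lesssim> d \<otimes> D [^] l" using d' d by (simp add: shift)
    with z' have "z \<otimes> D [^] k \<otimes> D [^] l \<lesssim> d \<otimes> D [^] l" by (rule gle_trans)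
    then have "z \<otimes> D [^] k \<lesssim> d" using gle_mult_D_pow_iff zG d(1) by simp
    then show ?thesis using shift' zG d(1) by simp
  qed
  moreover have "d \<otimes> D [^] (- k) \<lesssim> x" "d \<otimes> D [^] (- k) \<lesssim> y" using d x y by (simp_all add: shift)
  ultimately show ?thesis by blast
qed

lemma ex_glb:
  "finite A \<Longrightarrow> A \<noteq> {} \<Longrightarrow> A \<subseteq> carrier G \<Longrightarrow>
    \<exists>d\<in>carrier G. (\<forall>a\<in>A. d \<lesssim> a) \<and> (\<forall>z. (\<forall>a\<in>A. z \<lesssim> a) \<longrightarrow> z \<lesssim> d)"
proof (induction A rule: finite_ne_induct)
  case (singleton x)
  then show ?case using gle_refl by (intro bexI[of _ x]) simp_all
next
  case (insert x F)
  then obtain d where d: "d \<in> carrier G" "\<And>a. a \<in> F \<Longrightarrow> d \<lesssim> a" "\<And>z. (\<forall>a\<in>F. z \<lesssim> a) \<Longrightarrow> z \<lesssim> d"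
    by auto
  obtain e where e: "e \<lesssim> x" "e \<lesssim> d" "\<And>z. z \<lesssim> x \<and> z \<lesssim> d \<Longrightarrow> z \<lesssim> e"
    using ex_glb2[of x d] insert.prems d by auto
  have "e \<in> carrier G" using e by (simp add: gle_def)
  moreover have "\<forall>a\<in>insert x F. e \<lesssim> a" using e d(2) gle_trans by blast
  moreover have "\<forall>z. (\<forall>a\<in>insert x F. z \<lesssim> a) \<longrightarrow> z \<lesssim> e" using e d(3) by blast
  ultimately show ?case by blast
qed

section \<open>Degrees and the chain-shaped orbit\<close>

lemma deg_one: "deg \<one> = 0"
  using deg_mult[of \<one> \<one>] by simp

lemma deg_inv: "g \<in> carrier G \<Longrightarrow> deg (inv g) = - deg g"
  using deg_mult[of g "inv g"] deg_one by simp

lemma deg_D_pow: "deg (D [^] (j::int)) = j * deg D"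
proof (induction j rule: int_induct[where k = 0])
  case (step1 i)
  then show ?case unfolding D_pow_Suc by (simp add: deg_mult algebra_simps)
next
  case (step2 i)
  then show ?case unfolding D_pow_Suc by (simp add: deg_mult deg_inv algebra_simps)
qed (simp add: deg_one)

text \<open>The pairs \<open>(h, j)\<close> with \<open>deg h + j * deg D \<ge> 0\<close> act on \<open>G\<close> by \<open>y \<mapsto> h y D^j\<close>. The greatest lower
  bound \<open>x\<close> of the orbit of \<open>\<one>\<close> under this submonoid is moved upwards by all its elements, and
  of any two inverse pairs one has nonnegative degree, so that the orbit of \<open>x\<close> under all
  pairs is a chain.\<close>

theorem ex_chain_orbit:
  assumes H: "subgroup H G" and R: "finite R" "R \<subseteq> H"
    and HR: "\<And>h. h \<in> H \<Longrightarrow> \<exists>r\<in>R. \<exists>i::int. h = r \<otimes> D [^] i"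
  shows "\<exists>x\<in>carrier G. \<forall>h\<in>H. \<exists>j::int.
    inv x \<otimes> h \<otimes> x \<otimes> D [^] j \<in> P \<and> inv (inv x \<otimes> h \<otimes> x \<otimes> D [^] j) \<otimes> D \<in> P"
proof (cases "deg D = 0")
  case True
  \<comment> \<open>Degenerate case: with \<open>D\<close> trivial, \<open>absorb\<close> makes
    every element positive, so both an element and its inverse have nonnegative degree, which leaves
    only the identity.\<close>
  then have "D = \<one>" using deg_zero D_P by blast
  then have all: "g \<in> P" if "g \<in> carrier G" for g using absorb[OF that] that by simp
  have "h = \<one>" if "h \<in> H" for h
  proof -
    have h: "h \<in> carrier G" using that H subgroup.mem_carrier by metis
    then have "0 \<le> deg h" "0 \<le> deg (inv h)" using all deg_nonneg by simp_all
    then show ?thesis using deg_zero[OF all[OF h]] deg_inv[OF h] by simp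
  qed
  then have "inv \<one> \<otimes> h \<otimes> \<one> \<otimes> D [^] (0::int) = \<one>" if "h \<in> H" for h using that by fastforce
  then show ?thesis using one_P D_P by (intro bexI[of _ \<one>] ballI exI[of _ "0::int"]) simp_all
next
  case False
  define N where "N = deg D"
  have N: "N > 0" using False deg_nonneg[OF D_P] by (simp add: N_def)
  have HG: "h \<in> carrier G" if "h \<in> H" for h using that H subgroup.mem_carrier by metis
  \<comment> \<open>The least exponent for which the pair \<open>(h, j0 h)\<close> has nonnegative
    degree.\<close>
  define j0 where "j0 h = - (deg h div N)" for h
  have j0: "deg h + j0 h * N \<ge> 0" "deg h + (j0 h - 1) * N < 0" for h
  proof -
    have "deg h + j0 h * N = deg h mod N" by (simp add: j0_def minus_div_mult_eq_mod)
    moreover have "(j0 h - 1) * N = j0 h * N - N" by (simp add: left_diff_distrib)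
    ultimately show "deg h + j0 h * N \<ge> 0" "deg h + (j0 h - 1) * N < 0"
      using pos_mod_bound[OF N, of "deg h"] pos_mod_sign[OF N, of "deg h"] by linarith+
  qed
  have j0_le: "j0 h \<le> j" if "deg h + j * N \<ge> 0" for h j
  proof (rule ccontr)
    assume "\<not> j0 h \<le> j"
    then have "j * N \<le> (j0 h - 1) * N" using N by (intro mult_right_mono) auto
    then show False using that j0(2)[of h] by linarith
  qed
  \<comment> \<open>Finitely many elements suffice: changing a representative by a power of
    \<open>D\<close> only shifts the exponent, and larger exponents give larger elements.\<close>
  define A where "A = (\<lambda>r. r \<otimes> D [^] j0 r) ` R"
  have "R \<noteq> {}" using HR subgroup.one_closed[OF H] by blast
  moreover have "A \<subseteq> carrier G" using R HG by (auto simp: A_def)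
  ultimately obtain x where x: "x \<in> carrier G" "\<And>a. a \<in> A \<Longrightarrow> x \<lesssim> a" "\<And>z. (\<forall>a\<in>A. z \<lesssim> a) \<Longrightarrow> z \<lesssim> x"
    using ex_glb[of A] R by (auto simp: A_def)
  have low: "x \<lesssim> h \<otimes> D [^] j" if h: "h \<in> H" and j: "deg h + j * N \<ge> 0" for h j
  proof -
    obtain r i where r: "r \<in> R" "h = r \<otimes> D [^] (i::int)" using HR[OF h] by blast
    have rG: "r \<in> carrier G" using r R HG by blast
    have "deg r + (i + j) * N \<ge> 0" using j rG by (simp add: r(2) deg_mult deg_D_pow N_def algebra_simps)
    then have "r \<otimes> D [^] j0 r \<lesssim> r \<otimes> D [^] (i + j)" using j0_le rG by (intro gle_D_pow)
    moreover have "x \<lesssim> r \<otimes> D [^] j0 r" using x(2) r(1) by (simp add: A_def)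
    ultimately show ?thesis using gle_trans rG by (simp add: r(2) D_pow_cancel)
  qed
  have up: "x \<lesssim> h \<otimes> x \<otimes> D [^] j" if h: "h \<in> H" and j: "deg h + j * N \<ge> 0" for h j
  proof -
    have hG: "h \<in> carrier G" using h HG by blast
    \<comment> \<open>Pairs of nonnegative degree are closed under multiplication, so
      \<open>x\<close> also bounds the translates of \<open>A\<close>. Translating back shows that
      this element is a lower bound of \<open>A\<close>, hence below the greatest one.\<close>
    have "inv h \<otimes> x \<otimes> D [^] (- j) \<lesssim> a" if a: "a \<in> A" for a
    proof -
      obtain r where r: "r \<in> R" "a = r \<otimes> D [^] j0 r" using a by (auto simp: A_def)
      have rH: "r \<in> H" "r \<in> carrier G" using r R HG by auto
      have hr: "h \<otimes> r \<in> H" using h rH H subgroup.m_closed by metis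
      have "deg (h \<otimes> r) + (j0 r + j) * N \<ge> 0"
        using j j0(1)[of r] hG rH by (simp add: deg_mult algebra_simps)
      from low[OF hr this] have "inv h \<otimes> x \<lesssim> inv h \<otimes> (h \<otimes> r \<otimes> D [^] (j0 r + j))"
        using hG by (intro gle_mult_left) simp
      also have "inv h \<otimes> (h \<otimes> r \<otimes> D [^] (j0 r + j)) = a \<otimes> D [^] j"
        using hG rH by (simp add: r(2) m_assoc int_pow_mult)
      finally have "inv h \<otimes> x \<otimes> D [^] (- j) \<lesssim> a \<otimes> D [^] j \<otimes> D [^] (- j)" by (rule gle_mult_D_pow)
      then show ?thesis using rH by (simp add: r(2) D_pow_cancel)
    qed
    then have "inv h \<otimes> x \<otimes> D [^] (- j) \<lesssim> x" using x(3) by blast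
    from gle_mult_D_pow[OF this, of j] have "inv h \<otimes> x \<lesssim> x \<otimes> D [^] j"
      using hG x(1) by (simp add: D_pow_cancel)
    from gle_mult_left[OF hG this] show ?thesis using hG x(1) by (simp add: m_assoc)
  qed
  show ?thesis
  proof (intro bexI[OF _ x(1)] ballI exI conjI)
    fix h assume h: "h \<in> H"
    have hG: "h \<in> carrier G" using h HG by blast
    have 1: "x \<lesssim> h \<otimes> x \<otimes> D [^] j0 h" using up[OF h j0(1)] .
    then show "inv x \<otimes> h \<otimes> x \<otimes> D [^] j0 h \<in> P" using x(1) hG by (simp add: gle_def m_assoc)
    \<comment> \<open>By minimality the pair \<open>(h, j0 h - 1)\<close> has negative degree, so
      its inverse \<open>(inv h, 1 - j0 h)\<close> moves \<open>x\<close> upwards as well. The shift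
      by one becomes the upper bound \<open>x \<otimes> D\<close>.\<close>
    have "inv h \<in> H" using h H subgroup.m_inv_closed by metis
    moreover have "deg (inv h) + (1 - j0 h) * N \<ge> 0" using j0(2)[of h] hG by (simp add: deg_inv algebra_simps)
    ultimately have "x \<lesssim> inv h \<otimes> x \<otimes> D [^] (1 - j0 h)" by (rule up)
    from gle_mult_left[OF hG gle_mult_D_pow[OF this, of "j0 h"]]
    have "h \<otimes> (x \<otimes> D [^] j0 h) \<lesssim> h \<otimes> (inv h \<otimes> x \<otimes> D [^] (1 - j0 h) \<otimes> D [^] j0 h)" .
    also have "\<dots> = x \<otimes> D"
      using hG x(1) int_pow_mult[of D "1 - j0 h" "j0 h"] by (simp add: m_assoc)
    finally have "inv (h \<otimes> (x \<otimes> D [^] j0 h)) \<otimes> (x \<otimes> D) \<in> P" by (simp add: gle_def)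
    moreover have "inv (inv x \<otimes> h \<otimes> x \<otimes> D [^] j0 h) \<otimes> D = inv (h \<otimes> (x \<otimes> D [^] j0 h)) \<otimes> (x \<otimes> D)"
      using hG x(1) by (simp add: inv_mult_group m_assoc)
    ultimately show "inv (inv x \<otimes> h \<otimes> x \<otimes> D [^] j0 h) \<otimes> D \<in> P" by simp
  qed
qed

end

section \<open>Artin groups\<close>

definition acl :: "'a set \<Rightarrow> ('a \<Rightarrow> 'a \<Rightarrow> nat) \<Rightarrow> ('a \<times> bool) list \<Rightarrow> 'a artin_elt" where
  "acl S m w = art_rel S m `` {w}"

definition wdeg :: "('a \<times> bool) list \<Rightarrow> int" where
  "wdeg w = sum_list (map (\<lambda>l. if snd l then 1 else - 1) w)"

definition adeg :: "'a artin_elt \<Rightarrow> int" where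
  "adeg X = wdeg (SOME w. w \<in> X)"

lemma pos_simps [simp]: "pos [] = []" "pos (s # u) = (s, True) # pos u" "pos (u @ v) = pos u @ pos v"
  by (auto simp: pos_def)

lemma set_pos: "set (pos u) \<subseteq> S \<times> UNIV \<longleftrightarrow> set u \<subseteq> S"
  by (auto simp: pos_def)

lemma map_fst_pos [simp]: "map fst (pos u) = u"
  by (induction u) auto

lemma wdeg_simps [simp]: "wdeg [] = 0" "wdeg (l # w) = (if snd l then 1 else - 1) + wdeg w"
  "wdeg (v @ w) = wdeg v + wdeg w"
  by (auto simp: wdeg_def)

lemma wdeg_pos [simp]: "wdeg (pos u) = int (length u)"
  by (induction u) auto

lemma posword_pos: "posword (pos u)"
  by (auto simp: posword_def pos_def)

lemma poswordD: "posword w \<Longrightarrow> w = pos (map fst w)"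
  by (induction w) (auto simp: posword_def)

lemma art_eq_set: "art_eq S m u v \<Longrightarrow> set u \<subseteq> S \<times> UNIV \<and> set v \<subseteq> S \<times> UNIV"
proof (induction rule: art_eq.induct)
  case (braid s t u v)
  then have "set (pos (alt s t (m s t))) \<subseteq> S \<times> UNIV" "set (pos (alt t s (m s t))) \<subseteq> S \<times> UNIV"
    by (simp_all only: set_pos set_alt)
  then show ?case using braid by simp
qed auto

lemma art_eq_wdeg: "art_eq S m u v \<Longrightarrow> wdeg u = wdeg v"
  by (induction rule: art_eq.induct) auto

lemma art_eq_ctxt:
  "art_eq S m u v \<Longrightarrow> set x \<subseteq> S \<times> UNIV \<Longrightarrow> set y \<subseteq> S \<times> UNIV \<Longrightarrow> art_eq S m (x @ u @ y) (x @ v @ y)"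
proof (induction rule: art_eq.induct)
  case (refl w)
  then show ?case by (simp add: art_eq.refl)
next
  case (free s u v b)
  then show ?case using art_eq.free[of s S "x @ u" "v @ y" m b] by simp
next
  case (braid s t u v)
  then show ?case using art_eq.braid[of s S t m "x @ u" "v @ y"] by simp
qed (auto intro: art_eq.sym art_eq.trans)

lemma art_eq_append:
  assumes "art_eq S m u u'" "art_eq S m v v'"
  shows "art_eq S m (u @ v) (u' @ v')"
  using art_eq_ctxt[OF assms(1), of "[]" v] art_eq_ctxt[OF assms(2), of u' "[]"]
    art_eq_set[OF assms(1)] art_eq_set[OF assms(2)] by (auto intro: art_eq.trans)

lemma set_map_fst: "set u \<subseteq> S \<times> UNIV \<Longrightarrow> set (map fst u) \<subseteq> S"
  by auto

lemma art_eq_imp_cox_eq: "art_eq S m u v \<Longrightarrow> cox_eq S m (map fst u) (map fst v)"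
proof (induction rule: art_eq.induct)
  case (refl w)
  then show ?case by (intro cox_eq.refl) auto
next
  case (free s u v b)
  then have "cox_eq S m (map fst u @ [s, s] @ map fst v) (map fst u @ map fst v)"
    by (intro cox_eq.square set_map_fst)
  then show ?case by simp
next
  case (braid s t u v)
  then have "cox_eq S m (map fst u @ alt s t (m s t) @ map fst v) (map fst u @ alt t s (m s t) @ map fst v)"
    by (intro cox_eq.braid set_map_fst)
  then show ?case by simp
qed (auto intro: cox_eq.sym cox_eq.trans)

lemma braid_eq_imp_art_eq: "braid_eq S m u v \<Longrightarrow> art_eq S m (pos u) (pos v)"
proof (induction rule: braid_eq.induct)
  case (refl w)
  then show ?case by (intro art_eq.refl) (simp add: set_pos)
next
  case (braid s t u v)
  then show ?case using art_eq.braid[of s S t m "pos u" "pos v"] by (simp add: set_pos)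
qed (auto intro: art_eq.sym art_eq.trans)

lemma in_acl: "w \<in> acl S m u \<longleftrightarrow> art_eq S m u w"
  by (simp add: acl_def art_rel_def)

lemma acl_eq_iff: "set u \<subseteq> S \<times> UNIV \<Longrightarrow> acl S m u = acl S m v \<longleftrightarrow> art_eq S m u v"
proof
  assume "set u \<subseteq> S \<times> UNIV" "acl S m u = acl S m v"
  then show "art_eq S m u v" using in_acl[of u S m] art_eq.refl art_eq.sym by metis
next
  assume "art_eq S m u v"
  then show "acl S m u = acl S m v"
    unfolding set_eq_iff in_acl using art_eq.sym art_eq.trans by metis
qed

lemma carrier_artin: "carrier (artin S m) = acl S m ` {w. set w \<subseteq> S \<times> UNIV}"
  by (auto simp: artin_def quotient_def acl_def)

lemma one_artin: "\<one>\<^bsub>artin S m\<^esub> = acl S m []"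
  by (simp add: artin_def acl_def)

lemma mult_acl:
  assumes "set u \<subseteq> S \<times> UNIV" "set v \<subseteq> S \<times> UNIV"
  shows "acl S m u \<otimes>\<^bsub>artin S m\<^esub> acl S m v = acl S m (u @ v)"
proof -
  have "w \<in> art_rel S m `` {x @ y |x y. x \<in> acl S m u \<and> y \<in> acl S m v} \<longleftrightarrow> w \<in> acl S m (u @ v)" for w
  proof
    assume "w \<in> art_rel S m `` {x @ y |x y. x \<in> acl S m u \<and> y \<in> acl S m v}"
    then obtain x y where "art_eq S m u x" "art_eq S m v y" "art_eq S m (x @ y) w"
      by (auto simp: in_acl art_rel_def)
    then show "w \<in> acl S m (u @ v)" unfolding in_acl using art_eq_append art_eq.trans by metis
  next
    assume "w \<in> acl S m (u @ v)"
    then have "(u @ v, w) \<in> art_rel S m" by (simp add: in_acl art_rel_def)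
    moreover have "u \<in> acl S m u" "v \<in> acl S m v" using assms art_eq.refl by (simp_all add: in_acl)
    ultimately show "w \<in> art_rel S m `` {x @ y |x y. x \<in> acl S m u \<and> y \<in> acl S m v}" by blast
  qed
  then show ?thesis by (auto simp: artin_def)
qed

definition winv :: "('a \<times> bool) list \<Rightarrow> ('a \<times> bool) list" where
  "winv w = map (\<lambda>l. (fst l, \<not> snd l)) (rev w)"

lemma winv_set: "set (winv w) \<subseteq> S \<times> UNIV \<longleftrightarrow> set w \<subseteq> S \<times> UNIV"
  by (auto simp: winv_def)

lemma winv_append: "set w \<subseteq> S \<times> UNIV \<Longrightarrow> art_eq S m (winv w @ w) []"
proof (induction w)
  case Nil
  then show ?case by (simp add: winv_def art_eq.refl)
next
  case (Cons l w)
  obtain s b where l: "l = (s, b)" by (cases l)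
  have s: "s \<in> S" "set w \<subseteq> S \<times> UNIV" using Cons.prems l by auto
  have "art_eq S m (winv w @ [(s, \<not> b), (s, \<not> \<not> b)] @ w) (winv w @ w)"
    using s by (intro art_eq.free) (simp_all add: winv_set)
  then have "art_eq S m (winv (l # w) @ l # w) (winv w @ w)" by (simp add: winv_def l)
  then show ?case using Cons.IH[OF s(2)] by (rule art_eq.trans)
qed

lemma group_artin: "group (artin S m)"
proof (rule groupI)
  show "\<one>\<^bsub>artin S m\<^esub> \<in> carrier (artin S m)" by (auto simp: one_artin carrier_artin)
next
  fix x y assume "x \<in> carrier (artin S m)" "y \<in> carrier (artin S m)"
  then obtain u v where "set u \<subseteq> S \<times> UNIV" "set v \<subseteq> S \<times> UNIV" "x = acl S m u" "y = acl S m v"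
    by (auto simp: carrier_artin)
  then show "x \<otimes>\<^bsub>artin S m\<^esub> y \<in> carrier (artin S m)" by (auto simp: mult_acl carrier_artin)
next
  fix x y z assume "x \<in> carrier (artin S m)" "y \<in> carrier (artin S m)" "z \<in> carrier (artin S m)"
  then obtain u v w where "set u \<subseteq> S \<times> UNIV" "set v \<subseteq> S \<times> UNIV" "set w \<subseteq> S \<times> UNIV"
    "x = acl S m u" "y = acl S m v" "z = acl S m w"
    by (auto simp: carrier_artin)
  then show "x \<otimes>\<^bsub>artin S m\<^esub> y \<otimes>\<^bsub>artin S m\<^esub> z = x \<otimes>\<^bsub>artin S m\<^esub> (y \<otimes>\<^bsub>artin S m\<^esub> z)"
    by (simp add: mult_acl)
next
  fix x assume "x \<in> carrier (artin S m)"
  then obtain u where u: "set u \<subseteq> S \<times> UNIV" "x = acl S m u" by (auto simp: carrier_artin)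
  then show "\<one>\<^bsub>artin S m\<^esub> \<otimes>\<^bsub>artin S m\<^esub> x = x" by (simp add: one_artin mult_acl)
  have i: "set (winv u) \<subseteq> S \<times> UNIV" using u by (simp add: winv_set)
  then have "acl S m (winv u) \<otimes>\<^bsub>artin S m\<^esub> x = \<one>\<^bsub>artin S m\<^esub>"
    unfolding u(2) mult_acl[OF i u(1)] one_artin using winv_append[OF u(1)] i u(1) by (subst acl_eq_iff) simp_all
  then show "\<exists>y\<in>carrier (artin S m). y \<otimes>\<^bsub>artin S m\<^esub> x = \<one>\<^bsub>artin S m\<^esub>"
    using i by (auto simp: carrier_artin)
qed

lemma adeg_acl: "set w \<subseteq> S \<times> UNIV \<Longrightarrow> adeg (acl S m w) = wdeg w"
proof -
  assume "set w \<subseteq> S \<times> UNIV"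
  then have "w \<in> acl S m w" by (simp add: in_acl art_eq.refl)
  then have "(SOME v. v \<in> acl S m w) \<in> acl S m w" by (rule someI)
  then show ?thesis unfolding adeg_def in_acl using art_eq_wdeg by metis
qed

context finite_coxeter_group
begin

subsection \<open>The positive monoid embeds into the Artin group\<close>

text \<open>Clearing denominators: since an inverse letter is \<open>star\<close> over the central
  \<Delta>^2, \<open>conv w\<close> represents \<open>w\<close> times
  \<open>dpow (negs w)\<close>.\<close>

fun conv :: "('a \<times> bool) list \<Rightarrow> 'a list" where
  "conv [] = []"
| "conv (l # w) = (if snd l then [fst l] else star (fst l)) @ conv w"

definition negs :: "('a \<times> bool) list \<Rightarrow> nat" where
  "negs w = length (filter (\<lambda>l. \<not> snd l) w)"

definition dpow :: "nat \<Rightarrow> 'a list" where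
  "dpow k = concat (replicate k (dw @ dw))"

lemma conv_append [simp]: "conv (u @ v) = conv u @ conv v"
  by (induction u) auto

lemma conv_S: "set w \<subseteq> S \<times> UNIV \<Longrightarrow> set (conv w) \<subseteq> S"
proof (induction w)
  case (Cons l w)
  then show ?case using star(1)[of "fst l"] by (cases l) auto
qed simp

lemma conv_pos [simp]: "conv (pos u) = u"
  by (induction u) auto

lemma negs_append [simp]: "negs (u @ v) = negs u + negs v"
  by (simp add: negs_def)

lemma negs_pos [simp]: "negs (pos u) = 0"
  by (auto simp: negs_def pos_def)

lemma dpow_add: "dpow (j + k) = dpow j @ dpow k"
  by (simp add: dpow_def replicate_add)

lemma dpow_simps: "dpow 0 = []" "dpow (Suc k) = dw @ dw @ dpow k"
  by (simp_all add: dpow_def)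

lemma dpow_S: "set (dpow k) \<subseteq> S"
  using dw_S by (induction k) (simp_all add: dpow_simps)

lemma dpow_central: "set u \<subseteq> S \<Longrightarrow> u @ dpow k \<approx> dpow k @ u"
proof (induction k)
  case 0
  then show ?case by (simp add: dpow_simps braid_eq.refl)
next
  case (Suc k)
  have d: "dw @ dw \<approx> dw @ dw" using dw_S by (intro braid_eq.refl) simp
  have "(u @ dw @ dw) @ dpow k \<approx> (dw @ dw @ u) @ dpow k"
    by (rule braid_eq_append[OF dw_dw_central[OF Suc.prems] braid_eq.refl[OF dpow_S]])
  moreover have "(dw @ dw) @ (u @ dpow k) \<approx> (dw @ dw) @ (dpow k @ u)"
    by (rule braid_eq_append[OF d Suc.IH[OF Suc.prems]])
  ultimately show ?case by (simp add: dpow_simps braid_eq.trans[of S m "u @ dw @ dw @ dpow k" "dw @ dw @ u @ dpow k"])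
qed

lemma dpow_cancel_right:
  assumes "u @ dpow k \<approx> v @ dpow k" shows "u \<approx> v"
proof -
  have uv: "set u \<subseteq> S" "set v \<subseteq> S" using braid_eq_set[OF assms] by simp_all
  have "dpow k @ u \<approx> u @ dpow k" by (rule braid_eq.sym[OF dpow_central[OF uv(1)]])
  also note assms
  also have "v @ dpow k \<approx> dpow k @ v" by (rule dpow_central[OF uv(2)])
  finally show ?thesis by (rule braid_eq_cancel)
qed

text \<open>Free reduction changes the number of inverse letters, so the two sides are compared
  after cross-multiplication by powers of \<Delta>^2. Transitivity leaves a surplus factor
  \<open>dpow (negs y)\<close>; removing it uses centrality and left cancellation in the
  monoid.\<close>

lemma conv_cong: "art_eq S m x y \<Longrightarrow> conv x @ dpow (negs y) \<approx> conv y @ dpow (negs x)"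
proof (induction rule: art_eq.induct)
  case (refl w)
  then show ?case using conv_S dpow_S by (intro braid_eq.refl) simp
next
  case (sym x y)
  show ?case by (rule braid_eq.sym[OF sym.IH])
next
  case (trans x y z)
  have app: "u @ dpow k \<approx> v @ dpow k" if "u \<approx> v" for u v k
    using braid_eq_append[OF that braid_eq.refl[OF dpow_S]] .
  have "conv x @ dpow (negs y + negs z) \<approx> conv y @ dpow (negs x + negs z)"
    using app[OF trans.IH(1), of "negs z"] by (simp add: dpow_add)
  moreover have "conv y @ dpow (negs z + negs x) \<approx> conv z @ dpow (negs y + negs x)"
    using app[OF trans.IH(2), of "negs x"] by (simp add: dpow_add)
  ultimately have "conv x @ dpow (negs z + negs y) \<approx> conv z @ dpow (negs x + negs y)"
    unfolding add.commute[of "negs z"] add.commute[of "negs x" "negs y"] by (rule braid_eq.trans)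
  then have "(conv x @ dpow (negs z)) @ dpow (negs y) \<approx> (conv z @ dpow (negs x)) @ dpow (negs y)"
    by (simp add: dpow_add)
  then show ?case by (rule dpow_cancel_right)
next
  case (free s u v b)
  define n where "n = negs u + negs v"
  have S: "set (conv u) \<subseteq> S" "set (conv v) \<subseteq> S" using free conv_S by simp_all
  have neg: "negs (u @ [(s, b), (s, \<not> b)] @ v) = Suc n" "negs (u @ v) = n"
    by (simp_all add: negs_def n_def)
  have "conv [(s, b), (s, \<not> b)] \<approx> dw @ dw" using star(2,3)[OF free(1)] by simp
  then have "conv u @ (conv [(s, b), (s, \<not> b)] @ (conv v @ dpow n)) \<approx> conv u @ ((dw @ dw) @ (conv v @ dpow n))"
    using S dpow_S by (intro braid_eq_append) (simp_all add: braid_eq.refl)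
  moreover have "conv u @ ((dw @ dw @ conv v) @ dpow n) \<approx> conv u @ ((conv v @ dw @ dw) @ dpow n)"
    by (rule braid_eq_ctxt[OF braid_eq.sym[OF dw_dw_central[OF S(2)]] S(1) dpow_S])
  ultimately have "conv u @ conv [(s, b), (s, \<not> b)] @ conv v @ dpow n \<approx> conv u @ conv v @ dw @ dw @ dpow n"
    by (simp add: braid_eq.trans[of S m _ "conv u @ dw @ dw @ conv v @ dpow n"])
  then show ?case unfolding neg by (simp add: dpow_simps)
next
  case (braid s t u v)
  have S: "set (conv u) \<subseteq> S" "set (conv v @ dpow (negs u + negs v)) \<subseteq> S" using braid conv_S dpow_S by simp_all
  from braid_eq.braid[of s S t m, OF braid(1-3) S] show ?case by simp
qed

definition pw :: "'a list \<Rightarrow> 'a artin_elt" where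
  "pw u = acl S m (pos u)"

abbreviation A where "A \<equiv> artin S m"
abbreviation amult (infixl \<open>\<cdot>\<close> 70) where "x \<cdot> y \<equiv> x \<otimes>\<^bsub>A\<^esub> y"
abbreviation P where "P \<equiv> artin_pos S m"

text \<open>Positive words have no denominators, so \<open>conv_cong\<close> returns plain braid
  equivalence: the monoid embeds into the group.\<close>

lemma pw_eq_iff:
  assumes "set u \<subseteq> S" shows "pw u = pw v \<longleftrightarrow> u \<approx> v"
proof
  assume "pw u = pw v"
  then have "art_eq S m (pos u) (pos v)" using assms acl_eq_iff[of "pos u"] by (simp add: pw_def set_pos)
  from conv_cong[OF this] show "u \<approx> v" by (simp add: dpow_simps)
next
  assume "u \<approx> v"
  from braid_eq_imp_art_eq[OF this] show "pw u = pw v"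
    using assms acl_eq_iff[of "pos u"] by (simp add: pw_def set_pos)
qed

lemma pw_cong: "u \<approx> v \<Longrightarrow> pw u = pw v"
  using pw_eq_iff braid_eq_set by metis

lemma pw_mult: "set u \<subseteq> S \<Longrightarrow> set v \<subseteq> S \<Longrightarrow> pw u \<cdot> pw v = pw (u @ v)"
  by (simp add: pw_def mult_acl set_pos)

lemma pw_one: "pw [] = \<one>\<^bsub>A\<^esub>"
  by (simp add: pw_def one_artin)

lemma artin_pos_eq: "P = pw ` {u. set u \<subseteq> S}"
proof (intro equalityI subsetI)
  fix X assume "X \<in> P"
  then obtain w where w: "X \<in> carrier A" "w \<in> X" "posword w" by (auto simp: artin_pos_def)
  then obtain v where v: "set v \<subseteq> S \<times> UNIV" "X = acl S m v" by (auto simp: carrier_artin)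
  have "art_eq S m v w" using w(2) v(2) by (simp add: in_acl)
  then have "X = acl S m w" "set w \<subseteq> S \<times> UNIV" using acl_eq_iff[OF v(1)] art_eq_set v(2) by metis+
  then have "X = pw (map fst w)" "set (map fst w) \<subseteq> S"
    using poswordD[OF w(3)] set_pos[of "map fst w" S] unfolding pw_def by metis+
  then show "X \<in> pw ` {u. set u \<subseteq> S}" by auto
next
  fix X assume "X \<in> pw ` {u. set u \<subseteq> S}"
  then obtain u where u: "set u \<subseteq> S" "X = pw u" by auto
  then have "pos u \<in> X" by (simp add: pw_def in_acl art_eq.refl set_pos)
  moreover have "X \<in> carrier A"
    unfolding u(2) pw_def carrier_artin by (rule imageI) (simp add: set_pos u(1))
  ultimately show "X \<in> P" using posword_pos by (auto simp: artin_pos_def)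
qed

lemma artin_posE:
  assumes "X \<in> P" obtains u where "set u \<subseteq> S" "X = pw u"
  using assms unfolding artin_pos_eq by blast

lemma pw_P: "set u \<subseteq> S \<Longrightarrow> pw u \<in> P"
  by (simp add: artin_pos_eq)

lemma adeg_pw: "set u \<subseteq> S \<Longrightarrow> adeg (pw u) = int (length u)"
  by (simp add: pw_def adeg_acl set_pos)

interpretation A: group A
  by (rule group_artin)

lemma pw_carrier: "set u \<subseteq> S \<Longrightarrow> pw u \<in> carrier A"
  using pw_P by (simp add: artin_pos_def)

lemma inv_pw_mult_P:
  assumes "set u \<subseteq> S" "set v \<subseteq> S"
  shows "inv\<^bsub>A\<^esub> (pw u) \<cdot> pw v \<in> P \<longleftrightarrow> pdvd u v"
proof
  note c = pw_carrier[OF assms(1)] pw_carrier[OF assms(2)]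
  assume "inv\<^bsub>A\<^esub> (pw u) \<cdot> pw v \<in> P"
  then obtain w where w: "set w \<subseteq> S" "inv\<^bsub>A\<^esub> (pw u) \<cdot> pw v = pw w" by (auto simp: artin_pos_eq)
  then have "pw u \<cdot> pw w = pw u \<cdot> (inv\<^bsub>A\<^esub> (pw u) \<cdot> pw v)" by simp
  also have "\<dots> = pw v" using c by (simp flip: A.m_assoc)
  finally have "pw v = pw (u @ w)" using pw_mult[OF assms(1) w(1)] by simp
  then have "v \<approx> u @ w" using pw_eq_iff[OF assms(2)] by simp
  then show "pdvd u v" by (rule pdvdI)
next
  assume "pdvd u v"
  then obtain w where w: "set w \<subseteq> S" "v \<approx> u @ w" by (rule pdvdE)
  then have "pw v = pw u \<cdot> pw w" using pw_cong pw_mult[OF assms(1) w(1)] by simp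
  then have "inv\<^bsub>A\<^esub> (pw u) \<cdot> pw v = pw w"
    using pw_carrier assms w(1) by (simp flip: A.m_assoc)
  then show "inv\<^bsub>A\<^esub> (pw u) \<cdot> pw v \<in> P" using pw_P w(1) by simp
qed

subsection \<open>Atoms and the Garside element\<close>

definition ccl :: "'a list \<Rightarrow> 'a list set" where
  "ccl u = cox_rel S m `` {u}"

lemma in_ccl: "v \<in> ccl u \<longleftrightarrow> cox_eq S m u v"
  by (simp add: ccl_def cox_rel_def)

lemma ccl_eq_iff:
  assumes "set u \<subseteq> S" "set v \<subseteq> S" shows "ccl u = ccl v \<longleftrightarrow> ev u = ev v"
proof -
  have "ccl u = ccl v \<longleftrightarrow> cox_eq S m u v"
  proof
    assume "ccl u = ccl v"
    then show "cox_eq S m u v" using in_ccl[of v u] in_ccl[of v v] cox_eq.refl[OF assms(2)] by simp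
  next
    assume "cox_eq S m u v"
    then show "ccl u = ccl v" unfolding set_eq_iff in_ccl using cox_eq.sym cox_eq.trans by metis
  qed
  then show ?thesis using ev_eq_iff[OF assms] by simp
qed

lemma coxeter_elems_eq: "coxeter_elems S m = ccl ` {u. set u \<subseteq> S}"
  by (auto simp: coxeter_elems_def quotient_def ccl_def)

lemma cox_len_ccl:
  assumes "set u \<subseteq> S" shows "cox_len (ccl u) = len (ev u)"
proof -
  have "(\<exists>w\<in>ccl u. length w = n) \<longleftrightarrow> (\<exists>w. set w \<subseteq> S \<and> ev w = ev u \<and> length w = n)" for n
    using ev_eq_iff[OF assms] cox_eq_set in_ccl by metis
  then show ?thesis by (simp add: cox_len_def len_def)
qed

lemma longest_eq: "longest S m = ccl dw"
  unfolding longest_def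
proof (rule the_equality, intro conjI ballI)
  have dw: "ev dw = w0" using rw(2)[OF w0(1)] by (simp add: dw_def)
  show "ccl dw \<in> coxeter_elems S m" using dw_S by (simp add: coxeter_elems_eq)
  fix y assume "y \<in> coxeter_elems S m"
  then obtain u where "set u \<subseteq> S" "y = ccl u" by (auto simp: coxeter_elems_eq)
  then show "cox_len y \<le> cox_len (ccl dw)" using w0(2) dw dw_S by (simp add: cox_len_ccl)
next
  have dw: "ev dw = w0" using rw(2)[OF w0(1)] by (simp add: dw_def)
  fix x assume x: "x \<in> coxeter_elems S m \<and> (\<forall>y\<in>coxeter_elems S m. cox_len y \<le> cox_len x)"
  then obtain u where u: "set u \<subseteq> S" "x = ccl u" by (auto simp: coxeter_elems_eq)
  have "ccl dw \<in> coxeter_elems S m" using dw_S by (simp add: coxeter_elems_eq)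
  then have "len w0 \<le> len (ev u)" using x u dw dw_S by (metis cox_len_ccl)
  then have "ev u = w0" using w0_unique u by simp
  then show "x = ccl dw" using ccl_eq_iff[OF u(1) dw_S] dw u(2) by simp
qed

lemma to_cox_pw:
  assumes "set u \<subseteq> S" shows "to_cox S m (pw u) = ccl u"
proof (intro equalityI subsetI)
  fix v assume "v \<in> to_cox S m (pw u)"
  then obtain w where "art_eq S m (pos u) w" "cox_eq S m (map fst w) v"
    by (auto simp: to_cox_def pw_def in_acl cox_rel_def)
  then have "cox_eq S m u v" using art_eq_imp_cox_eq cox_eq.trans map_fst_pos by metis
  then show "v \<in> ccl u" by (simp add: in_ccl)
next
  fix v assume "v \<in> ccl u"
  moreover have "pos u \<in> pw u" using assms by (simp add: pw_def in_acl art_eq.refl set_pos)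
  then have "u \<in> map fst ` pw u" using map_fst_pos by force
  ultimately show "v \<in> to_cox S m (pw u)" by (auto simp: to_cox_def in_ccl cox_rel_def)
qed

lemma pos_len_pw:
  assumes "set u \<subseteq> S" shows "pos_len (pw u) = length u"
  unfolding pos_len_def
proof (rule Least_equality)
  have "pos u \<in> pw u" using assms by (simp add: pw_def in_acl art_eq.refl set_pos)
  then show "\<exists>w\<in>pw u. posword w \<and> length w = length u"
    using posword_pos by (intro bexI[of _ "pos u"]) (simp_all add: pos_def)
next
  fix n assume "\<exists>w\<in>pw u. posword w \<and> length w = n"
  then obtain w where w: "art_eq S m (pos u) w" "posword w" "length w = n" by (auto simp: pw_def in_acl)
  then have "wdeg w = int (length u)" using art_eq_wdeg[OF w(1)] by simp
  moreover have "wdeg w = int (length w)" using poswordD[OF w(2)] wdeg_pos length_map by metis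
  ultimately show "length u \<le> n" using w(3) by simp
qed

lemma atom_pw: "set u \<subseteq> S \<Longrightarrow> atom S m (pw u) \<longleftrightarrow> length u = len (ev u)"
  by (simp add: atom_def pw_P pos_len_pw to_cox_pw cox_len_ccl)

lemma dw: "ev dw = w0" "length dw = len w0"
  using rw(2,3)[OF w0(1)] by (simp_all add: dw_def)

lemma Delta_eq: "Delta S m = pw dw"
  unfolding Delta_def
proof (rule the_equality)
  show "atom S m (pw dw) \<and> to_cox S m (pw dw) = longest S m"
    using dw dw_S by (simp add: atom_pw to_cox_pw longest_eq)
next
  fix X assume X: "atom S m X \<and> to_cox S m X = longest S m"
  then obtain u where u: "set u \<subseteq> S" "X = pw u" by (auto simp: atom_def artin_pos_eq)
  then have "ev u = ev dw" using X ccl_eq_iff[OF u(1) dw_S] by (simp add: to_cox_pw longest_eq)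
  moreover have "length u = len (ev u)" using X u atom_pw by simp
  ultimately have "u \<approx> dw" using u dw dw_S by (intro matsumoto) simp_all
  then show "X = pw dw" using u pw_cong by simp
qed

abbreviation \<Delta> where "\<Delta> \<equiv> Delta S m"

text \<open>Every reduced word extends to one of the longest element. Conversely a word dividing
  \<Delta> must be reduced, as otherwise \<open>w0\<close> would have a shorter word. This
  identifies atoms with the interval that the chain argument produces.\<close>

lemma atom_iff: "atom S m X \<longleftrightarrow> X \<in> P \<and> inv\<^bsub>A\<^esub> X \<cdot> \<Delta> \<in> P"
proof (cases "X \<in> P")
  case False
  then show ?thesis by (simp add: atom_def)
next
  case True
  then obtain u where u: "set u \<subseteq> S" "X = pw u" by (auto simp: artin_pos_eq)
  have "length u = len (ev u) \<longleftrightarrow> pdvd u dw"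
  proof
    assume l: "length u = len (ev u)"
    have W: "ev u \<in> W" "- ev u + w0 \<in> W" using u w0 by simp_all
    have "rw (ev u + (- ev u + w0)) \<approx> rw (ev u) @ rw (- ev u + w0)"
      using wle_w0[OF W(1)] W by (intro rw_add) (simp_all add: wle_def)
    then have "dw \<approx> rw (ev u) @ rw (- ev u + w0)" by (simp add: dw_def)
    moreover have "rw (ev u) @ rw (- ev u + w0) \<approx> u @ rw (- ev u + w0)"
      using rw(1)[OF W(2)] by (intro braid_eq_append[OF rw_ev[OF u(1) l] braid_eq.refl])
    ultimately have "dw \<approx> u @ rw (- ev u + w0)" by (rule braid_eq.trans)
    then show "pdvd u dw" by (rule pdvdI)
  next
    assume "pdvd u dw"
    then obtain w where w: "set w \<subseteq> S" "dw \<approx> u @ w" by (rule pdvdE)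
    have "len w0 = length u + length w" using braid_eq_length[OF w(2)] dw by simp
    moreover have "w0 = ev u + ev w" using evI[OF braid_eq_imp_cox_eq[OF w(2)]] dw by simp
    then have "len w0 \<le> len (ev u) + len (ev w)" using len_add[OF W_ev[OF u(1)] W_ev[OF w(1)]] by simp
    ultimately show "length u = len (ev u)" using len_le[OF u(1)] len_le[OF w(1)] by simp
  qed
  then show ?thesis using True inv_pw_mult_P[OF u(1) dw_S] by (simp add: u atom_pw Delta_eq)
qed

lemma map_flip: "set u \<subseteq> S \<Longrightarrow> set (map flip u) \<subseteq> S \<and> u @ dw \<approx> dw @ map flip u \<and> map flip u @ dw \<approx> dw @ u"
proof (induction u)
  case Nil
  then show ?case using dw_S by (simp add: braid_eq.refl)
next
  case (Cons s u)
  have s: "s \<in> S" "set u \<subseteq> S" using Cons.prems by simp_all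
  note f = flip(1)[OF s(1)]
  have IH: "set (map flip u) \<subseteq> S" "u @ dw \<approx> dw @ map flip u" "map flip u @ dw \<approx> dw @ u"
    using Cons.IH[OF s(2)] by simp_all
  have "s # u @ dw \<approx> s # dw @ map flip u" by (rule braid_eq_Cons[OF s(1) IH(2)])
  moreover have "(s # dw) @ map flip u \<approx> (dw @ [flip s]) @ map flip u"
    by (rule braid_eq_append[OF flip(4)[OF s(1)] braid_eq.refl[OF IH(1)]])
  moreover have "flip s # map flip u @ dw \<approx> flip s # dw @ u" by (rule braid_eq_Cons[OF f IH(3)])
  moreover have "(flip s # dw) @ u \<approx> (dw @ [s]) @ u"
    by (rule braid_eq_append[OF dw_flip[OF s(1)] braid_eq.refl[OF s(2)]])
  ultimately show ?case using f IH(1)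
    by (simp add: braid_eq.trans[of S m "s # u @ dw" "s # dw @ map flip u"]
        braid_eq.trans[of S m "flip s # map flip u @ dw" "flip s # dw @ u"])
qed

sublocale gar: garside_group A P \<Delta> adeg
proof (intro garside_group.intro group_artin garside_group_axioms.intro)
  have DG: "\<Delta> \<in> carrier A" using pw_carrier dw_S by (simp add: Delta_eq)
  show "P \<subseteq> carrier A" by (auto simp: artin_pos_def)
  show "\<one>\<^bsub>A\<^esub> \<in> P" using pw_P[of "[]"] by (simp add: pw_one)
  show "\<Delta> \<in> P" using pw_P dw_S by (simp add: Delta_eq)
  show mult: "p \<cdot> q \<in> P" if "p \<in> P" "q \<in> P" for p q
  proof -
    from that(1) obtain u where "set u \<subseteq> S" "p = pw u" by (rule artin_posE)
    moreover from that(2) obtain v where "set v \<subseteq> S" "q = pw v" by (rule artin_posE)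
    ultimately show ?thesis using pw_P[of "u @ v"] by (simp add: pw_mult)
  qed
  show conj: "inv\<^bsub>A\<^esub> \<Delta> \<cdot> p \<cdot> \<Delta> \<in> P" if "p \<in> P" for p
  proof -
    from that obtain u where u: "set u \<subseteq> S" "p = pw u" by (rule artin_posE)
    note f = map_flip[OF u(1)]
    have fS: "set (map flip u) \<subseteq> S" using f by blast
    have "pw u \<cdot> \<Delta> = \<Delta> \<cdot> pw (map flip u)"
      unfolding Delta_eq pw_mult[OF u(1) dw_S] pw_mult[OF dw_S fS] using f pw_cong by blast
    then have "inv\<^bsub>A\<^esub> \<Delta> \<cdot> p \<cdot> \<Delta> = inv\<^bsub>A\<^esub> \<Delta> \<cdot> (\<Delta> \<cdot> pw (map flip u))"
      using DG pw_carrier[OF u(1)] by (simp add: u(2) A.m_assoc)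
    also have "\<dots> = pw (map flip u)" using DG pw_carrier[OF fS] by (simp flip: A.m_assoc)
    finally show ?thesis using pw_P[OF fS] by simp
  qed
  show "\<Delta> \<cdot> p \<cdot> inv\<^bsub>A\<^esub> \<Delta> \<in> P" if "p \<in> P" for p
  proof -
    from that obtain u where u: "set u \<subseteq> S" "p = pw u" by (rule artin_posE)
    note f = map_flip[OF u(1)]
    have fS: "set (map flip u) \<subseteq> S" using f by blast
    have "pw (map flip u) \<cdot> \<Delta> = \<Delta> \<cdot> pw u"
      unfolding Delta_eq pw_mult[OF fS dw_S] pw_mult[OF dw_S u(1)] using f pw_cong by blast
    then have "\<Delta> \<cdot> p \<cdot> inv\<^bsub>A\<^esub> \<Delta> = pw (map flip u) \<cdot> \<Delta> \<cdot> inv\<^bsub>A\<^esub> \<Delta>"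
      by (simp add: u(2))
    also have "\<dots> = pw (map flip u)" using DG pw_carrier[OF fS] by (simp add: A.m_assoc)
    finally show ?thesis using pw_P[OF fS] by simp
  qed
  show "adeg (g \<cdot> h) = adeg g + adeg h" if "g \<in> carrier A" "h \<in> carrier A" for g h
    using that by (auto simp: carrier_artin mult_acl adeg_acl)
  show "0 \<le> adeg p" if "p \<in> P" for p using that by (auto simp: artin_pos_eq adeg_pw)
  show "p = \<one>\<^bsub>A\<^esub>" if "p \<in> P" "adeg p = 0" for p using that by (auto simp: artin_pos_eq adeg_pw pw_one)
  show "\<exists>d\<in>P. inv\<^bsub>A\<^esub> d \<cdot> x \<in> P \<and> inv\<^bsub>A\<^esub> d \<cdot> y \<in> P \<and>
        (\<forall>e\<in>P. inv\<^bsub>A\<^esub> e \<cdot> x \<in> P \<and> inv\<^bsub>A\<^esub> e \<cdot> y \<in> P \<longrightarrow> inv\<^bsub>A\<^esub> e \<cdot> d \<in> P)"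
    if "x \<in> P" "y \<in> P" for x y
  proof -
    from that(1) obtain u where u: "set u \<subseteq> S" "x = pw u" by (rule artin_posE)
    from that(2) obtain v where v: "set v \<subseteq> S" "y = pw v" by (rule artin_posE)
    note uv = u(1) v(1) u(2) v(2)
    obtain d where d: "pdvd d u" "pdvd d v" "\<And>e. pdvd e u \<Longrightarrow> pdvd e v \<Longrightarrow> pdvd e d"
      using ex_pgcd[OF uv(1,2)] by metis
    have dS: "set d \<subseteq> S" using d(1) by (simp add: pdvd_def)
    have "inv\<^bsub>A\<^esub> e \<cdot> pw d \<in> P"
      if e: "e \<in> P" "inv\<^bsub>A\<^esub> e \<cdot> x \<in> P" "inv\<^bsub>A\<^esub> e \<cdot> y \<in> P" for e
    proof -
      obtain w where w: "set w \<subseteq> S" "e = pw w" using e(1) by (rule artin_posE)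
      then show ?thesis using e d(3)[of w] uv dS by (simp add: inv_pw_mult_P)
    qed
    then show ?thesis using d uv dS by (intro bexI[of _ "pw d"]) (simp_all add: inv_pw_mult_P pw_P)
  qed
  show "\<exists>k::nat. g \<cdot> \<Delta> [^]\<^bsub>A\<^esub> k \<in> P" if "g \<in> carrier A" for g
  proof -
    have "\<exists>k::nat. acl S m w \<cdot> \<Delta> [^]\<^bsub>A\<^esub> k \<in> P" if "set w \<subseteq> S \<times> UNIV" for w
      using that
    proof (induction w)
      case Nil
      then show ?case using pw_P[of "[]"] by (intro exI[of _ "0::nat"]) (simp add: pw_one one_artin[symmetric])
    next
      case (Cons l w)
      obtain s b where l: "l = (s, b)" by (cases l)
      have s: "s \<in> S" "set w \<subseteq> S \<times> UNIV" using Cons.prems l by auto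
      obtain k :: nat where k: "acl S m w \<cdot> \<Delta> [^]\<^bsub>A\<^esub> k \<in> P" using Cons.IH[OF s(2)] by blast
      have wc: "acl S m w \<in> carrier A" using s(2) by (auto simp: carrier_artin)
      define p where "p = acl S m w \<cdot> \<Delta> [^]\<^bsub>A\<^esub> k"
      have pc: "p \<in> carrier A" using wc DG by (simp add: p_def)
      have "set [l] \<subseteq> S \<times> UNIV" using s(1) l by simp
      from mult_acl[OF this s(2), of m] have lw: "acl S m (l # w) = acl S m [l] \<cdot> acl S m w" by simp
      have lc: "acl S m [l] \<in> carrier A" using s(1) l by (auto simp: carrier_artin)
      have lp: "acl S m (l # w) \<cdot> \<Delta> [^]\<^bsub>A\<^esub> k = acl S m [l] \<cdot> p"
        using lc wc DG by (simp add: lw p_def A.m_assoc)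
      show ?case
      proof (cases b)
        case True
        then have "acl S m [l] = pw [s]" by (simp add: l pw_def)
        then have "acl S m [l] \<cdot> p \<in> P" using mult[OF pw_P[of "[s]"]] k s(1) by (simp add: p_def)
        then show ?thesis using lp by (intro exI[of _ k]) simp
      next
        case False
        have ss: "set (star s) \<subseteq> S" "set [s] \<subseteq> S" using star(1)[OF s(1)] s(1) by simp_all
        have sc: "pw [s] \<in> carrier A" "pw (star s) \<in> carrier A" using pw_carrier ss by blast+
        have "acl S m [l] \<cdot> pw [s] = acl S m ([l] @ pos [s])"
          unfolding pw_def using s(1) l by (intro mult_acl) simp_all
        also have "\<dots> = acl S m []"
          using art_eq.free[of s S "[]" "[]" m False] s(1) l False by (subst acl_eq_iff) simp_all
        finally have l1: "acl S m [l] \<cdot> pw [s] = \<one>\<^bsub>A\<^esub>" by (simp add: one_artin)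
        have "pw [s] \<cdot> pw (star s) = \<Delta> \<cdot> \<Delta>"
          unfolding Delta_eq pw_mult[OF ss(2,1)] pw_mult[OF dw_S dw_S]
          using star(2)[OF s(1)] pw_cong by simp
        then have "acl S m [l] \<cdot> (\<Delta> \<cdot> \<Delta>) = acl S m [l] \<cdot> pw [s] \<cdot> pw (star s)"
          using lc sc by (simp add: A.m_assoc)
        then have l2: "acl S m [l] \<cdot> (\<Delta> \<cdot> \<Delta>) = pw (star s)" using l1 sc by simp
        \<comment> \<open>Two more factors \<Delta> absorb the inverse letter, but they must first
          move past \<open>p\<close>. Centrality of \<Delta>^2 is available only for positive words
          here, so \<open>p\<close> is replaced by its conjugate \<open>q\<close>, still
          positive.\<close>
        define q where "q = inv\<^bsub>A\<^esub> \<Delta> \<cdot> (inv\<^bsub>A\<^esub> \<Delta> \<cdot> p \<cdot> \<Delta>) \<cdot> \<Delta>"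
        have q: "q \<in> P" unfolding q_def using conj k by (simp add: p_def)
        have pq: "p \<cdot> (\<Delta> \<cdot> \<Delta>) = \<Delta> \<cdot> \<Delta> \<cdot> q"
        proof -
          have c: "\<Delta> \<cdot> (inv\<^bsub>A\<^esub> \<Delta> \<cdot> y) = y" if "y \<in> carrier A" for y
            using that DG by (simp flip: A.m_assoc)
          show ?thesis using DG pc c by (simp add: q_def A.m_assoc)
        qed
        have "acl S m (l # w) \<cdot> \<Delta> [^]\<^bsub>A\<^esub> (k + 2) = acl S m [l] \<cdot> (p \<cdot> (\<Delta> \<cdot> \<Delta>))"
          using lc wc DG by (simp add: lw p_def A.m_assoc)
        also have "\<dots> = pw (star s) \<cdot> q"
          unfolding pq l2[symmetric] using lc DG q by (simp add: A.m_assoc artin_pos_def)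
        finally show ?thesis using mult[OF pw_P[OF ss(1)] q] by metis
      qed
    qed
    then show ?thesis using that by (auto simp: carrier_artin)
  qed
qed

end

section \<open>The quotient by the central element and its action\<close>

context finite_coxeter_group
begin

text \<open>A power of \<Delta> makes \<open>g\<close> positive, where centrality is known from
  words; that power commutes with \<Delta>^2 and cancels.\<close>

lemma Delta_sq_central:
  assumes g: "g \<in> carrier A"
  shows "g \<cdot> (\<Delta> \<cdot> \<Delta>) = \<Delta> \<cdot> \<Delta> \<cdot> g"
proof -
  obtain k :: nat where "g \<cdot> \<Delta> [^]\<^bsub>A\<^esub> k \<in> P" using gar.absorb[OF g] by blast
  then obtain u where u: "set u \<subseteq> S" "g \<cdot> \<Delta> [^]\<^bsub>A\<^esub> k = pw u" by (rule artin_posE)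
  have dd: "set (dw @ dw) \<subseteq> S" using dw_S by simp
  have Z: "\<Delta> \<cdot> \<Delta> = pw (dw @ dw)" unfolding Delta_eq by (rule pw_mult[OF dw_S dw_S])
  have "pw u \<cdot> pw (dw @ dw) = pw (dw @ dw) \<cdot> pw u"
    unfolding pw_mult[OF u(1) dd] pw_mult[OF dd u(1)]
    using pw_cong[OF dw_dw_central[OF u(1)]] by simp
  then have "g \<cdot> \<Delta> [^]\<^bsub>A\<^esub> k \<cdot> (\<Delta> \<cdot> \<Delta>) = \<Delta> \<cdot> \<Delta> \<cdot> (g \<cdot> \<Delta> [^]\<^bsub>A\<^esub> k)"
    unfolding u(2) Z .
  moreover have "\<Delta> [^]\<^bsub>A\<^esub> k \<cdot> (\<Delta> \<cdot> \<Delta>) = \<Delta> \<cdot> \<Delta> \<cdot> \<Delta> [^]\<^bsub>A\<^esub> k"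
  proof -
    have e: "\<Delta> [^]\<^bsub>A\<^esub> k \<cdot> \<Delta> = \<Delta> \<cdot> \<Delta> [^]\<^bsub>A\<^esub> k"
      using gar.nat_pow_Suc2[OF gar.D_carrier, of k] unfolding gar.nat_pow_Suc .
    have "\<Delta> [^]\<^bsub>A\<^esub> k \<cdot> (\<Delta> \<cdot> \<Delta>) = \<Delta> [^]\<^bsub>A\<^esub> k \<cdot> \<Delta> \<cdot> \<Delta>" by (simp add: gar.m_assoc)
    also have "\<dots> = \<Delta> \<cdot> (\<Delta> [^]\<^bsub>A\<^esub> k \<cdot> \<Delta>)" by (simp add: e gar.m_assoc)
    also have "\<dots> = \<Delta> \<cdot> \<Delta> \<cdot> \<Delta> [^]\<^bsub>A\<^esub> k" by (simp add: e gar.m_assoc)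
    finally show ?thesis .
  qed
  ultimately have "g \<cdot> (\<Delta> \<cdot> \<Delta>) \<cdot> \<Delta> [^]\<^bsub>A\<^esub> k = \<Delta> \<cdot> \<Delta> \<cdot> g \<cdot> \<Delta> [^]\<^bsub>A\<^esub> k"
    using g by (simp add: gar.m_assoc)
  then show ?thesis using g by simp
qed

lemma Delta_even_central:
  assumes g: "g \<in> carrier A"
  shows "g \<cdot> \<Delta> [^]\<^bsub>A\<^esub> (2 * k :: int) = \<Delta> [^]\<^bsub>A\<^esub> (2 * k) \<cdot> g"
proof -
  define z where "z = \<Delta> \<cdot> \<Delta>"
  have z: "z \<in> carrier A" "g \<cdot> z = z \<cdot> g" using Delta_sq_central[OF g] by (simp_all add: z_def)
  have zi: "g \<cdot> inv\<^bsub>A\<^esub> z = inv\<^bsub>A\<^esub> z \<cdot> g"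
  proof -
    have "z \<cdot> (g \<cdot> inv\<^bsub>A\<^esub> z) = g" using g z(1) by (simp add: z(2)[symmetric] gar.m_assoc[symmetric]) (simp add: gar.m_assoc)
    then have "inv\<^bsub>A\<^esub> z \<cdot> (z \<cdot> (g \<cdot> inv\<^bsub>A\<^esub> z)) = inv\<^bsub>A\<^esub> z \<cdot> g" by simp
    then show ?thesis using g z(1) by simp
  qed
  have "g \<cdot> z [^]\<^bsub>A\<^esub> k = z [^]\<^bsub>A\<^esub> k \<cdot> g"
  proof (induction k rule: int_induct[where k = 0])
    case (step1 i)
    have e: "z [^]\<^bsub>A\<^esub> (i + 1) = z [^]\<^bsub>A\<^esub> i \<cdot> z" using z(1) by (simp add: gar.int_pow_mult)
    have "g \<cdot> (z [^]\<^bsub>A\<^esub> i \<cdot> z) = z [^]\<^bsub>A\<^esub> i \<cdot> g \<cdot> z"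
      using step1(2) g z(1) by (simp flip: gar.m_assoc)
    then show ?case unfolding e using g z by (simp add: gar.m_assoc)
  next
    case (step2 i)
    have e: "z [^]\<^bsub>A\<^esub> (i - 1) = z [^]\<^bsub>A\<^esub> i \<cdot> inv\<^bsub>A\<^esub> z" using z(1) by (simp add: gar.int_pow_diff)
    have "g \<cdot> (z [^]\<^bsub>A\<^esub> i \<cdot> inv\<^bsub>A\<^esub> z) = z [^]\<^bsub>A\<^esub> i \<cdot> g \<cdot> inv\<^bsub>A\<^esub> z"
      using step2(2) g z(1) by (simp flip: gar.m_assoc)
    then show ?case unfolding e using g z(1) zi by (simp add: gar.m_assoc)
  qed (use g in simp)
  moreover have "z = \<Delta> [^]\<^bsub>A\<^esub> (2::int)" using gar.int_pow_mult[of \<Delta> 1 1] by (simp add: z_def)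
  ultimately show ?thesis by (simp add: gar.int_pow_pow)
qed

subsection \<open>Normal forms and special representatives\<close>

lemma pleq_iff:
  "x \<in> carrier A \<Longrightarrow> y \<in> carrier A \<Longrightarrow> pleq S m x y \<longleftrightarrow> inv\<^bsub>A\<^esub> x \<cdot> y \<in> P"
  unfolding pleq_def by (metis gar.PG gar.inv_mult_cancel)

lemma pleq_antisym:
  assumes "x \<in> carrier A" "y \<in> carrier A" "pleq S m x y" "pleq S m y x"
  shows "x = y"
proof -
  obtain p where p: "p \<in> P" "y = x \<cdot> p" using assms(3) by (auto simp: pleq_def)
  obtain q where q: "q \<in> P" "x = y \<cdot> q" using assms(4) by (auto simp: pleq_def)
  have "adeg y = adeg x + adeg p" using gar.deg_mult[OF assms(1) gar.PG[OF p(1)]] p(2) by simp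
  moreover have "adeg x = adeg y + adeg q" using gar.deg_mult[OF assms(2) gar.PG[OF q(1)]] q(2) by simp
  ultimately have "adeg p = 0" using gar.deg_nonneg[OF p(1)] gar.deg_nonneg[OF q(1)] by simp
  then have "p = \<one>\<^bsub>A\<^esub>" using gar.deg_zero p(1) by blast
  then show ?thesis using p(2) assms(1) by simp
qed

lemma atom_P: "atom S m a \<Longrightarrow> a \<in> P"
  by (simp add: atom_def)

lemma atom_carrier: "atom S m a \<Longrightarrow> a \<in> carrier A"
  using atom_P gar.PG by blast

lemma atom_Delta: "atom S m \<Delta>"
  unfolding atom_iff by (simp add: gar.D_P gar.one_P)

lemma alpha_eqI:
  assumes "atom S m a" "pleq S m a g" "\<And>b. atom S m b \<Longrightarrow> pleq S m b g \<Longrightarrow> pleq S m b a"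
  shows "alpha S m g = a"
  unfolding alpha_def
proof (rule the_equality)
  fix b assume "atom S m b \<and> pleq S m b g \<and> (\<forall>c. atom S m c \<and> pleq S m c g \<longrightarrow> pleq S m c b)"
  then show "b = a" using assms by (intro pleq_antisym) (auto intro: atom_carrier)
qed (use assms in blast)

lemma alpha_atom:
  assumes "atom S m a" shows "alpha S m a = a"
proof (rule alpha_eqI[OF assms])
  show "pleq S m a a" using atom_carrier[OF assms] by (simp add: pleq_iff gar.one_P)
qed

lemma alpha_Delta:
  assumes "p \<in> P" shows "alpha S m (\<Delta> \<cdot> p) = \<Delta>"
proof (rule alpha_eqI[OF atom_Delta])
  show "pleq S m \<Delta> (\<Delta> \<cdot> p)" using assms by (auto simp: pleq_def)
  fix b assume "atom S m b"
  then show "pleq S m b \<Delta>" using atom_carrier by (simp add: pleq_iff atom_iff)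
qed

definition is_nf :: "'a artin_elt list \<Rightarrow> bool" where
  "is_nf L \<longleftrightarrow> (\<forall>a\<in>set L. atom S m a \<and> a \<noteq> \<one>\<^bsub>A\<^esub>) \<and>
    (\<forall>i<length L. L ! i = alpha S m (aprod S m (drop i L)))"

lemma aprod_simps [simp]: "aprod S m [] = \<one>\<^bsub>A\<^esub>" "aprod S m (a # L) = a \<cdot> aprod S m L"
  by (simp_all add: aprod_def)

lemma is_nf_Nil [simp]: "is_nf []"
  by (simp add: is_nf_def)

lemma is_nf_Cons [simp]:
  "is_nf (a # L) \<longleftrightarrow> atom S m a \<and> a \<noteq> \<one>\<^bsub>A\<^esub> \<and> alpha S m (a \<cdot> aprod S m L) = a \<and> is_nf L"
  unfolding is_nf_def by (auto simp: All_less_Suc2)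

lemma is_nf_aprod: "is_nf L \<Longrightarrow> aprod S m L \<in> P"
  by (induction L) (simp_all add: gar.one_P gar.mult_P atom_P)

lemma is_nf_unique: "is_nf L \<Longrightarrow> is_nf L' \<Longrightarrow> aprod S m L = aprod S m L' \<Longrightarrow> L = L'"
proof (induction L arbitrary: L')
  have ne: "aprod S m (a # K) \<noteq> \<one>\<^bsub>A\<^esub>" if nf: "is_nf (a # K)" for a K
  proof
    have a: "a \<in> P" "a \<noteq> \<one>\<^bsub>A\<^esub>" and K: "aprod S m K \<in> P" using nf is_nf_aprod atom_P by simp_all
    assume "aprod S m (a # K) = \<one>\<^bsub>A\<^esub>"
    then have "adeg (a \<cdot> aprod S m K) = 0" using gar.deg_one by simp
    then have "adeg a + adeg (aprod S m K) = 0"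
      using gar.deg_mult[OF gar.PG[OF a(1)] gar.PG[OF K]] by simp
    then have "adeg a = 0" using gar.deg_nonneg[OF a(1)] gar.deg_nonneg[OF K] by linarith
    then show False using gar.deg_zero a by blast
  qed
  {
    case Nil
    then show ?case using ne by (cases L') auto
  next
    case (Cons a L)
    then obtain b K where L': "L' = b # K" using ne[of a L] by (cases L') auto
    have nf: "is_nf (a # L)" "is_nf (b # K)" using Cons.prems L' by simp_all
    have eq: "a \<cdot> aprod S m L = b \<cdot> aprod S m K" using Cons.prems(3) L' by simp
    have ab: "a = b"
    proof -
      have "a = alpha S m (a \<cdot> aprod S m L)" "alpha S m (b \<cdot> aprod S m K) = b"
        using nf by simp_all
      then show ?thesis unfolding eq by simp
    qed
    have c: "a \<in> carrier A" "aprod S m L \<in> carrier A" "aprod S m K \<in> carrier A"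
      using nf atom_carrier is_nf_aprod gar.PG by simp_all
    have "aprod S m L = aprod S m K" using eq c unfolding ab[symmetric] by simp
    then show ?case using Cons.IH[of K] nf ab L' by simp
  }
qed

lemma normal_form_eq: "is_nf L \<Longrightarrow> normal_form S m (aprod S m L) = L"
  unfolding normal_form_def
proof (rule the_equality)
  fix K assume nf: "is_nf L"
  assume "(\<forall>a\<in>set K. atom S m a \<and> a \<noteq> \<one>\<^bsub>A\<^esub>) \<and> aprod S m K = aprod S m L \<and>
    (\<forall>i<length K. K ! i = alpha S m (aprod S m (drop i K)))"
  then show "K = L" using is_nf_unique[of K L] nf by (auto simp: is_nf_def)
qed (auto simp: is_nf_def)

text \<open>For a nontrivial atom other than \<Delta>, the positive elements of its vertex all have
  this shape, so these normal forms decide its special representative.\<close>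

lemma normal_form_Delta_pow:
  assumes a: "atom S m a" "a \<noteq> \<one>\<^bsub>A\<^esub>"
  shows "normal_form S m (\<Delta> [^]\<^bsub>A\<^esub> (k::nat) \<cdot> a) = replicate k \<Delta> @ [a]"
proof -
  have ac: "a \<in> carrier A" using atom_carrier a by simp
  have D1: "\<Delta> \<noteq> \<one>\<^bsub>A\<^esub>"
  proof
    assume "\<Delta> = \<one>\<^bsub>A\<^esub>"
    then have "inv\<^bsub>A\<^esub> a \<in> P" using a(1) ac by (simp add: atom_iff)
    then have "adeg a = 0"
      using gar.deg_nonneg[of "inv\<^bsub>A\<^esub> a"] gar.deg_nonneg[OF atom_P[OF a(1)]] gar.deg_inv[OF ac] by simp
    then show False using gar.deg_zero atom_P a by blast
  qed
  have "is_nf (replicate k \<Delta> @ [a]) \<and> aprod S m (replicate k \<Delta> @ [a]) = \<Delta> [^]\<^bsub>A\<^esub> k \<cdot> a"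
  proof (induction k)
    case 0
    then show ?case using a ac by (simp add: alpha_atom)
  next
    case (Suc k)
    define L where "L = replicate k \<Delta> @ [a]"
    have L: "is_nf L" "aprod S m L = \<Delta> [^]\<^bsub>A\<^esub> k \<cdot> a" using Suc by (simp_all add: L_def)
    have "is_nf (\<Delta> # L)" using L(1) D1 atom_Delta alpha_Delta[OF is_nf_aprod[OF L(1)]] by simp
    moreover have "aprod S m (\<Delta> # L) = \<Delta> [^]\<^bsub>A\<^esub> Suc k \<cdot> a"
      using ac gar.nat_pow_Suc2[of \<Delta> k] by (simp add: L(2) gar.m_assoc)
    ultimately show ?case by (simp add: L_def)
  qed
  then show ?thesis using normal_form_eq by metis
qed

section \<open>Vertices and adjacency\<close>

lemma DeltaGrp_eq: "DeltaGrp S m = {\<Delta> [^]\<^bsub>A\<^esub> (k::int) | k. True}"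
  using gar.generate_pow[of \<Delta>] by (simp add: DeltaGrp_def)

lemma DeltaGrp_carrier: "DeltaGrp S m \<subseteq> carrier A"
  by (auto simp: DeltaGrp_eq)

lemma in_vertex: "y \<in> g <#\<^bsub>A\<^esub> DeltaGrp S m \<longleftrightarrow> (\<exists>k::int. y = g \<cdot> \<Delta> [^]\<^bsub>A\<^esub> k)"
  by (auto simp: l_coset_def DeltaGrp_eq)

lemma vertex_shift:
  assumes g: "g \<in> carrier A"
  shows "(g \<cdot> \<Delta> [^]\<^bsub>A\<^esub> (k::int)) <#\<^bsub>A\<^esub> DeltaGrp S m = g <#\<^bsub>A\<^esub> DeltaGrp S m"
proof (intro equalityI subsetI)
  fix y assume "y \<in> (g \<cdot> \<Delta> [^]\<^bsub>A\<^esub> k) <#\<^bsub>A\<^esub> DeltaGrp S m"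
  then obtain j :: int where "y = g \<cdot> \<Delta> [^]\<^bsub>A\<^esub> k \<cdot> \<Delta> [^]\<^bsub>A\<^esub> j" by (auto simp: in_vertex)
  then have "y = g \<cdot> \<Delta> [^]\<^bsub>A\<^esub> (k + j)" using g by (simp add: gar.D_pow_cancel)
  then show "y \<in> g <#\<^bsub>A\<^esub> DeltaGrp S m" unfolding in_vertex by blast
next
  fix y assume "y \<in> g <#\<^bsub>A\<^esub> DeltaGrp S m"
  then obtain j :: int where "y = g \<cdot> \<Delta> [^]\<^bsub>A\<^esub> j" by (auto simp: in_vertex)
  then have "y = g \<cdot> \<Delta> [^]\<^bsub>A\<^esub> k \<cdot> \<Delta> [^]\<^bsub>A\<^esub> (j - k)" using g by (simp add: gar.D_pow_cancel)
  then show "y \<in> (g \<cdot> \<Delta> [^]\<^bsub>A\<^esub> k) <#\<^bsub>A\<^esub> DeltaGrp S m" unfolding in_vertex by blast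
qed

lemma vertex_mult:
  "h \<in> carrier A \<Longrightarrow> g \<in> carrier A \<Longrightarrow>
    h <#\<^bsub>A\<^esub> (g <#\<^bsub>A\<^esub> DeltaGrp S m) = (h \<cdot> g) <#\<^bsub>A\<^esub> DeltaGrp S m"
  by (rule gar.lcos_m_assoc[OF DeltaGrp_carrier])

lemma atom_conj:
  assumes a: "atom S m a" shows "atom S m (\<Delta> [^]\<^bsub>A\<^esub> (- k) \<cdot> a \<cdot> \<Delta> [^]\<^bsub>A\<^esub> (k::int))"
proof -
  have ac: "a \<in> carrier A" using atom_carrier a .
  have conj: "\<Delta> [^]\<^bsub>A\<^esub> (- k) \<cdot> p \<cdot> \<Delta> [^]\<^bsub>A\<^esub> k \<in> P" if p: "p \<in> P" for p
  proof -
    have "gar.gle \<one>\<^bsub>A\<^esub> p" using p by (simp add: gar.P_iff_gle)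
    then have "gar.gle (\<one>\<^bsub>A\<^esub> \<cdot> \<Delta> [^]\<^bsub>A\<^esub> k) (p \<cdot> \<Delta> [^]\<^bsub>A\<^esub> k)" by (rule gar.gle_mult_D_pow)
    then show ?thesis using p by (simp add: gar.gle_def gar.int_pow_neg gar.m_assoc)
  qed
  define b where "b = \<Delta> [^]\<^bsub>A\<^esub> (- k) \<cdot> a \<cdot> \<Delta> [^]\<^bsub>A\<^esub> k"
  have com: "\<Delta> \<cdot> \<Delta> [^]\<^bsub>A\<^esub> k = \<Delta> [^]\<^bsub>A\<^esub> k \<cdot> \<Delta>"
    using gar.int_pow_mult[of \<Delta> 1 k] gar.int_pow_mult[of \<Delta> k 1] by (simp add: add.commute)
  have "inv\<^bsub>A\<^esub> b \<cdot> \<Delta> = \<Delta> [^]\<^bsub>A\<^esub> (- k) \<cdot> inv\<^bsub>A\<^esub> a \<cdot> (\<Delta> [^]\<^bsub>A\<^esub> k \<cdot> \<Delta>)"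
    unfolding b_def using ac by (simp add: gar.inv_mult_group gar.int_pow_neg gar.m_assoc)
  also have "\<dots> = \<Delta> [^]\<^bsub>A\<^esub> (- k) \<cdot> (inv\<^bsub>A\<^esub> a \<cdot> \<Delta>) \<cdot> \<Delta> [^]\<^bsub>A\<^esub> k"
    unfolding com[symmetric] using ac by (simp add: gar.m_assoc)
  finally have "inv\<^bsub>A\<^esub> b \<cdot> \<Delta> \<in> P" using conj a by (simp add: atom_iff)
  moreover have "b \<in> P" unfolding b_def using conj atom_P[OF a] by simp
  ultimately show ?thesis using atom_iff unfolding b_def by blast
qed

text \<open>The competing representatives are \<open>a\<close> times a power of \<Delta>. A negative
  power is positive only if \<Delta> divides \<open>a\<close>, which forces
  \<open>a = \<Delta>\<close>; a positive power, moved to the left, puts \<Delta> into the normal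
  form.\<close>

lemma vlen_atom:
  assumes a: "atom S m a" "a \<noteq> \<one>\<^bsub>A\<^esub>" "a \<noteq> \<Delta>"
  shows "vlen S m (a <#\<^bsub>A\<^esub> DeltaGrp S m) = 1"
proof -
  have ac: "a \<in> carrier A" using atom_carrier a by simp
  have nf: "normal_form S m a = [a]" using normal_form_Delta_pow[OF a(1,2), of 0] ac by simp
  have "special_rep S m (a <#\<^bsub>A\<^esub> DeltaGrp S m) = a"
    unfolding special_rep_def
  proof (rule the_equality)
    have "a \<in> a <#\<^bsub>A\<^esub> DeltaGrp S m" unfolding in_vertex using ac by (intro exI[of _ "0::int"]) simp
    then show "a \<in> P \<and> a \<in> a <#\<^bsub>A\<^esub> DeltaGrp S m \<and> \<Delta> \<notin> set (normal_form S m a)"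
      using nf a atom_P by auto
  next
    fix p assume p: "p \<in> P \<and> p \<in> a <#\<^bsub>A\<^esub> DeltaGrp S m \<and> \<Delta> \<notin> set (normal_form S m p)"
    then obtain j :: int where j: "p = a \<cdot> \<Delta> [^]\<^bsub>A\<^esub> j" by (auto simp: in_vertex)
    consider "j = 0" | "j < 0" | "0 < j" by linarith
    then show "p = a"
    proof cases
      case 1
      then show ?thesis using j ac by simp
    next
      case 2
      have "gar.gle \<one>\<^bsub>A\<^esub> (a \<cdot> \<Delta> [^]\<^bsub>A\<^esub> j)" using p j by (simp add: gar.P_iff_gle)
      also have "gar.gle (a \<cdot> \<Delta> [^]\<^bsub>A\<^esub> j) (a \<cdot> \<Delta> [^]\<^bsub>A\<^esub> (-1::int))"
        using 2 ac by (intro gar.gle_D_pow) simp_all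
      finally (gar.gle_trans) have "gar.gle (\<one>\<^bsub>A\<^esub> \<cdot> \<Delta> [^]\<^bsub>A\<^esub> (1::int)) (a \<cdot> \<Delta> [^]\<^bsub>A\<^esub> (-1::int) \<cdot> \<Delta> [^]\<^bsub>A\<^esub> (1::int))"
        by (rule gar.gle_mult_D_pow)
      then have "gar.gle \<Delta> a" using gar.D_pow_cancel[OF ac, of "-1" 1] ac by simp
      then have "pleq S m \<Delta> a" using ac by (simp add: pleq_iff gar.gle_def)
      moreover have "pleq S m a \<Delta>" using a(1) ac by (simp add: pleq_iff atom_iff)
      ultimately show ?thesis using pleq_antisym ac a(3) by simp
    next
      case 3
      then obtain n where n: "j = int (Suc n)" by (metis pos_int_cases gr0_implies_Suc)
      define b where "b = \<Delta> [^]\<^bsub>A\<^esub> (- j) \<cdot> a \<cdot> \<Delta> [^]\<^bsub>A\<^esub> j"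
      have b: "atom S m b" unfolding b_def by (rule atom_conj[OF a(1)])
      have pb: "p = \<Delta> [^]\<^bsub>A\<^esub> Suc n \<cdot> b"
      proof -
        have "\<Delta> [^]\<^bsub>A\<^esub> j \<cdot> b = a \<cdot> \<Delta> [^]\<^bsub>A\<^esub> j"
          unfolding b_def using ac by (simp add: gar.int_pow_neg gar.m_assoc)
        then show ?thesis unfolding j n int_pow_int by simp
      qed
      have "b \<noteq> \<one>\<^bsub>A\<^esub>"
      proof
        assume "b = \<one>\<^bsub>A\<^esub>"
        then have "a \<cdot> \<Delta> [^]\<^bsub>A\<^esub> j = \<Delta> [^]\<^bsub>A\<^esub> j"
          using pb unfolding j n int_pow_int by simp
        then show False using ac a(2) by (simp add: gar.l_cancel_one)
      qed
      then have "normal_form S m p = replicate (Suc n) \<Delta> @ [b]"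
        unfolding pb by (rule normal_form_Delta_pow[OF b])
      then show ?thesis using p by simp
    qed
  qed
  then show ?thesis by (simp add: vlen_def nf)
qed

text \<open>The representative chosen in \<open>d_at\<close> may differ from \<open>g\<close> by a
  power of \<Delta>. The difference only replaces \<open>a\<close> by a conjugate atom
  \<open>b\<close>, and \<open>v \<noteq> w\<close> excludes that \<open>b\<close> is trivial or
  \<Delta>.\<close>

lemma d_at_eq_1:
  assumes g: "g \<in> carrier A" and a: "atom S m a" and v: "v = g <#\<^bsub>A\<^esub> DeltaGrp S m"
    and w: "w = (g \<cdot> a) <#\<^bsub>A\<^esub> DeltaGrp S m" and vw: "v \<noteq> w"
  shows "d_at S m v w = 1"
proof -
  have ac: "a \<in> carrier A" using atom_carrier a .
  define g' where "g' = (SOME g. g \<in> carrier A \<and> g <#\<^bsub>A\<^esub> DeltaGrp S m = v)"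
  have g': "g' \<in> carrier A \<and> g' <#\<^bsub>A\<^esub> DeltaGrp S m = v"
    unfolding g'_def by (rule someI[of _ g]) (use g v in simp)
  have "g' \<in> g' <#\<^bsub>A\<^esub> DeltaGrp S m" unfolding in_vertex using g' by (intro exI[of _ "0::int"]) simp
  then have "g' \<in> g <#\<^bsub>A\<^esub> DeltaGrp S m" using g' v by simp
  then obtain i :: int where i: "g' = g \<cdot> \<Delta> [^]\<^bsub>A\<^esub> i" by (auto simp: in_vertex)
  define b where "b = \<Delta> [^]\<^bsub>A\<^esub> (- i) \<cdot> a \<cdot> \<Delta> [^]\<^bsub>A\<^esub> i"
  have b: "atom S m b" unfolding b_def by (rule atom_conj[OF a])
  have bc: "b \<in> carrier A" using atom_carrier b .
  have "inv\<^bsub>A\<^esub> g' <#\<^bsub>A\<^esub> w = (inv\<^bsub>A\<^esub> g' \<cdot> (g \<cdot> a)) <#\<^bsub>A\<^esub> DeltaGrp S m"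
    unfolding w using g ac g' by (intro vertex_mult) simp_all
  also have "inv\<^bsub>A\<^esub> g' \<cdot> (g \<cdot> a) = \<Delta> [^]\<^bsub>A\<^esub> (- i) \<cdot> a"
    unfolding i using g ac by (simp add: gar.inv_mult_group gar.int_pow_neg gar.m_assoc)
  also have "(\<Delta> [^]\<^bsub>A\<^esub> (- i) \<cdot> a) <#\<^bsub>A\<^esub> DeltaGrp S m = b <#\<^bsub>A\<^esub> DeltaGrp S m"
    unfolding b_def using ac by (simp add: vertex_shift)
  finally have eq: "inv\<^bsub>A\<^esub> g' <#\<^bsub>A\<^esub> w = b <#\<^bsub>A\<^esub> DeltaGrp S m" .
  have gb: "(g' \<cdot> b) <#\<^bsub>A\<^esub> DeltaGrp S m = w"
  proof -
    have "g' \<cdot> b = g \<cdot> a \<cdot> \<Delta> [^]\<^bsub>A\<^esub> i"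
      unfolding i b_def using g ac by (simp add: gar.int_pow_neg gar.m_assoc)
    then show ?thesis using g ac w by (simp add: vertex_shift)
  qed
  have "b \<noteq> \<one>\<^bsub>A\<^esub>"
  proof
    assume "b = \<one>\<^bsub>A\<^esub>"
    then show False using gb g' vw by simp
  qed
  moreover have "b \<noteq> \<Delta>"
  proof
    assume "b = \<Delta>"
    then have "(g' \<cdot> \<Delta> [^]\<^bsub>A\<^esub> (1::int)) <#\<^bsub>A\<^esub> DeltaGrp S m = w" using gb by simp
    then show False using vertex_shift[of g' 1] g' vw by simp
  qed
  ultimately show ?thesis
    unfolding d_at_def g'_def[symmetric] Let_def eq using vlen_atom b by simp
qed

end

section \<open>Finite subgroups of the quotient\<close>

lemma (in group) subgroup_conj_class_conj:
  assumes H: "H \<subseteq> carrier G" and k: "k \<in> carrier G"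
  shows "subgroup_conj_class G ((\<lambda>h. k \<otimes> h \<otimes> inv k) ` H) = subgroup_conj_class G H"
proof -
  have *: "(\<lambda>h. g \<otimes> h \<otimes> inv g) ` (\<lambda>h. k \<otimes> h \<otimes> inv k) ` H = (\<lambda>h. (g \<otimes> k) \<otimes> h \<otimes> inv (g \<otimes> k)) ` H"
    if "g \<in> carrier G" "k \<in> carrier G" for g k
  proof -
    have "g \<otimes> (k \<otimes> h \<otimes> inv k) \<otimes> inv g = (g \<otimes> k) \<otimes> h \<otimes> inv (g \<otimes> k)" if "h \<in> H" for h
      using that H \<open>g \<in> carrier G\<close> \<open>k \<in> carrier G\<close> by (auto simp: inv_mult_group m_assoc)
    then show ?thesis by (simp add: image_image cong: image_cong)
  qed
  show ?thesis
  proof (intro equalityI subsetI)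
    fix X assume "X \<in> subgroup_conj_class G ((\<lambda>h. k \<otimes> h \<otimes> inv k) ` H)"
    then obtain g where g: "g \<in> carrier G" "X = (\<lambda>h. g \<otimes> h \<otimes> inv g) ` (\<lambda>h. k \<otimes> h \<otimes> inv k) ` H"
      unfolding subgroup_conj_class_def by blast
    then show "X \<in> subgroup_conj_class G H"
      unfolding subgroup_conj_class_def g(2) *[OF g(1) k] using k by blast
  next
    fix X assume "X \<in> subgroup_conj_class G H"
    then obtain g where g: "g \<in> carrier G" "X = (\<lambda>h. g \<otimes> h \<otimes> inv g) ` H"
      unfolding subgroup_conj_class_def by blast
    have gk: "g \<otimes> inv k \<in> carrier G" using g k by simp
    have "(g \<otimes> inv k) \<otimes> k = g" using g k by (simp add: m_assoc)
    then have "X = (\<lambda>h. (g \<otimes> inv k) \<otimes> h \<otimes> inv (g \<otimes> inv k)) ` (\<lambda>h. k \<otimes> h \<otimes> inv k) ` H"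
      unfolding *[OF gk k] g(2) by simp
    then show "X \<in> subgroup_conj_class G ((\<lambda>h. k \<otimes> h \<otimes> inv k) ` H)"
      unfolding subgroup_conj_class_def using gk by blast
  qed
qed

context finite_coxeter_group
begin

abbreviation N where "N \<equiv> Delta2Grp S m"

lemma Delta2Grp_eq: "N = {\<Delta> [^]\<^bsub>A\<^esub> (2 * k :: int) | k. True}"
proof -
  have "\<Delta> \<cdot> \<Delta> = \<Delta> [^]\<^bsub>A\<^esub> (2::int)" using gar.int_pow_mult[of \<Delta> 1 1] by simp
  then show ?thesis
    using gar.generate_pow[of "\<Delta> \<cdot> \<Delta>"] by (simp add: Delta2Grp_def gar.int_pow_pow)
qed

lemma in_coset: "g \<in> carrier A \<Longrightarrow> h \<in> N #>\<^bsub>A\<^esub> g \<longleftrightarrow> (\<exists>k::int. h = g \<cdot> \<Delta> [^]\<^bsub>A\<^esub> (2 * k))"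
  by (auto simp: r_coset_def Delta2Grp_eq Delta_even_central)

lemma normal_N: "N \<lhd> A"
proof (rule gar.normalI)
  show "subgroup N A" unfolding Delta2Grp_def by (rule gar.generate_is_subgroup) simp
  show "\<forall>x\<in>carrier A. N #>\<^bsub>A\<^esub> x = x <#\<^bsub>A\<^esub> N"
    by (auto simp: r_coset_def l_coset_def Delta2Grp_eq Delta_even_central)
qed

lemma coset_self: "g \<in> carrier A \<Longrightarrow> g \<in> N #>\<^bsub>A\<^esub> g"
  unfolding in_coset by (rule exI[of _ 0]) simp

lemma coset_eq: "g \<in> carrier A \<Longrightarrow> h \<in> N #>\<^bsub>A\<^esub> g \<Longrightarrow> N #>\<^bsub>A\<^esub> h = N #>\<^bsub>A\<^esub> g"
  using gar.repr_independence[of h N g] normal_N normal_def by metis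

lemma Gq_group: "group (Gq S m)"
  unfolding Gq_def by (rule normal.factorgroup_is_group[OF normal_N])

lemma Gq_carrier: "carrier (Gq S m) = (\<lambda>g. N #>\<^bsub>A\<^esub> g) ` carrier A"
  unfolding Gq_def by (rule carrier_FactGroup)

lemma Gq_mult:
  "g \<in> carrier A \<Longrightarrow> h \<in> carrier A \<Longrightarrow>
    (N #>\<^bsub>A\<^esub> g) \<otimes>\<^bsub>Gq S m\<^esub> (N #>\<^bsub>A\<^esub> h) = N #>\<^bsub>A\<^esub> (g \<cdot> h)"
  unfolding Gq_def mult_FactGroup by (rule normal.rcos_sum[OF normal_N])

lemma Gq_one: "\<one>\<^bsub>Gq S m\<^esub> = N #>\<^bsub>A\<^esub> \<one>\<^bsub>A\<^esub>"
proof -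
  have "N \<subseteq> carrier A" by (auto simp: Delta2Grp_eq)
  then show ?thesis by (simp add: Gq_def gar.coset_mult_one)
qed

lemma Gq_inv:
  assumes g: "g \<in> carrier A" shows "inv\<^bsub>Gq S m\<^esub> (N #>\<^bsub>A\<^esub> g) = N #>\<^bsub>A\<^esub> (inv\<^bsub>A\<^esub> g)"
proof (rule group.inv_equality[OF Gq_group])
  show "(N #>\<^bsub>A\<^esub> inv\<^bsub>A\<^esub> g) \<otimes>\<^bsub>Gq S m\<^esub> (N #>\<^bsub>A\<^esub> g) = \<one>\<^bsub>Gq S m\<^esub>"
    using g by (simp add: Gq_mult Gq_one)
qed (use g in \<open>simp_all add: Gq_carrier\<close>)

text \<open>The preimage \<open>K\<close> of \<open>H\<close> is covered by one representative per
  coset up to even powers of \<Delta>, so \<open>ex_chain_orbit\<close> applies; the two positivity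
  conditions it yields say exactly that the element is an atom.\<close>

lemma ex_base_point:
  assumes H: "subgroup H (Gq S m)" "finite H"
  shows "\<exists>x\<in>carrier A. \<forall>h\<in>carrier A. N #>\<^bsub>A\<^esub> h \<in> H \<longrightarrow>
    (\<exists>j::int. atom S m (inv\<^bsub>A\<^esub> x \<cdot> h \<cdot> x \<cdot> \<Delta> [^]\<^bsub>A\<^esub> j))"
proof -
  define K where "K = {h \<in> carrier A. N #>\<^bsub>A\<^esub> h \<in> H}"
  have K: "subgroup K A"
  proof (rule gar.subgroupI)
    show "K \<noteq> {}" using subgroup.one_closed[OF H(1)] unfolding Gq_one K_def by blast
    show "inv\<^bsub>A\<^esub> h \<in> K" if "h \<in> K" for h
      using subgroup.m_inv_closed[OF H(1), of "N #>\<^bsub>A\<^esub> h"] that by (simp add: K_def Gq_inv)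
    show "g \<cdot> h \<in> K" if "g \<in> K" "h \<in> K" for g h
      using subgroup.m_closed[OF H(1), of "N #>\<^bsub>A\<^esub> g" "N #>\<^bsub>A\<^esub> h"] that by (simp add: K_def Gq_mult)
  qed (auto simp: K_def)
  define rep where "rep C = (SOME h. h \<in> carrier A \<and> C = N #>\<^bsub>A\<^esub> h)" for C
  have rep: "rep C \<in> carrier A" "C = N #>\<^bsub>A\<^esub> rep C" if "C \<in> H" for C
  proof -
    have "\<exists>h. h \<in> carrier A \<and> C = N #>\<^bsub>A\<^esub> h" using that subgroup.subset[OF H(1)] by (auto simp: Gq_carrier)
    from someI_ex[OF this] show "rep C \<in> carrier A" "C = N #>\<^bsub>A\<^esub> rep C" unfolding rep_def by blast+
  qed
  have "rep ` H \<subseteq> K"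
  proof
    fix h assume "h \<in> rep ` H"
    then obtain C where "C \<in> H" "h = rep C" by blast
    then show "h \<in> K" using rep[of C] by (simp add: K_def)
  qed
  moreover have "\<exists>r\<in>rep ` H. \<exists>i::int. h = r \<cdot> \<Delta> [^]\<^bsub>A\<^esub> i" if "h \<in> K" for h
  proof -
    define C where "C = N #>\<^bsub>A\<^esub> h"
    have C: "C \<in> H" "h \<in> C" using that coset_self by (simp_all add: K_def C_def)
    then have "h \<in> N #>\<^bsub>A\<^esub> rep C" using rep by blast
    then show ?thesis using in_coset rep(1)[OF C(1)] C(1) by blast
  qed
  ultimately obtain x where x: "x \<in> carrier A" "\<And>h. h \<in> K \<Longrightarrow> \<exists>j::int.
    inv\<^bsub>A\<^esub> x \<cdot> h \<cdot> x \<cdot> \<Delta> [^]\<^bsub>A\<^esub> j \<in> P \<and>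
    inv\<^bsub>A\<^esub> (inv\<^bsub>A\<^esub> x \<cdot> h \<cdot> x \<cdot> \<Delta> [^]\<^bsub>A\<^esub> j) \<cdot> \<Delta> \<in> P"
    using gar.ex_chain_orbit[OF K finite_imageI[OF H(2)]] by metis
  then show ?thesis unfolding atom_iff by (intro bexI[of _ x]) (simp_all add: K_def)
qed

text \<open>The union over the coset collapses to one vertex: even powers of \<Delta> are central
  and are swallowed by \<open>DeltaGrp\<close>.\<close>

lemma gact_vertex:
  assumes g: "g \<in> carrier A" and h: "h \<in> carrier A"
  shows "gact S m (N #>\<^bsub>A\<^esub> g) (h <#\<^bsub>A\<^esub> DeltaGrp S m) = (g \<cdot> h) <#\<^bsub>A\<^esub> DeltaGrp S m"
proof -
  have "g' <#\<^bsub>A\<^esub> (h <#\<^bsub>A\<^esub> DeltaGrp S m) = (g \<cdot> h) <#\<^bsub>A\<^esub> DeltaGrp S m"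
    if "g' \<in> N #>\<^bsub>A\<^esub> g" for g'
  proof -
    obtain k :: int where k: "g' = g \<cdot> \<Delta> [^]\<^bsub>A\<^esub> (2 * k)" using \<open>g' \<in> N #>\<^bsub>A\<^esub> g\<close> in_coset[OF g] by blast
    have "g' \<cdot> h = g \<cdot> h \<cdot> \<Delta> [^]\<^bsub>A\<^esub> (2 * k)"
      unfolding k using g h Delta_even_central[OF h, of k] by (simp add: gar.m_assoc)
    then show ?thesis using vertex_mult[of g' h] vertex_shift[of "g \<cdot> h" "2 * k"] g h k by simp
  qed
  then show ?thesis using coset_self[OF g] unfolding gact_def by blast
qed

text \<open>The simplex is the orbit of the vertex of \<open>x\<close>, invariant by construction.
  Two of its vertices, those of \<open>b \<cdot> x\<close> and \<open>c \<cdot> x\<close>, are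
  compared by applying the choice of \<open>x\<close> to the quotient of \<open>b\<close> and
  \<open>c\<close>, again in the preimage of \<open>H\<close>.\<close>

theorem ex_invariant_simplex:
  assumes H: "subgroup H (Gq S m)" "finite H"
  shows "\<exists>\<sigma>. simplex S m \<sigma> \<and> (\<forall>h\<in>H. gact S m h ` \<sigma> = \<sigma>)"
proof -
  obtain x where x: "x \<in> carrier A" "\<And>h. h \<in> carrier A \<Longrightarrow> N #>\<^bsub>A\<^esub> h \<in> H \<Longrightarrow>
    \<exists>j::int. atom S m (inv\<^bsub>A\<^esub> x \<cdot> h \<cdot> x \<cdot> \<Delta> [^]\<^bsub>A\<^esub> j)"
    using ex_base_point[OF H] by blast
  define v where "v = x <#\<^bsub>A\<^esub> DeltaGrp S m"
  define \<sigma> where "\<sigma> = (\<lambda>C. gact S m C v) ` H"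
  have HE: "\<exists>h\<in>carrier A. C = N #>\<^bsub>A\<^esub> h" if "C \<in> H" for C
    using that subgroup.subset[OF H(1)] by (auto simp: Gq_carrier)
  have gv: "gact S m (N #>\<^bsub>A\<^esub> h) v = (h \<cdot> x) <#\<^bsub>A\<^esub> DeltaGrp S m" if "h \<in> carrier A" for h
    unfolding v_def by (rule gact_vertex[OF that x(1)])
  have gg: "gact S m B (gact S m C v) = gact S m (B \<otimes>\<^bsub>Gq S m\<^esub> C) v" if BC: "B \<in> H" "C \<in> H" for B C
  proof -
    obtain b where b: "b \<in> carrier A" "B = N #>\<^bsub>A\<^esub> b" using HE[OF BC(1)] by blast
    obtain c where c: "c \<in> carrier A" "C = N #>\<^bsub>A\<^esub> c" using HE[OF BC(2)] by blast
    show ?thesis using b c x(1) by (simp add: gv Gq_mult gact_vertex gar.m_assoc)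
  qed
  have "simplex S m \<sigma>" unfolding simplex_def
  proof (intro conjI ballI impI)
    show "\<sigma> \<subseteq> verts S m"
    proof
      fix w assume "w \<in> \<sigma>"
      then obtain C where "C \<in> H" "w = gact S m C v" by (auto simp: \<sigma>_def)
      moreover then obtain h where "h \<in> carrier A" "C = N #>\<^bsub>A\<^esub> h" using HE by blast
      ultimately show "w \<in> verts S m" using gv x(1) unfolding verts_def by blast
    qed
    show "finite \<sigma>" "\<sigma> \<noteq> {}" using H subgroup.one_closed[OF H(1)] by (auto simp: \<sigma>_def)
    fix w w' assume w: "w \<in> \<sigma>" "w' \<in> \<sigma>" "w \<noteq> w'"
    obtain B where B: "B \<in> H" "w = gact S m B v" using w(1) by (auto simp: \<sigma>_def)
    obtain C where C: "C \<in> H" "w' = gact S m C v" using w(2) by (auto simp: \<sigma>_def)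
    obtain b where b: "b \<in> carrier A" "B = N #>\<^bsub>A\<^esub> b" using HE[OF B(1)] by blast
    obtain c where c: "c \<in> carrier A" "C = N #>\<^bsub>A\<^esub> c" using HE[OF C(1)] by blast
    have "inv\<^bsub>Gq S m\<^esub> B \<otimes>\<^bsub>Gq S m\<^esub> C \<in> H"
      using subgroup.m_closed[OF H(1) subgroup.m_inv_closed[OF H(1) B(1)] C(1)] .
    then have "N #>\<^bsub>A\<^esub> (inv\<^bsub>A\<^esub> b \<cdot> c) \<in> H" using b c by (simp add: Gq_inv Gq_mult)
    then obtain j :: int where
      j: "atom S m (inv\<^bsub>A\<^esub> x \<cdot> (inv\<^bsub>A\<^esub> b \<cdot> c) \<cdot> x \<cdot> \<Delta> [^]\<^bsub>A\<^esub> j)"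
      using x(2)[of "inv\<^bsub>A\<^esub> b \<cdot> c"] b c by auto
    define a where "a = inv\<^bsub>A\<^esub> x \<cdot> (inv\<^bsub>A\<^esub> b \<cdot> c) \<cdot> x \<cdot> \<Delta> [^]\<^bsub>A\<^esub> j"
    have bx: "b \<cdot> x \<in> carrier A" using b x by simp
    have "b \<cdot> x \<cdot> a = c \<cdot> x \<cdot> \<Delta> [^]\<^bsub>A\<^esub> j"
      unfolding a_def using b c x(1) by (simp add: gar.m_assoc)
    then have "(b \<cdot> x \<cdot> a) <#\<^bsub>A\<^esub> DeltaGrp S m = (c \<cdot> x) <#\<^bsub>A\<^esub> DeltaGrp S m"
      using c x(1) by (simp add: vertex_shift)
    also have "\<dots> = w'" using C c gv by simp
    finally show "d_at S m w w' = 1"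
      using d_at_eq_1[OF bx j[folded a_def] _ _ w(3)] B b gv by simp
  qed
  moreover have "gact S m B ` \<sigma> = \<sigma>" if B: "B \<in> H" for B
  proof (intro equalityI subsetI)
    fix w assume "w \<in> gact S m B ` \<sigma>"
    then obtain C where C: "C \<in> H" "w = gact S m B (gact S m C v)" by (auto simp: \<sigma>_def)
    then show "w \<in> \<sigma>" using gg[OF B C(1)] subgroup.m_closed[OF H(1) B C(1)] by (auto simp: \<sigma>_def)
  next
    fix w assume "w \<in> \<sigma>"
    then obtain C where C: "C \<in> H" "w = gact S m C v" by (auto simp: \<sigma>_def)
    define E where "E = inv\<^bsub>Gq S m\<^esub> B \<otimes>\<^bsub>Gq S m\<^esub> C"
    have E: "E \<in> H" unfolding E_def
      using subgroup.m_closed[OF H(1) subgroup.m_inv_closed[OF H(1) B] C(1)] .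
    have "B \<in> carrier (Gq S m)" "C \<in> carrier (Gq S m)" using subgroup.mem_carrier[OF H(1)] B C by simp_all
    then have "B \<otimes>\<^bsub>Gq S m\<^esub> E = C"
      unfolding E_def using group.inv_solve_left'[OF Gq_group, of E C B]
      by (simp add: group.inv_closed[OF Gq_group] group.is_monoid[OF Gq_group] monoid.m_assoc[symmetric]
          group.r_inv[OF Gq_group] monoid.l_one)
    then have "w = gact S m B (gact S m E v)" using gg[OF B E] C by simp
    then show "w \<in> gact S m B ` \<sigma>" using E by (auto simp: \<sigma>_def)
  qed
  ultimately show ?thesis by blast
qed

lemma finite_atoms: "finite {a. atom S m a}"
proof (rule finite_subset)
  show "{a. atom S m a} \<subseteq> (\<lambda>w. pw (rw w)) ` W"
  proof
    fix a assume "a \<in> {a. atom S m a}"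
    then have a: "atom S m a" by simp
    then obtain u where u: "set u \<subseteq> S" "a = pw u" using artin_posE[OF atom_P] by metis
    then have "length u = len (ev u)" using a atom_pw by simp
    then have "a = pw (rw (ev u))" using pw_cong[OF rw_ev[OF u(1)]] u(2) by simp
    then show "a \<in> (\<lambda>w. pw (rw w)) ` W" using u(1) by simp
  qed
qed (simp add: finite_W)

text \<open>Conjugation by the inverse of the base point carries every finite subgroup into one
  fixed finite set \<open>F\<close>, which has finitely many subsets.\<close>

theorem finite_conj_classes:
  "finite {subgroup_conj_class (Gq S m) H | H. subgroup H (Gq S m) \<and> finite H}"
proof (rule finite_subset)
  define F where "F = (\<lambda>(a, j). N #>\<^bsub>A\<^esub> (a \<cdot> \<Delta> [^]\<^bsub>A\<^esub> (j::int))) ` ({a. atom S m a} \<times> {0, 1})"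
  have "finite F" using finite_atoms by (simp add: F_def)
  then show "finite (subgroup_conj_class (Gq S m) ` Pow F)" by simp
  show "{subgroup_conj_class (Gq S m) H | H. subgroup H (Gq S m) \<and> finite H} \<subseteq> subgroup_conj_class (Gq S m) ` Pow F"
  proof
    fix X assume "X \<in> {subgroup_conj_class (Gq S m) H | H. subgroup H (Gq S m) \<and> finite H}"
    then obtain H where H: "subgroup H (Gq S m)" "finite H" "X = subgroup_conj_class (Gq S m) H" by blast
    obtain x where x: "x \<in> carrier A" "\<And>h. h \<in> carrier A \<Longrightarrow> N #>\<^bsub>A\<^esub> h \<in> H \<Longrightarrow>
      \<exists>j::int. atom S m (inv\<^bsub>A\<^esub> x \<cdot> h \<cdot> x \<cdot> \<Delta> [^]\<^bsub>A\<^esub> j)"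
      using ex_base_point[OF H(1,2)] by blast
    define k where "k = N #>\<^bsub>A\<^esub> (inv\<^bsub>A\<^esub> x)"
    have k: "k \<in> carrier (Gq S m)" using x(1) by (auto simp: k_def Gq_carrier)
    define H' where "H' = (\<lambda>h. k \<otimes>\<^bsub>Gq S m\<^esub> h \<otimes>\<^bsub>Gq S m\<^esub> inv\<^bsub>Gq S m\<^esub> k) ` H"
    have "C \<in> F" if C: "C \<in> H'" for C
    proof -
      obtain B where B: "B \<in> H" "C = k \<otimes>\<^bsub>Gq S m\<^esub> B \<otimes>\<^bsub>Gq S m\<^esub> inv\<^bsub>Gq S m\<^esub> k" using C by (auto simp: H'_def)
      obtain h where h: "h \<in> carrier A" "B = N #>\<^bsub>A\<^esub> h"
        using subgroup.subset[OF H(1)] B(1) by (auto simp: Gq_carrier)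
      obtain j :: int where j: "atom S m (inv\<^bsub>A\<^esub> x \<cdot> h \<cdot> x \<cdot> \<Delta> [^]\<^bsub>A\<^esub> j)"
        using x(2)[OF h(1)] B(1) h(2) by auto
      define a where "a = inv\<^bsub>A\<^esub> x \<cdot> h \<cdot> x \<cdot> \<Delta> [^]\<^bsub>A\<^esub> j"
      have a: "atom S m a" "a \<in> carrier A" using j atom_carrier by (simp_all add: a_def)
      define y where "y = inv\<^bsub>A\<^esub> x \<cdot> h \<cdot> x"
      have y: "y \<in> carrier A" using x(1) h(1) by (simp add: y_def)
      have Cy: "C = N #>\<^bsub>A\<^esub> y"
        unfolding B(2) h(2) k_def y_def using x(1) h(1) by (simp add: Gq_mult Gq_inv)
      \<comment> \<open>Solving for \<open>y\<close> gives the exponent \<open>- j\<close>, and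
        modulo \<Delta>^2 this is \<open>j mod 2\<close>.\<close>
      have "a \<cdot> \<Delta> [^]\<^bsub>A\<^esub> (j mod 2) = y \<cdot> \<Delta> [^]\<^bsub>A\<^esub> (j + j mod 2)"
        unfolding a_def y_def[symmetric] using gar.D_pow_cancel[OF y] .
      moreover have "even (j + j mod 2)" by (cases "even j") (simp_all add: odd_iff_mod_2_eq_one)
      then obtain i where "j + j mod 2 = 2 * i" by (rule evenE)
      ultimately have "a \<cdot> \<Delta> [^]\<^bsub>A\<^esub> (j mod 2) \<in> N #>\<^bsub>A\<^esub> y" using in_coset[OF y] by auto
      then have "C = N #>\<^bsub>A\<^esub> (a \<cdot> \<Delta> [^]\<^bsub>A\<^esub> (j mod 2))" using coset_eq[OF y] Cy by simp
      moreover have "j mod 2 \<in> {0, 1}" by auto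
      ultimately show "C \<in> F" using a(1) unfolding F_def by force
    qed
    moreover have "X = subgroup_conj_class (Gq S m) H'"
      unfolding H(3) H'_def
      by (rule group.subgroup_conj_class_conj[OF Gq_group subgroup.subset[OF H(1)] k, symmetric])
    ultimately show "X \<in> subgroup_conj_class (Gq S m) ` Pow F" by blast
  qed
qed

end

section \<open>The regular representation of the Coxeter group\<close>

text \<open>Left multiplication by \<open>s\<close>, extended by the identity outside the Coxeter
  group so that it is a bijection of the whole type.\<close>

definition regular :: "'a set \<Rightarrow> ('a \<Rightarrow> 'a \<Rightarrow> nat) \<Rightarrow> 'a \<Rightarrow> 'a list set \<Rightarrow> 'a list set" where
  "regular S m s X = (if s \<in> S \<and> X \<in> coxeter_elems S m then cox_rel S m `` ((#) s ` X) else X)"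

lemma cox_class_eq_iff:
  assumes "set v \<subseteq> S"
  shows "cox_rel S m `` {u} = cox_rel S m `` {v} \<longleftrightarrow> cox_eq S m u v"
proof
  assume "cox_rel S m `` {u} = cox_rel S m `` {v}"
  moreover have "v \<in> cox_rel S m `` {v}" using assms by (simp add: cox_rel_def cox_eq.refl)
  ultimately show "cox_eq S m u v" by (auto simp: cox_rel_def)
next
  assume "cox_eq S m u v"
  then show "cox_rel S m `` {u} = cox_rel S m `` {v}"
    unfolding cox_rel_def set_eq_iff by simp (metis cox_eq.sym cox_eq.trans)
qed

lemma regular_class:
  assumes "s \<in> S" "set u \<subseteq> S"
  shows "regular S m s (cox_rel S m `` {u}) = cox_rel S m `` {s # u}"
proof -
  have "cox_rel S m `` {u} \<in> coxeter_elems S m" using assms(2) by (auto simp: coxeter_elems_def quotient_def)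
  moreover have "w \<in> cox_rel S m `` ((#) s ` (cox_rel S m `` {u})) \<longleftrightarrow> w \<in> cox_rel S m `` {s # u}" for w
  proof
    assume "w \<in> cox_rel S m `` ((#) s ` (cox_rel S m `` {u}))"
    then obtain x where x: "cox_eq S m u x" "cox_eq S m (s # x) w" by (auto simp: cox_rel_def)
    then have "cox_eq S m (s # u) (s # x)"
      using cox_eq_append[OF cox_eq.refl[of "[s]" S m] x(1)] assms by simp
    then have "cox_eq S m (s # u) w" using x(2) by (rule cox_eq.trans)
    then show "w \<in> cox_rel S m `` {s # u}" by (simp add: cox_rel_def)
  next
    assume "w \<in> cox_rel S m `` {s # u}"
    moreover have "u \<in> cox_rel S m `` {u}" using assms by (simp add: cox_rel_def cox_eq.refl)
    ultimately show "w \<in> cox_rel S m `` ((#) s ` (cox_rel S m `` {u}))" by blast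
  qed
  ultimately show ?thesis using assms(1) by (auto simp: regular_def)
qed

lemma coxeter_elemsE:
  assumes "X \<in> coxeter_elems S m" obtains u where "set u \<subseteq> S" "X = cox_rel S m `` {u}"
  using assms by (auto simp: coxeter_elems_def quotient_def)

lemma regular_regular: "regular S m s (regular S m s X) = X"
proof (cases "s \<in> S \<and> X \<in> coxeter_elems S m")
  case True
  then obtain u where u: "set u \<subseteq> S" "X = cox_rel S m `` {u}" by (auto elim: coxeter_elemsE)
  have "cox_eq S m ([] @ [s, s] @ u) ([] @ u)" using True u by (intro cox_eq.square) auto
  then have "cox_rel S m `` {s # s # u} = cox_rel S m `` {u}"
    using cox_class_eq_iff[OF u(1), of m "s # s # u"] by simp
  then show ?thesis using True u by (simp add: regular_class)
qed (simp only: regular_def if_False)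

lemma bij_regular: "bij (regular S m s)"
  by (rule o_bij[of "regular S m s"]) (simp_all add: fun_eq_iff regular_regular)

definition regular_gen :: "'a set \<Rightarrow> ('a \<Rightarrow> 'a \<Rightarrow> nat) \<Rightarrow> 'a \<Rightarrow> 'a list set bijection" where
  "regular_gen S m s = Abs_bijection (regular S m s)"

lemma Rep_plus: "Rep_bijection (f + g) = Rep_bijection f \<circ> Rep_bijection g"
  using Rep_bijection[of f] Rep_bijection[of g]
  by (simp add: plus_bijection_def Abs_bijection_inverse bij_comp)

lemma Rep_zero: "Rep_bijection 0 = id"
  by (simp add: zero_bijection_def Abs_bijection_inverse)

lemma regular_gen_word:
  assumes "set v \<subseteq> S"
  shows "set u \<subseteq> S \<Longrightarrow>
    Rep_bijection (sum_list (map (regular_gen S m) u)) (cox_rel S m `` {v}) = cox_rel S m `` {u @ v}"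
proof (induction u)
  case (Cons s u)
  then show ?case using assms
    by (simp add: Rep_plus regular_gen_def Abs_bijection_inverse bij_regular regular_class)
qed (simp add: Rep_zero)

lemma Rep_regular_outside:
  "X \<notin> coxeter_elems S m \<Longrightarrow> Rep_bijection (sum_list (map (regular_gen S m) u)) X = X"
  by (induction u)
    (simp_all add: Rep_plus Rep_zero regular_gen_def Abs_bijection_inverse bij_regular regular_def)

text \<open>The regular representation is faithful because a word sends the class of the empty word
  to its own class.\<close>

lemma regular_gen_eq_iff:
  assumes "set u \<subseteq> S" "set v \<subseteq> S"
  shows "sum_list (map (regular_gen S m) u) = sum_list (map (regular_gen S m) v) \<longleftrightarrow> cox_eq S m u v"
    (is "?U = ?V \<longleftrightarrow> _")
proof
  assume "?U = ?V"
  then have "cox_rel S m `` {u @ []} = cox_rel S m `` {v @ []}"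
    using regular_gen_word[of "[]" S u m] regular_gen_word[of "[]" S v m] assms by simp
  then show "cox_eq S m u v" using cox_class_eq_iff[OF assms(2)] by simp
next
  assume eq: "cox_eq S m u v"
  have "Rep_bijection ?U X = Rep_bijection ?V X" for X
  proof (cases "X \<in> coxeter_elems S m")
    case True
    then obtain w where w: "set w \<subseteq> S" "X = cox_rel S m `` {w}" by (rule coxeter_elemsE)
    have "cox_eq S m (u @ w) (v @ w)" by (rule cox_eq_append[OF eq cox_eq.refl[OF w(1)]])
    then have "cox_rel S m `` {u @ w} = cox_rel S m `` {v @ w}"
      using cox_class_eq_iff[of "v @ w" S m "u @ w"] assms w by simp
    then show ?thesis using regular_gen_word[OF w(1)] assms w(2) by simp
  qed (simp add: Rep_regular_outside)
  then show "?U = ?V" by (simp add: Rep_bijection_inject[symmetric] fun_eq_iff)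
qed

lemma finite_coxeter_group_regular:
  assumes "finite_type S m"
  shows "finite_coxeter_group S m (regular_gen S m)"
proof -
  interpret coxeter_group S m "regular_gen S m"
    using assms regular_gen_eq_iff by unfold_locales (auto simp: finite_type_def)
  have "finite ((\<lambda>X. ev (SOME u. u \<in> X)) ` coxeter_elems S m)"
    using assms by (simp add: finite_type_def)
  moreover have "W \<subseteq> (\<lambda>X. ev (SOME u. u \<in> X)) ` coxeter_elems S m"
  proof
    fix g assume "g \<in> W"
    then obtain u where u: "set u \<subseteq> S" "g = ev u" by (auto simp: W_def)
    define X where "X = cox_rel S m `` {u}"
    have "u \<in> X" using u by (simp add: X_def cox_rel_def cox_eq.refl)
    then have "(SOME u. u \<in> X) \<in> X" by (rule someI)
    then have "ev u = ev (SOME u. u \<in> X)" by (intro evI) (simp add: X_def cox_rel_def)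
    moreover have "X \<in> coxeter_elems S m" using u by (auto simp: X_def coxeter_elems_def quotient_def)
    ultimately show "g \<in> (\<lambda>X. ev (SOME u. u \<in> X)) ` coxeter_elems S m" using u(2) by simp
  qed
  ultimately have "finite W" by (rule finite_subset[rotated])
  then show ?thesis by unfold_locales
qed

theorem theorem3p12:
  fixes S :: "'a set" and m :: "'a \<Rightarrow> 'a \<Rightarrow> nat"
  assumes "finite_type S m"
  shows "(\<forall>H. subgroup H (Gq S m) \<and> finite H \<longrightarrow>
            (\<exists>\<sigma>. simplex S m \<sigma> \<and> (\<forall>h\<in>H. gact S m h ` \<sigma> = \<sigma>)))
       \<and> finite {subgroup_conj_class (Gq S m) H | H. subgroup H (Gq S m) \<and> finite H}"
proof -
  interpret finite_coxeter_group S m "regular_gen S m"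
    by (rule finite_coxeter_group_regular[OF assms])
  show ?thesis using ex_invariant_simplex finite_conj_classes by blast
qed

end
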